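(* Let $\succ$ be a binary relation on $\mathcal{F}$. Then $\succ$ satisfies Axioms A1–A7 below if and only if there exist a non-constant affine function $u:X\to\mathbb{R}$, unique up to positive affine transformation, and a unique pair $(C,D)$ of non-disjoint (i.e. $C\cap D\neq\emptyset$) convex, compact subsets of $\Delta$ such that, for all $f,g\in\mathcal{F}$, $$f\succ g \iff \begin{cases}\min_{p\in C}\int u(f)\,dp>\min_{p\in C}\int u(g)\,dp,\\ \max_{p\in D}\int u(f)\,dp>\max_{p\in D}\int u(g)\,dp.\end{cases}$$ The axioms are: (A1) $\succ$ is asymmetric and transitive, and the restriction of $\succ$ to $X$ is non-trivial and negatively transitive (for all $x,y,z\in X$, $x\not\succ y$ and $y\not\succ z$ imply $x\not\succ z$). (A2) For all $f,g,h\in\mathcal{F}$, the sets $\{\alpha\in[0,1]:\alpha f+(1-\alpha)g\succ h\}$ and $\{\alpha\in[0,1]:h\succ\alpha f+(1-\alpha)g\}$ are open (relative to $[0,1]$). (A3) For all $f,g\in\mathcal{F}$, $x\in X$, $\alpha\in(0,1)$: $f\succ g$ iff $\alpha f+(1-\alpha)x\succ\alpha g+(1-\alpha)x$. (A4) For all $x\in X$, the sets $\{f\in\mathcal{F}:f\succ x\}$ and $\{f\in\mathcal{F}:x\succ f\}$ are convex. (A5) For all $f,g\in\mathcal{F}$, if $f(s)\succ g(s)$ for all $s\in S$, then $f\succ g$. (A6) For all $f,g\in\mathcal{F}$, if for all $x\in X$, $f\Join x$ implies $g\Join x$, then $f\Join g$. (A7) For all $f,g\in\mathcal{F}$ and $x,y\in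 X$, if $f\Join x$, $x\succ g$, $g\Join y$ and $f\succ y$, then $f\succ g$.
   Context: $S$ is a set of states with an algebra $\Sigma$ of subsets; $X$ is a non-singleton convex subset of a real vector space. $\mathcal{F}$ is the set of simple acts: $\Sigma$-measurable functions $f:S\to X$ taking finitely many values. Mixtures are pointwise: $(\alpha f+(1-\alpha)g)(s)=\alpha f(s)+(1-\alpha)g(s)$. Each $x\in X$ is identified with the constant act equal to $x$. $\Delta$ is the set of finitely additive probability measures on $(S,\Sigma)$ with the weak* topology (convergence $p_n\to p$ iff $\int\varphi\,dp_n\to\int\varphi\,dp$ for every bounded measurable $\varphi:S\to\mathbb{R}$). For $f,g\in\mathcal{F}$, $f\Join g$ means $f\not\succ g$ and $g\not\succ f$. For $u:X\to\mathbb{R}$, $u(f)$ denotes $s\mapsto u(f(s))$. *)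

theory Defs
  imports "HOL-Analysis.Analysis"
begin

text \<open>States: the universe of type 's.  Outcomes: a subset X of a real vector space 'x.\<close>

definition acts :: "'s set set \<Rightarrow> 'x set \<Rightarrow> ('s \<Rightarrow> 'x) set" where
  "acts \<Sigma> X = {f. (\<forall>s. f s \<in> X) \<and> finite (range f) \<and> (\<forall>x. f -` {x} \<in> \<Sigma>)}"

definition cact :: "'x \<Rightarrow> ('s \<Rightarrow> 'x)" where
  "cact x = (\<lambda>_. x)"

definition mix :: "real \<Rightarrow> ('s \<Rightarrow> 'x::real_vector) \<Rightarrow> ('s \<Rightarrow> 'x) \<Rightarrow> ('s \<Rightarrow> 'x)" where
  "mix a f g = (\<lambda>s. a *\<^sub>R f s + (1 - a) *\<^sub>R g s)"

definition fa_probs :: "'s set set \<Rightarrow> ('s set \<Rightarrow> real) set" where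
  "fa_probs \<Sigma> = {p. p UNIV = 1 \<and> (\<forall>A\<in>\<Sigma>. p A \<ge> 0) \<and>
      (\<forall>A\<in>\<Sigma>. \<forall>B\<in>\<Sigma>. A \<inter> B = {} \<longrightarrow> p (A \<union> B) = p A + p B) \<and>
      (\<forall>A. A \<notin> \<Sigma> \<longrightarrow> p A = 0)}"

definition simple_fn :: "'s set set \<Rightarrow> ('s \<Rightarrow> real) \<Rightarrow> bool" where
  "simple_fn \<Sigma> \<psi> \<longleftrightarrow> finite (range \<psi>) \<and> (\<forall>y. \<psi> -` {y} \<in> \<Sigma>)"

definition simple_integral :: "('s set \<Rightarrow> real) \<Rightarrow> ('s \<Rightarrow> real) \<Rightarrow> real" where
  "simple_integral p \<psi> = (\<Sum>y\<in>range \<psi>. y * p (\<psi> -` {y}))"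

definition bmeas :: "'s set set \<Rightarrow> ('s \<Rightarrow> real) \<Rightarrow> bool" where
  "bmeas \<Sigma> \<phi> \<longleftrightarrow> bounded (range \<phi>) \<and> (\<forall>t. {s. \<phi> s > t} \<in> \<Sigma>)"

text \<open>Integral of a bounded measurable function w.r.t. a finitely additive probability
  (lower Darboux-type integral via simple functions; agrees with the simple integral
  on simple functions).\<close>
definition fa_integral :: "'s set set \<Rightarrow> ('s set \<Rightarrow> real) \<Rightarrow> ('s \<Rightarrow> real) \<Rightarrow> real" where
  "fa_integral \<Sigma> p \<phi> =
     Sup {simple_integral p \<psi> | \<psi>. simple_fn \<Sigma> \<psi> \<and> (\<forall>s. \<psi> s \<le> \<phi> s)}"

text \<open>Weak* topology on Delta: the coarsest topology making all maps
  p \<mapsto> \<integral>\<phi> dp (\<phi> bounded measurable) continuous.\<close>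
definition weak_star :: "'s set set \<Rightarrow> ('s set \<Rightarrow> real) topology" where
  "weak_star \<Sigma> = pullback_topology (fa_probs \<Sigma>)
      (\<lambda>p. restrict (\<lambda>\<phi>. fa_integral \<Sigma> p \<phi>) (Collect (bmeas \<Sigma>)))
      (product_topology (\<lambda>_. euclideanreal) (Collect (bmeas \<Sigma>)))"

definition convex_probs :: "('s set \<Rightarrow> real) set \<Rightarrow> bool" where
  "convex_probs C \<longleftrightarrow> (\<forall>p\<in>C. \<forall>q\<in>C. \<forall>a\<in>{0..1}. (\<lambda>A. a * p A + (1 - a) * q A) \<in> C)"

definition affine_on :: "'x::real_vector set \<Rightarrow> ('x \<Rightarrow> real) \<Rightarrow> bool" where
  "affine_on X u \<longleftrightarrow> (\<forall>x\<in>X. \<forall>y\<in>X. \<forall>a\<in>{0..1}. u (a *\<^sub>R x + (1 - a) *\<^sub>R y) = a * u x + (1 - a) * u y)"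

definition incomp :: "(('s \<Rightarrow> 'x) \<Rightarrow> ('s \<Rightarrow> 'x) \<Rightarrow> bool) \<Rightarrow> ('s \<Rightarrow> 'x) \<Rightarrow> ('s \<Rightarrow> 'x) \<Rightarrow> bool" where
  "incomp P f g \<longleftrightarrow> \<not> P f g \<and> \<not> P g f"

definition axioms_A1_A7 :: "'s set set \<Rightarrow> 'x::real_vector set \<Rightarrow> (('s \<Rightarrow> 'x) \<Rightarrow> ('s \<Rightarrow> 'x) \<Rightarrow> bool) \<Rightarrow> bool" where
  "axioms_A1_A7 \<Sigma> X P \<longleftrightarrow>
    \<comment> \<open>A1\<close>
    (\<forall>f\<in>acts \<Sigma> X. \<forall>g\<in>acts \<Sigma> X. P f g \<longrightarrow> \<not> P g f) \<and>
    (\<forall>f\<in>acts \<Sigma> X. \<forall>g\<in>acts \<Sigma> X. \<forall>h\<in>acts \<Sigma> X. P f g \<and> P g h \<longrightarrow> P f h) \<and>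
    (\<exists>x\<in>X. \<exists>y\<in>X. P (cact x) (cact y)) \<and>
    (\<forall>x\<in>X. \<forall>y\<in>X. \<forall>z\<in>X. \<not> P (cact x) (cact y) \<and> \<not> P (cact y) (cact z) \<longrightarrow> \<not> P (cact x) (cact z)) \<and>
    \<comment> \<open>A2\<close>
    (\<forall>f\<in>acts \<Sigma> X. \<forall>g\<in>acts \<Sigma> X. \<forall>h\<in>acts \<Sigma> X.
       openin (top_of_set {0..1}) {a\<in>{0..1::real}. P (mix a f g) h} \<and>
       openin (top_of_set {0..1}) {a\<in>{0..1::real}. P h (mix a f g)}) \<and>
    \<comment> \<open>A3\<close>
    (\<forall>f\<in>acts \<Sigma> X. \<forall>g\<in>acts \<Sigma> X. \<forall>x\<in>X. \<forall>a\<in>{0<..<1}.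
       P f g \<longleftrightarrow> P (mix a f (cact x)) (mix a g (cact x))) \<and>
    \<comment> \<open>A4\<close>
    (\<forall>x\<in>X. \<forall>f\<in>acts \<Sigma> X. \<forall>g\<in>acts \<Sigma> X. \<forall>a\<in>{0..1}.
       (P f (cact x) \<and> P g (cact x) \<longrightarrow> P (mix a f g) (cact x)) \<and>
       (P (cact x) f \<and> P (cact x) g \<longrightarrow> P (cact x) (mix a f g))) \<and>
    \<comment> \<open>A5\<close>
    (\<forall>f\<in>acts \<Sigma> X. \<forall>g\<in>acts \<Sigma> X. (\<forall>s. P (cact (f s)) (cact (g s))) \<longrightarrow> P f g) \<and>
    \<comment> \<open>A6\<close>
    (\<forall>f\<in>acts \<Sigma> X. \<forall>g\<in>acts \<Sigma> X.
       (\<forall>x\<in>X. incomp P f (cact x) \<longrightarrow> incomp P g (cact x)) \<longrightarrow> incomp P f g) \<and>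
    \<comment> \<open>A7\<close>
    (\<forall>f\<in>acts \<Sigma> X. \<forall>g\<in>acts \<Sigma> X. \<forall>x\<in>X. \<forall>y\<in>X.
       incomp P f (cact x) \<and> P (cact x) g \<and> incomp P g (cact y) \<and> P f (cact y) \<longrightarrow> P f g)"

definition represents :: "'s set set \<Rightarrow> 'x::real_vector set \<Rightarrow> (('s \<Rightarrow> 'x) \<Rightarrow> ('s \<Rightarrow> 'x) \<Rightarrow> bool)
    \<Rightarrow> ('x \<Rightarrow> real) \<Rightarrow> ('s set \<Rightarrow> real) set \<Rightarrow> ('s set \<Rightarrow> real) set \<Rightarrow> bool" where
  "represents \<Sigma> X P u C D \<longleftrightarrow>
     affine_on X u \<and> (\<exists>x\<in>X. \<exists>y\<in>X. u x \<noteq> u y) \<and>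
     C \<subseteq> fa_probs \<Sigma> \<and> D \<subseteq> fa_probs \<Sigma> \<and> C \<inter> D \<noteq> {} \<and>
     convex_probs C \<and> convex_probs D \<and>
     compactin (weak_star \<Sigma>) C \<and> compactin (weak_star \<Sigma>) D \<and>
     (\<forall>f\<in>acts \<Sigma> X. \<forall>g\<in>acts \<Sigma> X.
        P f g \<longleftrightarrow>
          ((INF p\<in>C. fa_integral \<Sigma> p (u \<circ> f)) > (INF p\<in>C. fa_integral \<Sigma> p (u \<circ> g)) \<and>
           (SUP p\<in>D. fa_integral \<Sigma> p (u \<circ> f)) > (SUP p\<in>D. fa_integral \<Sigma> p (u \<circ> g))))"

end

theory Submission
  imports Defs "HOL-Library.Function_Algebras"
begin

text \<open>
  Comparisons with constants determine everything: \<open>f \<succ> x\<close> holds iff \<open>u x\<close> lies below a number \<open>K (u f)\<close>,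
  and \<open>x \<succ> f\<close> iff \<open>u x\<close> lies above a number \<open>- M (- u f)\<close>. The axioms make \<open>K\<close> and \<open>M\<close>
  monotone, normalised, superlinear functionals on simple functions (lower previsions), so by
  Hahn-Banach each is the lower envelope of its core, a weak* compact convex set of finitely additive
  probabilities; \<open>K \<le> - M (- \<cdot>)\<close> and the sandwich theorem make the two cores intersect.
  Axiom A7, applied with \<open>u x = - M (- u f)\<close> and \<open>u y = K (u g)\<close>, yields \<open>f \<succ> g\<close> from the two
  strict inequalities, and transitivity with openness yields the converse. Uniqueness of the sets is
  separation of a point from a compact convex set by a simple function.
\<close>

section \<open>Hahn-Banach for sublinear functionals on a subspace\<close>

text \<open>Acts only reach utility profiles with values in the range of \<open>u\<close>, whereas
  duality needs functionals on a whole vector space. Normalising \<open>u\<close> to attain 1 and -1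
  makes every simple function, once shrunk, the profile of an act, and A3 with the outcome of
  utility 0 makes the comparison independent of the factor. Each property of \<open>K\<close> then
  has its source: A3 gives homogeneity and translation, A4 superadditivity, A5 with A2 and
  transitivity monotonicity, A2 the strict inequality in the comparison with constants. Maxima over
  \<open>D\<close> enter only through the conjugate of a lower functional because the axioms are
  self-dual: reversing the preference turns every statement about \<open>K\<close> into one about
  \<open>M\<close>. Simple functions do not form a type of their own, so functions are made a real
  vector space and Hahn-Banach is set on a subspace.\<close>

instantiation "fun" :: (type, scaleR) scaleR
begin

definition "c *\<^sub>R f = (\<lambda>x. c *\<^sub>R f x)"
instance ..

end

lemma scaleR_fun_apply [simp]: "(c *\<^sub>R f) x = c *\<^sub>R f x"
  by (simp add: scaleR_fun_def)

instance "fun" :: (type, real_vector) real_vector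
  by standard (simp_all add: fun_eq_iff algebra_simps)

definition sublinear_on :: "'v::real_vector set \<Rightarrow> ('v \<Rightarrow> real) \<Rightarrow> bool" where
  "sublinear_on V q \<longleftrightarrow>
     (\<forall>x\<in>V. \<forall>y\<in>V. q (x + y) \<le> q x + q y) \<and> (\<forall>x\<in>V. \<forall>c>0. q (c *\<^sub>R x) = c * q x)"

lemma sublinear_on_zero:
  assumes "sublinear_on V q" "subspace V"
  shows "q 0 = 0"
proof -
  have "q ((2::real) *\<^sub>R 0) = 2 * q 0"
    using assms subspace_0 unfolding sublinear_on_def by (metis zero_less_numeral)
  then show ?thesis by simp
qed

lemma sublinear_on_neg:
  assumes "sublinear_on V q" "subspace V" "x \<in> V"
  shows "- q (- x) \<le> q x"
proof -
  have "q (x + - x) \<le> q x + q (- x)"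
    using assms subspace_neg unfolding sublinear_on_def by blast
  then show ?thesis using sublinear_on_zero[OF assms(1,2)] by simp
qed

text \<open>The witness is the infimal convolution of \<open>q\<close> with the functional \<open>- h \<mapsto> - k h\<close> on \<open>- K\<close>.\<close>

lemma sublinear_minorant_conv:
  fixes V :: "'v::real_vector set"
  assumes q: "sublinear_on V q" and V: "subspace V" and K: "K \<subseteq> V" "0 \<in> K"
    and Kadd: "\<And>x y. x \<in> K \<Longrightarrow> y \<in> K \<Longrightarrow> x + y \<in> K"
    and Kscale: "\<And>c x. c > 0 \<Longrightarrow> x \<in> K \<Longrightarrow> c *\<^sub>R x \<in> K"
    and k0: "k 0 = (0::real)"
    and kadd: "\<And>x y. x \<in> K \<Longrightarrow> y \<in> K \<Longrightarrow> k x + k y \<le> k (x + y)"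
    and kscale: "\<And>c x. c > 0 \<Longrightarrow> x \<in> K \<Longrightarrow> k (c *\<^sub>R x) = c * k x"
    and kq: "\<And>x. x \<in> K \<Longrightarrow> k x \<le> q x"
  obtains r where "sublinear_on V r" "\<And>x. x \<in> V \<Longrightarrow> r x \<le> q x" "\<And>x. x \<in> K \<Longrightarrow> r (- x) \<le> - k x"
proof -
  define r where "r x = (INF h\<in>K. q (x + h) - k h)" for x
  have qadd: "q (x + y) \<le> q x + q y" if "x \<in> V" "y \<in> V" for x y
    using q that unfolding sublinear_on_def by blast
  have qscale: "q (c *\<^sub>R x) = c * q x" if "x \<in> V" "c > 0" for x c
    using q that unfolding sublinear_on_def by blast
  \<comment> \<open>The infimum is finite: subadditivity for \<open>h = (x + h) + - x\<close>,
    combined with \<open>k h \<le> q h\<close>, bounds all competitors from below.\<close>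
  have lower: "- q (- x) \<le> q (x + h) - k h" if "x \<in> V" "h \<in> K" for x h
  proof -
    have "q ((x + h) + - x) \<le> q (x + h) + q (- x)"
      using qadd V K that by (meson subsetD subspace_add subspace_neg)
    then show ?thesis using kq[OF that(2)] by simp
  qed
  have bdd: "bdd_below ((\<lambda>h. q (x + h) - k h) ` K)" if "x \<in> V" for x
    using lower[OF that] by (intro bdd_belowI2) auto
  have up: "r x \<le> q (x + h) - k h" if "x \<in> V" "h \<in> K" for x h
    unfolding r_def using bdd that by (intro cINF_lower) auto
  have ge: "m \<le> r x" if "\<And>h. h \<in> K \<Longrightarrow> m \<le> q (x + h) - k h" for x m
    unfolding r_def using K that by (intro cINF_greatest) auto
  have add: "r (x + y) \<le> r x + r y" if "x \<in> V" "y \<in> V" for x y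
  proof -
    have "r (x + y) - (q (x + h) - k h) \<le> r y" if h: "h \<in> K" for h
    proof (rule ge)
      fix g assume g: "g \<in> K"
      have "r (x + y) \<le> q (x + y + (h + g)) - k (h + g)"
        using up V that \<open>x \<in> V\<close> \<open>y \<in> V\<close> Kadd g h by (simp add: subspace_add)
      also have "\<dots> \<le> q ((x + h) + (y + g)) - (k h + k g)"
        using kadd[OF h g] by (simp add: algebra_simps)
      also have "q ((x + h) + (y + g)) \<le> q (x + h) + q (y + g)"
        using qadd V K g h \<open>x \<in> V\<close> \<open>y \<in> V\<close> by (meson subsetD subspace_add)
      finally show "r (x + y) - (q (x + h) - k h) \<le> q (y + g) - k g" by simp
    qed
    then have "r (x + y) - r y \<le> r x"
      by (intro ge) (simp add: algebra_simps)
    then show ?thesis by simp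
  qed
  \<comment> \<open>Multiplication by \<open>c\<close> maps the cone \<open>K\<close> onto itself,
    so competitors at \<open>x\<close> and at \<open>c *\<^sub>R x\<close> correspond. The reverse
    inequality is this one for \<open>inverse c\<close>.\<close>
  have scale_le: "c * r x \<le> r (c *\<^sub>R x)" if "x \<in> V" "c > 0" for x c
  proof (rule ge)
    fix h assume h: "h \<in> K"
    have ih: "inverse c *\<^sub>R h \<in> K" using Kscale that h by simp
    have "c * r x \<le> c * (q (x + inverse c *\<^sub>R h) - k (inverse c *\<^sub>R h))"
      using up[OF that(1) ih] that by (intro mult_left_mono) auto
    also have "\<dots> = q (c *\<^sub>R (x + inverse c *\<^sub>R h)) - k (c *\<^sub>R (inverse c *\<^sub>R h))"
      using qscale[of "x + inverse c *\<^sub>R h" c] kscale[OF that(2) ih] that V K ih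
      by (simp add: subspace_add subset_iff right_diff_distrib)
    also have "\<dots> = q (c *\<^sub>R x + h) - k h"
      using that by (simp add: scaleR_add_right)
    finally show "c * r x \<le> q (c *\<^sub>R x + h) - k h" .
  qed
  have scale: "r (c *\<^sub>R x) = c * r x" if "x \<in> V" "c > 0" for x c
  proof (rule antisym)
    have "inverse c * r (c *\<^sub>R x) \<le> r (inverse c *\<^sub>R (c *\<^sub>R x))"
      using that V by (intro scale_le) (auto simp: subspace_scale)
    then show "r (c *\<^sub>R x) \<le> c * r x"
      using that by (simp add: field_simps)
  qed (rule scale_le[OF that])
  show ?thesis
  proof (rule that)
    show "sublinear_on V r" unfolding sublinear_on_def using add scale by blast
    \<comment> \<open>The competitor \<open>h = 0\<close> gives this bound; the competitor
      \<open>h = x\<close> at the point \<open>- x\<close> gives the next one.\<close>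
    show "r x \<le> q x" if "x \<in> V" for x using up[OF that K(2)] k0 by simp
    show "r (- x) \<le> - k x" if "x \<in> K" for x
      using up[of "- x" x] that K V sublinear_on_zero[OF q V] by (auto simp: subspace_neg)
  qed
qed

text \<open>Oddness turns subadditivity at \<open>- x\<close> and \<open>- y\<close> into
  superadditivity at \<open>x\<close> and \<open>y\<close>, and reduces negative scalars to positive
  ones.\<close>

lemma sublinear_on_odd_linear:
  assumes r: "sublinear_on V r" and V: "subspace V"
    and odd: "\<And>x. x \<in> V \<Longrightarrow> r (- x) = - r x"
  shows "x \<in> V \<Longrightarrow> y \<in> V \<Longrightarrow> r (x + y) = r x + r y" "x \<in> V \<Longrightarrow> r (c *\<^sub>R x) = c * r x"
proof -
  have sub: "r (x + y) \<le> r x + r y" if "x \<in> V" "y \<in> V" for x y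
    using r that unfolding sublinear_on_def by blast
  have pos: "r (c *\<^sub>R x) = c * r x" if "x \<in> V" "c > 0" for x c
    using r that unfolding sublinear_on_def by blast
  show "r (x + y) = r x + r y" if "x \<in> V" "y \<in> V"
  proof -
    have "r (- x + - y) \<le> r (- x) + r (- y)"
      using that V by (intro sub) (auto simp: subspace_neg)
    moreover have "r (- x + - y) = - r (x + y)"
      using odd[of "x + y"] that V by (simp add: subspace_add)
    ultimately show ?thesis using sub[OF that] odd that by fastforce
  qed
  show "r (c *\<^sub>R x) = c * r x" if x: "x \<in> V"
  proof (cases c "0::real" rule: linorder_cases)
    case less
    then have "r ((- c) *\<^sub>R (- x)) = (- c) * r (- x)"
      using x V by (intro pos) (auto simp: subspace_neg)
    then show ?thesis using odd[OF x] by simp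
  qed (use pos[OF x] sublinear_on_zero[OF r V] in auto)
qed

text \<open>Zorn's lemma, with the pointwise infimum of a chain as its lower bound. The infimum is
  finite because every sublinear minorant of \<open>q\<close> is at least \<open>- q (- x)\<close>
  at \<open>x\<close>.\<close>

lemma minimal_sublinear_minorant:
  fixes V :: "'v::real_vector set"
  assumes q: "sublinear_on V q" and V: "subspace V"
  obtains m where "sublinear_on V m" "\<And>x. x \<in> V \<Longrightarrow> m x \<le> q x"
    "\<And>r x. sublinear_on V r \<Longrightarrow> (\<And>y. y \<in> V \<Longrightarrow> r y \<le> m y) \<Longrightarrow> x \<in> V \<Longrightarrow> r x = m x"
proof -
  define A where "A = {r. sublinear_on V r \<and> (\<forall>x\<in>V. r x \<le> q x) \<and> (\<forall>x. x \<notin> V \<longrightarrow> r x = 0)}"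
  \<comment> \<open>The order is reversed so that a maximal element is a minimal minorant. It only
    looks at \<open>V\<close>; setting minorants to 0 elsewhere, by \<open>trim\<close>, makes it
    antisymmetric.\<close>
  define ge where "ge r r' \<longleftrightarrow> (\<forall>x\<in>V. r' x \<le> r x)" for r r' :: "'v \<Rightarrow> real"
  define trim where "trim r x = (if x \<in> V then r x else 0)" for r :: "'v \<Rightarrow> real" and x
  have trim: "trim r \<in> A" if "sublinear_on V r" "\<And>x. x \<in> V \<Longrightarrow> r x \<le> q x" for r
    using that V by (auto simp: A_def trim_def sublinear_on_def subspace_add subspace_scale)
  have "\<exists>m\<in>A. \<forall>a\<in>A. ge m a \<longrightarrow> a = m"
  proof (rule predicate_Zorn)
    show "partial_order_on A (relation_of ge A)"
    proof (rule partial_order_on_relation_ofI)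
      fix a b assume "a \<in> A" "b \<in> A" "ge a b" "ge b a"
      then show "a = b" unfolding A_def ge_def by (intro ext) (metis (mono_tags, lifting) mem_Collect_eq order_antisym)
    qed (fastforce simp: ge_def)+
    fix C assume "C \<in> Chains (relation_of ge A)"
    then have CA: "C \<subseteq> A" and tot: "\<And>a b. a \<in> C \<Longrightarrow> b \<in> C \<Longrightarrow> ge a b \<or> ge b a"
      by (auto simp: Chains_def relation_of_def)
    show "\<exists>u\<in>A. \<forall>a\<in>C. ge a u"
    proof (cases "C = {}")
      case True
      then show ?thesis using trim[OF q] by auto
    next
      case False
      define s where "s x = (INF r\<in>C. r x)" for x
      have sub: "sublinear_on V r" "\<And>x. x \<in> V \<Longrightarrow> r x \<le> q x" if "r \<in> C" for r
        using CA that by (auto simp: A_def)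
      have "- q (- x) \<le> r x" if "r \<in> C" "x \<in> V" for r x
        using sublinear_on_neg[OF sub(1)[OF that(1)] V that(2)] sub(2)[OF that(1), of "- x"] V that
        by (simp add: subspace_neg)
      then have bdd: "bdd_below ((\<lambda>r. r x) ` C)" if "x \<in> V" for x
        using that by (intro bdd_belowI2) auto
      have low: "s x \<le> r x" if "x \<in> V" "r \<in> C" for x r
        unfolding s_def using bdd that by (intro cINF_lower) auto
      have great: "m \<le> s x" if "\<And>r. r \<in> C \<Longrightarrow> m \<le> r x" for m x
        unfolding s_def using False that by (intro cINF_greatest) auto
      have "s (x + y) \<le> s x + s y" if "x \<in> V" "y \<in> V" for x y
      proof -
        have "s (x + y) \<le> a x + b y" if ab: "a \<in> C" "b \<in> C" for a b
        proof -
          \<comment> \<open>In a chain the smaller of \<open>a\<close> and \<open>b\<close> serves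
            both points at once; this is where totality is essential, since infima of sublinear
            functionals need not be subadditive.\<close>
          obtain d where d: "d \<in> C" "d x \<le> a x" "d y \<le> b y"
            using tot[OF ab] ab \<open>x \<in> V\<close> \<open>y \<in> V\<close> unfolding ge_def by blast
          have "s (x + y) \<le> d (x + y)"
            using low V \<open>x \<in> V\<close> \<open>y \<in> V\<close> d by (simp add: subspace_add)
          also have "\<dots> \<le> d x + d y"
            using sub(1)[OF d(1)] \<open>x \<in> V\<close> \<open>y \<in> V\<close> unfolding sublinear_on_def by blast
          finally show ?thesis using d by simp
        qed
        then have *: "s (x + y) - a x \<le> b y" if "a \<in> C" "b \<in> C" for a b
          unfolding diff_le_eq using that by (subst add.commute)
        have "s (x + y) - a x \<le> s y" if "a \<in> C" for a
          using * that by (intro great) blast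
        then have "s (x + y) - s y \<le> s x"
          by (intro great) (simp add: algebra_simps)
        then show ?thesis by simp
      qed
      moreover have "s (c *\<^sub>R x) = c * s x" if "x \<in> V" "c > 0" for c x
      proof -
        have eq: "r (c *\<^sub>R x) = c * r x" if "r \<in> C" for r
          using sub(1)[OF that] \<open>x \<in> V\<close> \<open>c > 0\<close> unfolding sublinear_on_def by blast
        have "c * s x \<le> s (c *\<^sub>R x)"
          using low that by (intro great) (simp add: eq)
        moreover have "s (c *\<^sub>R x) / c \<le> s x"
        proof (rule great)
          fix r assume "r \<in> C"
          then show "s (c *\<^sub>R x) / c \<le> r x"
            using low[of "c *\<^sub>R x" r] V that eq by (simp add: subspace_scale field_simps)
        qed
        ultimately show ?thesis using that by (simp add: field_simps)
      qed
      ultimately have s: "sublinear_on V s" unfolding sublinear_on_def by blast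
      have sq: "s x \<le> q x" if "x \<in> V" for x
        using False low[OF that] sub(2) that by (meson all_not_in_conv order_trans)
      have "\<forall>a\<in>C. ge a (trim s)"
        using low by (auto simp: ge_def trim_def)
      then show ?thesis using trim[OF s sq] by blast
    qed
  qed
  then obtain m where m: "m \<in> A" "\<And>a. a \<in> A \<Longrightarrow> ge m a \<Longrightarrow> a = m" by blast
  show ?thesis
  proof (rule that)
    show sm: "sublinear_on V m" and mq: "\<And>x. x \<in> V \<Longrightarrow> m x \<le> q x"
      using m by (auto simp: A_def)
    fix r x assume r: "sublinear_on V r" "\<And>y. y \<in> V \<Longrightarrow> r y \<le> m y" and x: "x \<in> V"
    have "trim r = m"
      using r mq by (intro m(2) trim) (force simp: ge_def trim_def)+
    then show "r x = m x" using x by (auto simp: trim_def)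
  qed
qed

text \<open>A minimal sublinear functional is odd, hence linear: convolving \<open>m\<close> along
  the ray of \<open>h\<close> yields a sublinear \<open>r\<close> below \<open>m\<close> with
  \<open>r (- h) \<le> - m h\<close>, and minimality identifies \<open>r\<close> with
  \<open>m\<close>.\<close>

lemma linear_minorant:
  fixes V :: "'v::real_vector set"
  assumes q: "sublinear_on V q" and V: "subspace V"
  obtains l where "\<And>x y. x \<in> V \<Longrightarrow> y \<in> V \<Longrightarrow> l (x + y) = l x + l y"
    "\<And>c x. x \<in> V \<Longrightarrow> l (c *\<^sub>R x) = c * l x" "\<And>x. x \<in> V \<Longrightarrow> l x \<le> q x"
proof -
  obtain m where m: "sublinear_on V m" and mq: "\<And>x. x \<in> V \<Longrightarrow> m x \<le> q x"
    and min: "\<And>r x. sublinear_on V r \<Longrightarrow> (\<And>y. y \<in> V \<Longrightarrow> r y \<le> m y) \<Longrightarrow> x \<in> V \<Longrightarrow> r x = m x"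
    using minimal_sublinear_minorant[OF q V] by metis
  have odd: "m (- h) = - m h" if h: "h \<in> V" for h
  proof -
    define K where "K = {t *\<^sub>R h | t. t \<ge> 0}"
    have ms: "m (t *\<^sub>R x) = t * m x" if "t \<ge> 0" "x \<in> V" for t x
      using m that sublinear_on_zero[OF m V] unfolding sublinear_on_def
      by (cases "t = 0") auto
    obtain r where r: "sublinear_on V r" "\<And>x. x \<in> V \<Longrightarrow> r x \<le> m x"
        "\<And>x. x \<in> K \<Longrightarrow> r (- x) \<le> - m x"
    proof (rule sublinear_minorant_conv[OF m V, of K m])
      show "K \<subseteq> V" using h V by (auto simp: K_def subspace_scale)
      then show "\<And>c x. 0 < c \<Longrightarrow> x \<in> K \<Longrightarrow> m (c *\<^sub>R x) = c * m x" using ms by auto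
      show "0 \<in> K" by (force simp: K_def)
      show "x + y \<in> K" if "x \<in> K" "y \<in> K" for x y
        using that unfolding K_def by (smt (verit, best) mem_Collect_eq scaleR_left.add)
      show "c *\<^sub>R x \<in> K" if "c > 0" "x \<in> K" for c x
      proof -
        obtain t where "x = t *\<^sub>R h" "t \<ge> 0" using \<open>x \<in> K\<close> by (auto simp: K_def)
        then show ?thesis
          unfolding K_def using \<open>c > 0\<close> by (intro CollectI exI[of _ "c * t"]) simp
      qed
      show "m x + m y \<le> m (x + y)" if xy: "x \<in> K" "y \<in> K" for x y
      proof -
        obtain s t where "x = s *\<^sub>R h" "y = t *\<^sub>R h" "s \<ge> 0" "t \<ge> 0"
          using xy by (auto simp: K_def)
        then show ?thesis using ms[OF _ h, of s] ms[OF _ h, of t] ms[OF _ h, of "s + t"]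
          by (simp add: scaleR_left_distrib distrib_right)
      qed
    qed (use sublinear_on_zero[OF m V] in auto)
    have "m (- h) = r (- h)" using min[OF r(1,2)] h V by (simp add: subspace_neg)
    also have "\<dots> \<le> - m h"
      by (rule r(3)) (unfold K_def, rule CollectI, rule exI[of _ 1], simp)
    finally show ?thesis using sublinear_on_neg[OF m V h] by simp
  qed
  show ?thesis
    using that[of m] sublinear_on_odd_linear[OF m V odd] mq by blast
qed

text \<open>For \<open>K = {t h | t \<ge> 0}\<close> this gives a linear functional below \<open>q\<close> touching it at \<open>h\<close>, and for
  \<open>K = V\<close> it is the sandwich theorem.\<close>

theorem hahn_banach_sandwich:
  fixes V :: "'v::real_vector set"
  assumes q: "sublinear_on V q" and V: "subspace V" and K: "K \<subseteq> V" "0 \<in> K"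
    and Kadd: "\<And>x y. x \<in> K \<Longrightarrow> y \<in> K \<Longrightarrow> x + y \<in> K"
    and Kscale: "\<And>c x. c > 0 \<Longrightarrow> x \<in> K \<Longrightarrow> c *\<^sub>R x \<in> K"
    and k0: "k 0 = (0::real)"
    and kadd: "\<And>x y. x \<in> K \<Longrightarrow> y \<in> K \<Longrightarrow> k x + k y \<le> k (x + y)"
    and kscale: "\<And>c x. c > 0 \<Longrightarrow> x \<in> K \<Longrightarrow> k (c *\<^sub>R x) = c * k x"
    and kq: "\<And>x. x \<in> K \<Longrightarrow> k x \<le> q x"
  obtains l where "\<And>x y. x \<in> V \<Longrightarrow> y \<in> V \<Longrightarrow> l (x + y) = l x + l y"
    "\<And>c x. x \<in> V \<Longrightarrow> l (c *\<^sub>R x) = c * l x" "\<And>x. x \<in> V \<Longrightarrow> l x \<le> q x"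
    "\<And>x. x \<in> K \<Longrightarrow> k x \<le> l x"
proof -
  obtain r where r: "sublinear_on V r" "\<And>x. x \<in> V \<Longrightarrow> r x \<le> q x"
      "\<And>x. x \<in> K \<Longrightarrow> r (- x) \<le> - k x"
  proof (rule sublinear_minorant_conv[OF q V K, of k])
    show "\<And>x y. x \<in> K \<Longrightarrow> y \<in> K \<Longrightarrow> x + y \<in> K" by (rule Kadd)
    show "\<And>c x. c > 0 \<Longrightarrow> x \<in> K \<Longrightarrow> c *\<^sub>R x \<in> K" by (rule Kscale)
    show "\<And>x y. x \<in> K \<Longrightarrow> y \<in> K \<Longrightarrow> k x + k y \<le> k (x + y)" by (rule kadd)
    show "\<And>c x. c > 0 \<Longrightarrow> x \<in> K \<Longrightarrow> k (c *\<^sub>R x) = c * k x" by (rule kscale)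
  qed (rule k0, erule kq, blast)
  obtain l where l: "\<And>x y. x \<in> V \<Longrightarrow> y \<in> V \<Longrightarrow> l (x + y) = l x + l y"
    "\<And>c x. x \<in> V \<Longrightarrow> l (c *\<^sub>R x) = c * l x" "\<And>x. x \<in> V \<Longrightarrow> l x \<le> r x"
    using linear_minorant[OF r(1) V] by metis
  have "k x \<le> l x" if "x \<in> K" for x
    using l(2)[of x "- 1"] l(3)[of "- x"] r(3)[OF that] K that V by (auto simp: subspace_neg)
  moreover have "l x \<le> q x" if "x \<in> V" for x using l(3)[OF that] r(2)[OF that] by simp
  ultimately show ?thesis using that[of l] l(1,2) by blast
qed

section \<open>Simple functions and finitely additive integrals\<close>

text \<open>Polymorphic in the codomain, so that acts, real simple functions and pairs of either
  share one set of closure lemmas.\<close>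

definition finmeas :: "'s set set \<Rightarrow> ('s \<Rightarrow> 'b) \<Rightarrow> bool" where
  "finmeas \<Sigma> f \<longleftrightarrow> finite (range f) \<and> (\<forall>y. f -` {y} \<in> \<Sigma>)"

lemma simple_fn_iff_finmeas: "simple_fn \<Sigma> \<psi> \<longleftrightarrow> finmeas \<Sigma> \<psi>"
  by (simp add: simple_fn_def finmeas_def)

lemma acts_iff_finmeas: "f \<in> acts \<Sigma> X \<longleftrightarrow> (\<forall>s. f s \<in> X) \<and> finmeas \<Sigma> f"
  by (auto simp: acts_def finmeas_def)

lemma finmeas_vimage:
  assumes "algebra UNIV \<Sigma>" "finmeas \<Sigma> f"
  shows "f -` B \<in> \<Sigma>"
proof -
  interpret algebra UNIV \<Sigma> by fact
  have "f -` B = (\<Union>y\<in>B \<inter> range f. f -` {y})" by auto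
  also have "\<dots> \<in> \<Sigma>"
    using assms(2) by (intro finite_UN) (auto simp: finmeas_def)
  finally show ?thesis .
qed

lemma finmeas_comp:
  assumes "algebra UNIV \<Sigma>" "finmeas \<Sigma> f"
  shows "finmeas \<Sigma> (\<lambda>s. h (f s))"
proof -
  have "(\<lambda>s. h (f s)) -` {y} = f -` (h -` {y})" for y by auto
  moreover have "range (\<lambda>s. h (f s)) = h ` range f" by auto
  ultimately show ?thesis
    using assms(2) finmeas_vimage[OF assms] by (simp add: finmeas_def)
qed

text \<open>The pair generates the common refinement of the two level partitions, to which all
  pointwise binary operations reduce.\<close>

lemma finmeas_Pair:
  assumes "algebra UNIV \<Sigma>" "finmeas \<Sigma> f" "finmeas \<Sigma> g"
  shows "finmeas \<Sigma> (\<lambda>s. (f s, g s))"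
proof -
  interpret algebra UNIV \<Sigma> by fact
  have "(\<lambda>s. (f s, g s)) -` {y} = f -` {fst y} \<inter> g -` {snd y}" for y by auto
  moreover have "finite (range (\<lambda>s. (f s, g s)))"
    by (rule finite_subset[of _ "range f \<times> range g"]) (use assms in \<open>auto simp: finmeas_def\<close>)
  ultimately show ?thesis
    using assms by (auto simp: finmeas_def)
qed

lemma finmeas_comp2:
  assumes "algebra UNIV \<Sigma>" "finmeas \<Sigma> f" "finmeas \<Sigma> g"
  shows "finmeas \<Sigma> (\<lambda>s. h (f s) (g s))"
  using finmeas_comp[OF assms(1) finmeas_Pair[OF assms], of "\<lambda>(a, b). h a b"] by simp

lemma finmeas_const:
  assumes "algebra UNIV \<Sigma>"
  shows "finmeas \<Sigma> (\<lambda>_. c)"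
proof -
  interpret algebra UNIV \<Sigma> by fact
  have "(\<lambda>_. c) -` {y} = (if y = c then UNIV else {})" for y by auto
  then show ?thesis by (auto simp: finmeas_def)
qed

lemma finmeas_indicator:
  assumes "algebra UNIV \<Sigma>" "A \<in> \<Sigma>"
  shows "finmeas \<Sigma> (indicator A :: _ \<Rightarrow> real)"
proof -
  interpret algebra UNIV \<Sigma> by fact
  have "(indicator A :: _ \<Rightarrow> real) -` {y} = (if y = 1 then A else if y = 0 then UNIV - A else {})" for y
    by (auto simp: indicator_def)
  moreover have "finite (range (indicator A :: _ \<Rightarrow> real))"
    by (rule finite_subset[of _ "{0, 1}"]) (auto simp: indicator_def)
  ultimately show ?thesis using assms(2) by (auto simp: finmeas_def)
qed

definition simple_space :: "'s set set \<Rightarrow> ('s \<Rightarrow> real) set" where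
  "simple_space \<Sigma> = Collect (finmeas \<Sigma>)"

lemma mem_simple_space: "\<phi> \<in> simple_space \<Sigma> \<longleftrightarrow> finmeas \<Sigma> \<phi>"
  by (simp add: simple_space_def)

lemma simple_space_const: "algebra UNIV \<Sigma> \<Longrightarrow> (\<lambda>_. c) \<in> simple_space \<Sigma>"
  by (simp add: mem_simple_space finmeas_const)

lemma subspace_simple_space:
  assumes "algebra UNIV \<Sigma>"
  shows "subspace (simple_space \<Sigma>)"
proof (rule subspaceI)
  fix \<phi> \<psi> :: "'a \<Rightarrow> real" and c :: real
  assume "\<phi> \<in> simple_space \<Sigma>"
  then show "c *\<^sub>R \<phi> \<in> simple_space \<Sigma>"
    using finmeas_comp[OF assms, of \<phi> "\<lambda>y. c * y"] by (simp add: mem_simple_space scaleR_fun_def)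
  assume "\<psi> \<in> simple_space \<Sigma>"
  with \<open>\<phi> \<in> simple_space \<Sigma>\<close> show "\<phi> + \<psi> \<in> simple_space \<Sigma>"
    using finmeas_comp2[OF assms, of \<phi> \<psi> "(+)"] by (simp add: mem_simple_space plus_fun_def)
qed (simp add: zero_fun_def simple_space_const[OF assms])

lemma finmeas_bounded:
  fixes \<phi> :: "'s \<Rightarrow> real"
  assumes "finmeas \<Sigma> \<phi>"
  obtains B where "B > 0" "\<And>s. \<bar>\<phi> s\<bar> < B"
proof -
  have "finite (range (\<lambda>s. \<bar>\<phi> s\<bar>))"
    using assms finite_imageI[of "range \<phi>" abs] by (simp add: finmeas_def image_image)
  then have "\<bar>\<phi> s\<bar> \<le> Max (range (\<lambda>s. \<bar>\<phi> s\<bar>))" for s by simp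
  moreover from this[of undefined] have "0 \<le> Max (range (\<lambda>s. \<bar>\<phi> s\<bar>))" by linarith
  ultimately show ?thesis
    by (intro that[of "Max (range (\<lambda>s. \<bar>\<phi> s\<bar>)) + 1"]) (auto intro: le_less_trans[OF _ less_add_one])
qed

section \<open>Finitely additive probabilities and their integrals\<close>

lemma fa_probsD:
  assumes "p \<in> fa_probs \<Sigma>"
  shows "p UNIV = 1" "A \<in> \<Sigma> \<Longrightarrow> 0 \<le> p A" "A \<notin> \<Sigma> \<Longrightarrow> p A = 0"
    "A \<in> \<Sigma> \<Longrightarrow> B \<in> \<Sigma> \<Longrightarrow> A \<inter> B = {} \<Longrightarrow> p (A \<union> B) = p A + p B"
  using assms by (auto simp: fa_probs_def)

lemma fa_probs_empty:
  assumes "algebra UNIV \<Sigma>" "p \<in> fa_probs \<Sigma>"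
  shows "p {} = 0"
proof -
  interpret algebra UNIV \<Sigma> by fact
  show ?thesis using fa_probsD(4)[OF assms(2), of "{}" "{}"] by simp
qed

lemma fa_probs_Union:
  assumes "algebra UNIV \<Sigma>" "p \<in> fa_probs \<Sigma>" "finite I"
    and "\<And>i. i \<in> I \<Longrightarrow> A i \<in> \<Sigma>" "disjoint_family_on A I"
  shows "p (\<Union>i\<in>I. A i) = (\<Sum>i\<in>I. p (A i))"
  using assms(3-)
proof (induction I)
  case empty
  show ?case using fa_probs_empty[OF assms(1,2)] by simp
next
  case (insert i I)
  interpret algebra UNIV \<Sigma> by fact
  have "A i \<inter> (\<Union>i\<in>I. A i) = {}"
    using insert by (fastforce simp: disjoint_family_on_def)
  then have "p (A i \<union> (\<Union>i\<in>I. A i)) = p (A i) + p (\<Union>i\<in>I. A i)"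
    using insert by (intro fa_probsD(4)[OF assms(2)] finite_UN) auto
  moreover have "disjoint_family_on A I"
    using insert.prems(2) by (auto simp: disjoint_family_on_def)
  ultimately show ?case using insert by simp
qed

text \<open>Change of variables: the sum over the values of the composition is regrouped over the
  finer level partition of \<open>f\<close>. With a pair for \<open>f\<close>, two functions are
  integrated over one partition, which gives additivity and monotonicity.\<close>

lemma simple_integral_comp:
  assumes "algebra UNIV \<Sigma>" "p \<in> fa_probs \<Sigma>" "finmeas \<Sigma> f"
  shows "simple_integral p (\<lambda>s. h (f s)) = (\<Sum>y\<in>range f. h y * p (f -` {y}))"
proof -
  have fin: "finite (range f)" using assms(3) by (simp add: finmeas_def)
  have "p ((\<lambda>s. h (f s)) -` {z}) = (\<Sum>y\<in>{y\<in>range f. h y = z}. p (f -` {y}))" for z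
  proof -
    have "(\<lambda>s. h (f s)) -` {z} = (\<Union>y\<in>{y\<in>range f. h y = z}. f -` {y})" by auto
    then show ?thesis
      using assms(3) fin
      by (simp, intro fa_probs_Union[OF assms(1,2)]) (auto simp: finmeas_def disjoint_family_on_def)
  qed
  then have "simple_integral p (\<lambda>s. h (f s))
      = (\<Sum>z\<in>h ` range f. \<Sum>y\<in>{y\<in>range f. h y = z}. h y * p (f -` {y}))"
    unfolding simple_integral_def by (simp add: sum_distrib_left image_image)
  also have "\<dots> = (\<Sum>y\<in>range f. h y * p (f -` {y}))"
    using fin by (intro sum.group) auto
  finally show ?thesis .
qed

lemma simple_integral_add:
  assumes "algebra UNIV \<Sigma>" "p \<in> fa_probs \<Sigma>" "finmeas \<Sigma> \<phi>" "finmeas \<Sigma> \<psi>"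
  shows "simple_integral p (\<phi> + \<psi>) = simple_integral p \<phi> + simple_integral p \<psi>"
proof -
  note * = simple_integral_comp[OF assms(1,2) finmeas_Pair[OF assms(1,3,4)]]
  show ?thesis
    using *[of "\<lambda>z. fst z + snd z"] *[of fst] *[of snd]
    by (simp add: plus_fun_def distrib_right sum.distrib)
qed

lemma simple_integral_cmult:
  assumes "algebra UNIV \<Sigma>" "p \<in> fa_probs \<Sigma>" "finmeas \<Sigma> \<phi>"
  shows "simple_integral p (c *\<^sub>R \<phi>) = c * simple_integral p \<phi>"
  using simple_integral_comp[OF assms, of "\<lambda>y. c * y"] simple_integral_comp[OF assms, of "\<lambda>y. y"]
  by (simp add: scaleR_fun_def sum_distrib_left mult.assoc)

lemma simple_integral_mono:
  assumes "algebra UNIV \<Sigma>" "p \<in> fa_probs \<Sigma>" "finmeas \<Sigma> \<phi>" "finmeas \<Sigma> \<psi>" "\<And>s. \<phi> s \<le> \<psi> s"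
  shows "simple_integral p \<phi> \<le> simple_integral p \<psi>"
proof -
  note m = finmeas_Pair[OF assms(1,3,4)]
  note * = simple_integral_comp[OF assms(1,2) m]
  have "(\<Sum>y\<in>range (\<lambda>s. (\<phi> s, \<psi> s)). fst y * p ((\<lambda>s. (\<phi> s, \<psi> s)) -` {y}))
      \<le> (\<Sum>y\<in>range (\<lambda>s. (\<phi> s, \<psi> s)). snd y * p ((\<lambda>s. (\<phi> s, \<psi> s)) -` {y}))"
    using assms(5) fa_probsD(2)[OF assms(2)] m
    by (intro sum_mono mult_right_mono) (auto simp: finmeas_def)
  then show ?thesis using *[of fst] *[of snd] by simp
qed

lemma simple_integral_const:
  assumes "p \<in> fa_probs \<Sigma>"
  shows "simple_integral p (\<lambda>_. c) = c"
  using fa_probsD(1)[OF assms] by (simp add: simple_integral_def vimage_def)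

lemma simple_integral_indicator:
  assumes "algebra UNIV \<Sigma>" "p \<in> fa_probs \<Sigma>" "A \<in> \<Sigma>"
  shows "simple_integral p (indicator A) = p A"
proof -
  have m: "finmeas \<Sigma> (\<lambda>s. s \<in> A)"
    using finmeas_comp[OF assms(1) finmeas_indicator[OF assms(1,3)], of "\<lambda>y. y = 1"]
    by (simp add: indicator_eq_1_iff)
  have "indicator A = (\<lambda>s. of_bool (s \<in> A) :: real)" by (auto simp: indicator_def)
  then have "simple_integral p (indicator A) = (\<Sum>y\<in>range (\<lambda>s. s \<in> A). of_bool y * p ((\<lambda>s. s \<in> A) -` {y}))"
    using simple_integral_comp[OF assms(1,2) m, of of_bool] by simp
  \<comment> \<open>If \<open>A\<close> is empty or everything, one truth value is missing from the
    range; its term vanishes because its fibre is empty.\<close>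
  also have "\<dots> = (\<Sum>y\<in>{True, False}. of_bool y * p ((\<lambda>s. s \<in> A) -` {y}))"
  proof (rule sum.mono_neutral_left)
    show "\<forall>i\<in>{True, False} - range (\<lambda>s. s \<in> A). of_bool i * p ((\<lambda>s. s \<in> A) -` {i}) = 0"
    proof
      fix i assume "i \<in> {True, False} - range (\<lambda>s. s \<in> A)"
      then have "(\<lambda>s. s \<in> A) -` {i} = {}" by blast
      then show "of_bool i * p ((\<lambda>s. s \<in> A) -` {i}) = 0"
        using fa_probs_empty[OF assms(1,2)] by simp
    qed
  qed auto
  also have "\<dots> = p A" by (simp add: vimage_def)
  finally show ?thesis .
qed

lemma bmeas_if_finmeas:
  assumes "algebra UNIV \<Sigma>" "finmeas \<Sigma> \<phi>"
  shows "bmeas \<Sigma> \<phi>"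
proof -
  have "{s. \<phi> s > t} = \<phi> -` {t<..}" for t by auto
  then show ?thesis
    using finmeas_vimage[OF assms] assms(2) by (simp add: bmeas_def finmeas_def finite_imp_bounded)
qed

text \<open>The simple minorant belongs to the set whose supremum is the integral, and the simple
  majorant bounds that set by monotonicity. Both are needed for the supremum to be
  meaningful.\<close>

lemma fa_integral_bounds:
  assumes "algebra UNIV \<Sigma>" "p \<in> fa_probs \<Sigma>" "finmeas \<Sigma> \<psi>" "finmeas \<Sigma> \<eta>"
    and "\<And>s. \<psi> s \<le> \<phi> s" "\<And>s. \<phi> s \<le> \<eta> s"
  shows "simple_integral p \<psi> \<le> fa_integral \<Sigma> p \<phi>" "fa_integral \<Sigma> p \<phi> \<le> simple_integral p \<eta>"
proof -
  let ?A = "{simple_integral p \<psi> | \<psi>. simple_fn \<Sigma> \<psi> \<and> (\<forall>s. \<psi> s \<le> \<phi> s)}"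
  have ub: "a \<le> simple_integral p \<eta>" if "a \<in> ?A" for a
  proof -
    obtain \<theta> where "a = simple_integral p \<theta>" "finmeas \<Sigma> \<theta>" "\<And>s. \<theta> s \<le> \<phi> s"
      using \<open>a \<in> ?A\<close> by (auto simp: simple_fn_iff_finmeas)
    then show ?thesis
      using simple_integral_mono[OF assms(1,2) _ assms(4)] assms(6) order_trans by metis
  qed
  have mem: "simple_integral p \<psi> \<in> ?A"
    using assms by (auto simp: simple_fn_iff_finmeas)
  show "simple_integral p \<psi> \<le> fa_integral \<Sigma> p \<phi>"
    unfolding fa_integral_def using mem ub by (intro cSup_upper bdd_aboveI) auto
  show "fa_integral \<Sigma> p \<phi> \<le> simple_integral p \<eta>"
    unfolding fa_integral_def using mem ub by (intro cSup_least) auto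
qed

lemma fa_integral_simple:
  assumes "algebra UNIV \<Sigma>" "p \<in> fa_probs \<Sigma>" "finmeas \<Sigma> \<phi>"
  shows "fa_integral \<Sigma> p \<phi> = simple_integral p \<phi>"
  using fa_integral_bounds[OF assms(1,2,3,3), of \<phi>] by (intro antisym) auto

text \<open>Riesz representation in finitely additive form: the probability is the functional on
  indicators, and a simple function is the finite combination of the indicators of its level sets.
  The value 0 off \<open>\<Sigma>\<close> is the convention of \<open>fa_probs\<close>.\<close>

lemma fa_prob_of_linear:
  assumes alg: "algebra UNIV \<Sigma>"
    and add: "\<And>\<phi> \<psi>. \<phi> \<in> simple_space \<Sigma> \<Longrightarrow> \<psi> \<in> simple_space \<Sigma> \<Longrightarrow> l (\<phi> + \<psi>) = l \<phi> + l \<psi>"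
    and scale: "\<And>c \<phi>. \<phi> \<in> simple_space \<Sigma> \<Longrightarrow> l (c *\<^sub>R \<phi>) = c * l \<phi>"
    and pos: "\<And>\<phi>. \<phi> \<in> simple_space \<Sigma> \<Longrightarrow> (\<And>s. 0 \<le> \<phi> s) \<Longrightarrow> 0 \<le> l \<phi>"
    and one: "l (\<lambda>_. 1) = 1"
  obtains p where "p \<in> fa_probs \<Sigma>" "\<And>\<phi>. \<phi> \<in> simple_space \<Sigma> \<Longrightarrow> simple_integral p \<phi> = l \<phi>"
proof -
  interpret algebra UNIV \<Sigma> by fact
  note sub = subspace_simple_space[OF alg]
  define p where "p A = (if A \<in> \<Sigma> then l (indicator A) else 0)" for A
  have ind: "indicator A \<in> simple_space \<Sigma>" if "A \<in> \<Sigma>" for A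
    using finmeas_indicator[OF alg that] by (simp add: mem_simple_space)
  have "indicator UNIV = (\<lambda>_. 1::real)" by auto
  then have "p UNIV = 1" using one by (simp add: p_def)
  moreover have "p (A \<union> B) = p A + p B" if "A \<in> \<Sigma>" "B \<in> \<Sigma>" "A \<inter> B = {}" for A B
  proof -
    have "indicator (A \<union> B) = (indicator A + indicator B :: _ \<Rightarrow> real)"
      using that(3) by (auto simp: fun_eq_iff indicator_def)
    then show ?thesis using that add[OF ind ind] Un by (simp add: p_def)
  qed
  moreover have "p A \<ge> 0" for A using pos[OF ind] by (simp add: p_def)
  ultimately have p: "p \<in> fa_probs \<Sigma>" by (simp add: fa_probs_def) (simp add: p_def)
  have "simple_integral p \<phi> = l \<phi>" if \<phi>: "\<phi> \<in> simple_space \<Sigma>" for \<phi>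
  proof -
    have fm: "finite (range \<phi>)" "\<And>y. \<phi> -` {y} \<in> \<Sigma>"
      using \<phi> by (auto simp: mem_simple_space finmeas_def)
    have l0: "l 0 = 0" using scale[of 0 0] sub by (simp add: subspace_0)
    have "l (\<Sum>y\<in>Y. y *\<^sub>R indicator (\<phi> -` {y})) = (\<Sum>y\<in>Y. y * l (indicator (\<phi> -` {y})))"
      if "finite Y" for Y
      using that
    proof induction
      case (insert y Y)
      have "(\<Sum>y\<in>Y. y *\<^sub>R indicator (\<phi> -` {y})) \<in> simple_space \<Sigma>"
        using sub ind fm by (intro subspace_sum subspace_scale) auto
      moreover have "y *\<^sub>R indicator (\<phi> -` {y}) \<in> simple_space \<Sigma>"
        using sub ind fm by (intro subspace_scale) auto
      ultimately show ?case
        unfolding sum.insert[OF insert.hyps] using insert.IH by (simp only: add scale ind fm)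
    qed (simp only: sum.empty l0)
    moreover have "(\<Sum>y\<in>range \<phi>. y *\<^sub>R indicator (\<phi> -` {y})) = \<phi>"
    proof
      fix s
      have "(\<Sum>y\<in>Y. y *\<^sub>R indicator (\<phi> -` {y})) s = (\<Sum>y\<in>Y. if \<phi> s = y then y else 0)"
        if "finite Y" for Y
        using that by induction (auto simp: indicator_def split: if_splits)
      then show "(\<Sum>y\<in>range \<phi>. y *\<^sub>R indicator (\<phi> -` {y})) s = \<phi> s"
        using fm(1) by simp
    qed
    ultimately have "l \<phi> = (\<Sum>y\<in>range \<phi>. y * l (indicator (\<phi> -` {y})))"
      using fm(1) by metis
    then show ?thesis
      using fm(2) by (simp add: simple_integral_def p_def)
  qed
  then show ?thesis using that p by blast
qed

section \<open>The weak* topology\<close>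

text \<open>Tychonoff: every defining condition involves finitely many coordinates and is closed,
  and all coordinates lie in the unit interval. \<open>compact\<close> refers to the product
  topology on set functions.\<close>

lemma compact_fa_probs:
  assumes "algebra UNIV \<Sigma>"
  shows "compact (fa_probs \<Sigma>)"
proof -
  interpret algebra UNIV \<Sigma> by fact
  have cont [continuous_intros]: "continuous_on UNIV (\<lambda>p. p A)" for A :: "'a set"
    by (rule continuous_on_product_coordinates)
  let ?cube = "UNIV \<rightarrow>\<^sub>E {0..1::real} :: ('a set \<Rightarrow> real) set"
  have "compactin (product_topology (\<lambda>_. euclidean) UNIV) ?cube"
    unfolding compactin_PiE by auto
  then have "compact ?cube"
    by (simp add: euclidean_product_topology)
  moreover have "closed (fa_probs \<Sigma>)"
  proof -
    have "fa_probs \<Sigma> = {p. p UNIV = 1} \<inter> (\<Inter>A\<in>\<Sigma>. {p. 0 \<le> p A}) \<inter>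
        (\<Inter>A\<in>\<Sigma>. \<Inter>B\<in>{B\<in>\<Sigma>. A \<inter> B = {}}. {p. p (A \<union> B) = p A + p B}) \<inter>
        (\<Inter>A\<in>- \<Sigma>. {p. p A = 0})"
      by (auto simp: fa_probs_def)
    moreover have "closed \<dots>"
      by (intro closed_Int closed_INT ballI closed_Collect_eq closed_Collect_le
          continuous_intros)
    ultimately show ?thesis by simp
  qed
  moreover have "fa_probs \<Sigma> \<subseteq> ?cube"
  proof
    fix p assume p: "p \<in> fa_probs \<Sigma>"
    have "p A \<le> 1" if "A \<in> \<Sigma>" for A
      using fa_probsD(4)[OF p, of A "UNIV - A"] fa_probsD(2)[OF p, of "UNIV - A"]
        fa_probsD(1)[OF p] compl_sets[OF that] that by auto
    then have "0 \<le> p A \<and> p A \<le> 1" for A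
      using fa_probsD(2,3)[OF p] by (cases "A \<in> \<Sigma>") auto
    then show "p \<in> ?cube" by auto
  qed
  ultimately show ?thesis
    using compact_Int_closed[of ?cube "fa_probs \<Sigma>"] by (simp add: Int_absorb1)
qed

lemma continuous_on_simple_integral:
  "continuous_on S (\<lambda>p. simple_integral p \<phi>)"
  unfolding simple_integral_def
  by (intro continuous_intros continuous_on_subset[OF continuous_on_product_coordinates]) auto

lemma bmeas_approx:
  assumes alg: "algebra UNIV \<Sigma>" and "bmeas \<Sigma> \<phi>" "e > 0"
  obtains \<psi> where "finmeas \<Sigma> \<psi>" "\<And>s. \<psi> s \<le> \<phi> s" "\<And>s. \<phi> s \<le> \<psi> s + e"
proof -
  interpret algebra UNIV \<Sigma> by fact
  \<comment> \<open>Rounding on a grid of width \<open>e\<close>. The ceiling is used rather than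
    the floor because its level sets are differences of the strict superlevel sets in
    \<open>bmeas\<close>; the grid point below, \<open>e * (k s - 1)\<close>, is the
    minorant.\<close>
  define k where "k s = \<lceil>\<phi> s / e\<rceil>" for s
  have "k s = j \<longleftrightarrow> e * (j - 1) < \<phi> s \<and> \<phi> s \<le> e * j" for s j
    unfolding k_def ceiling_eq_iff pos_less_divide_eq[OF assms(3)] pos_divide_le_eq[OF assms(3)]
    by (simp add: mult.commute)
  then have "k -` {j} = {s. \<phi> s > e * (j - 1)} - {s. \<phi> s > e * j}" for j
    by (simp add: set_eq_iff not_less)
  moreover have "{s. \<phi> s > e * (j - 1)} - {s. \<phi> s > e * j} \<in> \<Sigma>" for j :: int
    using assms(2) by (intro Diff) (auto simp: bmeas_def)
  ultimately have "k -` {j} \<in> \<Sigma>" for j by simp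
  moreover have "finite (range k)"
  proof -
    obtain B where B: "\<And>s. \<bar>\<phi> s\<bar> \<le> B"
      using assms(2) by (auto simp: bmeas_def bounded_iff)
    have "range k \<subseteq> {\<lceil>- B / e\<rceil>..\<lceil>B / e\<rceil>}"
    proof (clarsimp simp: k_def)
      fix s
      have "- B \<le> \<phi> s" "\<phi> s \<le> B" using B[of s] by auto
      then show "\<lceil>- (B / e)\<rceil> \<le> \<lceil>\<phi> s / e\<rceil> \<and> \<lceil>\<phi> s / e\<rceil> \<le> \<lceil>B / e\<rceil>"
        using assms(3) by (intro conjI ceiling_mono) (auto simp: field_simps)
    qed
    then show ?thesis by (rule finite_subset) simp
  qed
  ultimately have "finmeas \<Sigma> k" by (simp add: finmeas_def)
  then have "finmeas \<Sigma> (\<lambda>s. e * (k s - 1))"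
    by (rule finmeas_comp[OF alg])
  moreover have "e * (k s - 1) \<le> \<phi> s \<and> \<phi> s \<le> e * (k s - 1) + e" for s
  proof -
    have "k s - 1 < \<phi> s / e" "\<phi> s / e \<le> k s"
      unfolding k_def by linarith+
    then show ?thesis using assms(3) by (simp add: field_simps)
  qed
  ultimately show ?thesis by (intro that) auto
qed

text \<open>Uniform limit of integrals of simple functions, which depend on finitely many
  coordinates of \<open>p\<close>. The error \<open>inverse (real (Suc n))\<close> is independent of
  \<open>p\<close> because all masses are 1.\<close>

lemma continuous_on_fa_integral:
  assumes alg: "algebra UNIV \<Sigma>" and \<phi>: "bmeas \<Sigma> \<phi>"
  shows "continuous_on (fa_probs \<Sigma>) (\<lambda>p. fa_integral \<Sigma> p \<phi>)"
proof -
  have "\<exists>\<psi>. finmeas \<Sigma> \<psi> \<and> (\<forall>s. \<psi> s \<le> \<phi> s \<and> \<phi> s \<le> \<psi> s + inverse (real (Suc n)))" for n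
    using bmeas_approx[OF assms, of "inverse (real (Suc n))"] by (metis inverse_positive_iff_positive of_nat_0_less_iff zero_less_Suc)
  then obtain \<psi> where \<psi>: "\<And>n. finmeas \<Sigma> (\<psi> n)" "\<And>n s. \<psi> n s \<le> \<phi> s"
    "\<And>n s. \<phi> s \<le> \<psi> n s + inverse (real (Suc n))" by metis
  have "uniform_limit (fa_probs \<Sigma>) (\<lambda>n p. simple_integral p (\<psi> n)) (\<lambda>p. fa_integral \<Sigma> p \<phi>) sequentially"
  proof (rule uniform_limitI)
    fix e :: real assume "e > 0"
    have "\<forall>\<^sub>F n in sequentially. inverse (real (Suc n)) < e"
      using LIMSEQ_inverse_real_of_nat \<open>e > 0\<close> by (rule order_tendstoD)
    then show "\<forall>\<^sub>F n in sequentially. \<forall>p\<in>fa_probs \<Sigma>. dist (simple_integral p (\<psi> n)) (fa_integral \<Sigma> p \<phi>) < e"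
    proof (rule eventually_mono, intro ballI)
      fix n p assume n: "inverse (real (Suc n)) < e" and p: "p \<in> fa_probs \<Sigma>"
      let ?d = "\<lambda>_. inverse (real (Suc n))"
      have "finmeas \<Sigma> (\<psi> n + ?d)"
        using finmeas_comp[OF alg \<psi>(1)[of n], of "\<lambda>y. y + inverse (real (Suc n))"] by (simp add: plus_fun_def)
      then have "fa_integral \<Sigma> p \<phi> \<le> simple_integral p (\<psi> n + ?d)"
        using \<psi> by (intro fa_integral_bounds(2)[OF alg p \<psi>(1)[of n]]) auto
      also have "\<dots> = simple_integral p (\<psi> n) + inverse (real (Suc n))"
        using simple_integral_add[OF alg p \<psi>(1)[of n] finmeas_const[OF alg]] simple_integral_const[OF p] by simp
      finally have "fa_integral \<Sigma> p \<phi> \<le> simple_integral p (\<psi> n) + inverse (real (Suc n))" .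
      moreover have "simple_integral p (\<psi> n) \<le> fa_integral \<Sigma> p \<phi>"
        using \<open>finmeas \<Sigma> (\<psi> n + ?d)\<close> \<psi> by (intro fa_integral_bounds(1)[OF alg p]) auto
      ultimately show "dist (simple_integral p (\<psi> n)) (fa_integral \<Sigma> p \<phi>) < e"
        using n by (simp add: dist_real_def)
    qed
  qed
  then show ?thesis
    by (intro uniform_limit_theorem[where F = sequentially]) (auto simp: continuous_on_simple_integral)
qed

text \<open>On \<open>\<Delta>\<close> the weak* topology is the topology of setwise convergence.\<close>

lemma compactin_weak_star:
  assumes alg: "algebra UNIV \<Sigma>" and C: "C \<subseteq> fa_probs \<Sigma>"
  shows "compactin (weak_star \<Sigma>) C \<longleftrightarrow> compact C"
proof
  let ?f = "\<lambda>p. restrict (\<lambda>\<phi>. fa_integral \<Sigma> p \<phi>) (Collect (bmeas \<Sigma>))"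
  let ?T = "product_topology (\<lambda>_. euclideanreal) (Collect (bmeas \<Sigma>))"
  {
    assume comp: "compactin (weak_star \<Sigma>) C"
    \<comment> \<open>On measurable events evaluation is integration of the indicator; off
      \<open>\<Sigma>\<close> it is constantly 0 on the space of probabilities.\<close>
    have "continuous_map (weak_star \<Sigma>) euclideanreal (\<lambda>p. p A)" for A
    proof (cases "A \<in> \<Sigma>")
      case True
      have "bmeas \<Sigma> (indicator A)"
        using bmeas_if_finmeas[OF alg finmeas_indicator[OF alg True]] .
      then have "continuous_map ?T euclideanreal (\<lambda>F. F (indicator A))"
        by (intro continuous_map_product_projection) simp
      then have "continuous_map (weak_star \<Sigma>) euclideanreal ((\<lambda>F. F (indicator A)) \<circ> ?f)"
        unfolding weak_star_def by (rule continuous_map_pullback)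
      then show ?thesis
      proof (rule continuous_map_eq)
        fix p assume "p \<in> topspace (weak_star \<Sigma>)"
        then have p: "p \<in> fa_probs \<Sigma>" by (simp add: weak_star_def topspace_pullback_topology)
        show "((\<lambda>F. F (indicator A)) \<circ> ?f) p = p A"
          using \<open>bmeas \<Sigma> (indicator A)\<close> fa_integral_simple[OF alg p finmeas_indicator[OF alg True]]
            simple_integral_indicator[OF alg p True] by simp
      qed
    next
      case False
      have "continuous_map (weak_star \<Sigma>) euclideanreal (\<lambda>_. 0)" by simp
      then show ?thesis
        by (rule continuous_map_eq)
          (use False in \<open>auto simp: weak_star_def topspace_pullback_topology fa_probs_def\<close>)
    qed
    then have "continuous_map (weak_star \<Sigma>) euclidean (\<lambda>p. p)"
      unfolding euclidean_product_topology[symmetric] continuous_map_componentwise_UNIV by simp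
    then have "compactin euclidean ((\<lambda>p. p) ` C)"
      using comp by (rule image_compactin[rotated])
    then show "compact C" by simp
  }
  assume "compact C"
  moreover have "continuous_map (top_of_set (fa_probs \<Sigma>)) (weak_star \<Sigma>) (\<lambda>p. p)"
    unfolding weak_star_def
  proof (rule continuous_map_pullback')
    show "continuous_map (top_of_set (fa_probs \<Sigma>)) ?T (?f \<circ> (\<lambda>p. p))"
      using continuous_on_fa_integral[OF alg]
      by (auto simp: continuous_map_componentwise comp_def)
  qed auto
  ultimately have "compactin (weak_star \<Sigma>) ((\<lambda>p. p) ` C)"
    using C by (intro image_compactin[of "top_of_set (fa_probs \<Sigma>)"]) (auto simp: compactin_subtopology)
  then show "compactin (weak_star \<Sigma>) C" by simp
qed

text \<open>The nearest point to \<open>q\<close> in \<open>C\<close>, with respect to finitely many events that already distinguish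
  \<open>q\<close> from every element of \<open>C\<close>, yields the separating simple function.\<close>

lemma separating_simple_fn:
  assumes alg: "algebra UNIV \<Sigma>" and C: "C \<subseteq> fa_probs \<Sigma>" "compact C" "convex_probs C" "C \<noteq> {}"
    and q: "q \<in> fa_probs \<Sigma>" "q \<notin> C"
  obtains \<phi> m where "\<phi> \<in> simple_space \<Sigma>" "simple_integral q \<phi> < m" "\<And>p. p \<in> C \<Longrightarrow> m \<le> simple_integral p \<phi>"
proof -
  have cont [continuous_intros]: "continuous_on S (\<lambda>p. p A)" for A :: "'a set" and S :: "('a set \<Rightarrow> real) set"
    by (rule continuous_on_subset[OF continuous_on_product_coordinates]) simp
  have ex: "\<exists>A\<in>\<Sigma>. p A \<noteq> q A" if "p \<in> C" for p
  proof (rule ccontr)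
    assume "\<not> (\<exists>A\<in>\<Sigma>. p A \<noteq> q A)"
    then have "p A = q A" for A
      using fa_probsD(3)[OF q(1), of A] fa_probsD(3)[of p \<Sigma> A] C(1) that by (cases "A \<in> \<Sigma>") auto
    then have "p = q" by (rule ext)
    then show False using that q(2) by simp
  qed
  have cover: "C \<subseteq> (\<Union>A\<in>\<Sigma>. {p. p A \<noteq> q A})"
  proof
    fix p assume "p \<in> C"
    from ex[OF this] show "p \<in> (\<Union>A\<in>\<Sigma>. {p. p A \<noteq> q A})" by simp
  qed
  \<comment> \<open>Compactness reduces the cover to finitely many events, so that a Euclidean
    distance to \<open>q\<close> becomes available.\<close>
  have "open {p. p A \<noteq> q A}" for A :: "'a set"
    by (intro open_Collect_neq continuous_intros)
  then obtain F where F: "F \<subseteq> \<Sigma>" "finite F" "C \<subseteq> (\<Union>A\<in>F. {p. p A \<noteq> q A})"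
    by (rule compactE_image[OF C(2) _ cover])
  have "continuous_on C (\<lambda>p. \<Sum>A\<in>F. (p A - q A)\<^sup>2)"
    by (intro continuous_intros)
  then obtain p0 where p0: "p0 \<in> C" and min: "\<And>p. p \<in> C \<Longrightarrow> (\<Sum>A\<in>F. (p0 A - q A)\<^sup>2) \<le> (\<Sum>A\<in>F. (p A - q A)\<^sup>2)"
    using continuous_attains_inf[OF C(2,4)] by blast
  define d where "d A = p0 A - q A" for A
  have dpos: "0 < (\<Sum>A\<in>F. (d A)\<^sup>2)"
  proof -
    obtain A where "A \<in> F" "p0 A \<noteq> q A" using F p0 by blast
    then show ?thesis using F(2) by (intro sum_pos2[of F A]) (auto simp: d_def)
  qed
  \<comment> \<open>First-order condition at the nearest point \<open>p0\<close>: up to the factor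
    2, this sum is the derivative of the squared distance along the segment from \<open>p0\<close>
    to \<open>p\<close>.\<close>
  have var: "0 \<le> (\<Sum>A\<in>F. d A * (p A - p0 A))" if p: "p \<in> C" for p
  proof (rule ccontr)
    define b where "b = (\<Sum>A\<in>F. d A * (p A - p0 A))"
    define c where "c = (\<Sum>A\<in>F. (p A - p0 A)\<^sup>2)"
    assume "\<not> 0 \<le> (\<Sum>A\<in>F. d A * (p A - p0 A))"
    then have b: "b < 0" by (simp add: b_def)
    have c: "c \<ge> 0" by (auto simp: c_def intro: sum_nonneg)
    have quad: "0 \<le> 2 * b + t * c" if t: "0 < t" "t \<le> 1" for t
    proof -
      have "(\<lambda>A. t * p A + (1 - t) * p0 A) \<in> C"
        using C(3) p p0 t by (auto simp: convex_probs_def)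
      from min[OF this] have "(\<Sum>A\<in>F. (d A)\<^sup>2) \<le> (\<Sum>A\<in>F. (t * p A + (1 - t) * p0 A - q A)\<^sup>2)"
        by (simp add: d_def)
      also have "\<dots> = (\<Sum>A\<in>F. (d A)\<^sup>2 + t * (2 * (d A * (p A - p0 A)) + t * (p A - p0 A)\<^sup>2))"
        by (intro sum.cong refl) (simp add: d_def power2_eq_square algebra_simps)
      also have "\<dots> = (\<Sum>A\<in>F. (d A)\<^sup>2) + t * (2 * b + t * c)"
        by (simp add: sum.distrib sum_distrib_left b_def c_def distrib_left)
      finally show ?thesis using t by (simp add: zero_le_mult_iff)
    qed
    \<comment> \<open>Small enough that \<open>t * c \<le> - b\<close>, whence
      \<open>2 * b + t * c \<le> b < 0\<close>. The summand 1 covers the case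
      \<open>c = 0\<close>.\<close>
    define t where "t = min 1 (- b / (c + 1))"
    have "t * (c + 1) \<le> - b / (c + 1) * (c + 1)"
      using c by (intro mult_right_mono) (auto simp: t_def)
    then have tc: "t * (c + 1) \<le> - b" using c by simp
    have t: "0 < t" "t \<le> 1" using b c by (auto simp: t_def divide_less_0_iff)
    then have "t * c \<le> - b" using tc by (simp add: distrib_left)
    then show False using quad[OF t] b by simp
  qed
  \<comment> \<open>The separating function has the displacement from \<open>q\<close> to
    \<open>p0\<close> as coefficients; its integrals against \<open>p0\<close> and \<open>q\<close>
    differ by the squared distance.\<close>
  define e where "e A = d A *\<^sub>R (indicator A :: 'a \<Rightarrow> real)" for A
  define \<phi> where "\<phi> = (\<Sum>A\<in>F. e A)"
  note sub = subspace_simple_space[OF alg]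
  have e: "e A \<in> simple_space \<Sigma>" "p \<in> fa_probs \<Sigma> \<Longrightarrow> simple_integral p (e A) = d A * p A"
    if "A \<in> \<Sigma>" for A p
    using finmeas_indicator[OF alg that] simple_integral_cmult[OF alg _ finmeas_indicator[OF alg that]]
      simple_integral_indicator[OF alg _ that] sub
    by (auto simp only: e_def mem_simple_space[symmetric] subspace_scale)
  have int: "(\<Sum>A\<in>G. e A) \<in> simple_space \<Sigma> \<and>
      simple_integral p (\<Sum>A\<in>G. e A) = (\<Sum>A\<in>G. d A * p A)"
    if "p \<in> fa_probs \<Sigma>" "finite G" "G \<subseteq> \<Sigma>" for p G
    using that(2,3)
  proof induction
    case empty
    then show ?case
      using simple_integral_const[OF that(1), of 0] simple_space_const[OF alg, of 0]
      by (simp add: zero_fun_def)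
  next
    case (insert A G)
    then have IH: "(\<Sum>A\<in>G. e A) \<in> simple_space \<Sigma>" "simple_integral p (\<Sum>A\<in>G. e A) = (\<Sum>A\<in>G. d A * p A)"
      and A: "A \<in> \<Sigma>" by auto
    show ?case
      unfolding sum.insert[OF insert.hyps] using e(1)[OF A] e(2)[OF A that(1)] IH sub
        simple_integral_add[OF alg that(1), of "e A" "\<Sum>A\<in>G. e A"]
      by (auto simp only: mem_simple_space[symmetric] subspace_add)
  qed
  show ?thesis
  proof (rule that[of \<phi> "\<Sum>A\<in>F. d A * p0 A"])
    show "\<phi> \<in> simple_space \<Sigma>" using int[OF q(1) F(2,1)] by (simp add: \<phi>_def)
    have "simple_integral q \<phi> = (\<Sum>A\<in>F. d A * q A)"
      using int[OF q(1) F(2,1)] by (simp add: \<phi>_def)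
    also have "\<dots> = (\<Sum>A\<in>F. d A * p0 A) - (\<Sum>A\<in>F. (d A)\<^sup>2)"
      by (simp add: sum_subtractf[symmetric] d_def power2_eq_square algebra_simps)
    finally show "simple_integral q \<phi> < (\<Sum>A\<in>F. d A * p0 A)" using dpos by simp
    show "(\<Sum>A\<in>F. d A * p0 A) \<le> simple_integral p \<phi>" if "p \<in> C" for p
      using int[of p F] var[OF that] C(1) that F
      by (auto simp: \<phi>_def right_diff_distrib sum_subtractf)
  qed
qed

section \<open>Lower previsions and their cores\<close>

text \<open>These are the coherent lower previsions of imprecise probability, in their superlinear
  form. Values at functions that are not simple are left arbitrary.\<close>

definition lower_prev :: "'s set set \<Rightarrow> (('s \<Rightarrow> real) \<Rightarrow> real) \<Rightarrow> bool" where
  "lower_prev \<Sigma> K \<longleftrightarrow>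
     (\<forall>\<phi>\<in>simple_space \<Sigma>. \<forall>\<psi>\<in>simple_space \<Sigma>. K \<phi> + K \<psi> \<le> K (\<phi> + \<psi>)) \<and>
     (\<forall>\<phi>\<in>simple_space \<Sigma>. \<forall>c>0. K (c *\<^sub>R \<phi>) = c * K \<phi>) \<and>
     (\<forall>\<phi>\<in>simple_space \<Sigma>. \<forall>\<psi>\<in>simple_space \<Sigma>. (\<forall>s. \<phi> s \<le> \<psi> s) \<longrightarrow> K \<phi> \<le> K \<psi>) \<and>
     (\<forall>c. K (\<lambda>_. c) = c)"

lemma lower_prevD:
  assumes "lower_prev \<Sigma> K"
  shows "\<phi> \<in> simple_space \<Sigma> \<Longrightarrow> \<psi> \<in> simple_space \<Sigma> \<Longrightarrow> K \<phi> + K \<psi> \<le> K (\<phi> + \<psi>)"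
    "\<phi> \<in> simple_space \<Sigma> \<Longrightarrow> c > 0 \<Longrightarrow> K (c *\<^sub>R \<phi>) = c * K \<phi>"
    "\<phi> \<in> simple_space \<Sigma> \<Longrightarrow> \<psi> \<in> simple_space \<Sigma> \<Longrightarrow> (\<And>s. \<phi> s \<le> \<psi> s) \<Longrightarrow> K \<phi> \<le> K \<psi>"
    "K (\<lambda>_. c) = c"
  using assms unfolding lower_prev_def by blast+

text \<open>Superadditivity with the constant \<open>c\<close> gives one inequality; undoing the
  translation with \<open>- c\<close> gives the other.\<close>

lemma lower_prev_add_const:
  assumes alg: "algebra UNIV \<Sigma>" and K: "lower_prev \<Sigma> K" and \<phi>: "\<phi> \<in> simple_space \<Sigma>"
  shows "K (\<phi> + (\<lambda>_. c)) = K \<phi> + c"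
proof (rule antisym)
  note c = simple_space_const[OF alg]
  have \<phi>c: "\<phi> + (\<lambda>_. c) \<in> simple_space \<Sigma>"
    using subspace_add[OF subspace_simple_space[OF alg]] \<phi> c by blast
  have "K (\<phi> + (\<lambda>_. c)) + K (\<lambda>_. - c) \<le> K (\<phi> + (\<lambda>_. c) + (\<lambda>_. - c))"
    by (rule lower_prevD(1)[OF K \<phi>c c])
  moreover have "\<phi> + (\<lambda>_. c) + (\<lambda>_. - c) = \<phi>" by (simp add: fun_eq_iff)
  ultimately show "K (\<phi> + (\<lambda>_. c)) \<le> K \<phi> + c" using lower_prevD(4)[OF K] by simp
  show "K \<phi> + c \<le> K (\<phi> + (\<lambda>_. c))"
    using lower_prevD(1)[OF K \<phi> c] lower_prevD(4)[OF K] by metis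
qed

lemma lower_prev_zero: "lower_prev \<Sigma> K \<Longrightarrow> K 0 = 0"
  using lower_prevD(4)[of \<Sigma> K 0] by (simp add: zero_fun_def)

definition core :: "'s set set \<Rightarrow> (('s \<Rightarrow> real) \<Rightarrow> real) \<Rightarrow> ('s set \<Rightarrow> real) set" where
  "core \<Sigma> K = {p \<in> fa_probs \<Sigma>. \<forall>\<phi>\<in>simple_space \<Sigma>. K \<phi> \<le> simple_integral p \<phi>}"

lemma compact_core:
  assumes "algebra UNIV \<Sigma>"
  shows "compact (core \<Sigma> K)"
proof -
  have "closed (\<Inter>\<phi>\<in>simple_space \<Sigma>. {p. K \<phi> \<le> simple_integral p \<phi>})"
    by (intro closed_INT ballI closed_Collect_le continuous_on_simple_integral continuous_on_const)
  moreover have "core \<Sigma> K = fa_probs \<Sigma> \<inter> (\<Inter>\<phi>\<in>simple_space \<Sigma>. {p. K \<phi> \<le> simple_integral p \<phi>})"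
    by (auto simp: core_def)
  ultimately show ?thesis
    using compact_Int_closed[OF compact_fa_probs[OF assms]] by simp
qed

lemma convex_core: "convex_probs (core \<Sigma> K)"
  unfolding convex_probs_def
proof (intro ballI)
  fix p q and a :: real assume pq: "p \<in> core \<Sigma> K" "q \<in> core \<Sigma> K" and a: "a \<in> {0..1}"
  let ?r = "\<lambda>A. a * p A + (1 - a) * q A"
  have "?r \<in> fa_probs \<Sigma>"
    unfolding fa_probs_def
  proof (intro CollectI conjI ballI allI impI)
    show "0 \<le> ?r A" if "A \<in> \<Sigma>" for A
      using pq a that by (intro add_nonneg_nonneg mult_nonneg_nonneg) (auto simp: core_def fa_probs_def)
  qed (use pq in \<open>auto simp: core_def fa_probs_def algebra_simps\<close>)
  moreover have "K \<phi> \<le> simple_integral ?r \<phi>" if "\<phi> \<in> simple_space \<Sigma>" for \<phi>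
  proof -
    have "simple_integral ?r \<phi> = a * simple_integral p \<phi> + (1 - a) * simple_integral q \<phi>"
      unfolding simple_integral_def sum_distrib_left sum.distrib[symmetric]
      by (intro sum.cong refl) (simp add: algebra_simps)
    moreover have "a * K \<phi> + (1 - a) * K \<phi> \<le> a * simple_integral p \<phi> + (1 - a) * simple_integral q \<phi>"
      using pq a that by (intro add_mono mult_left_mono) (auto simp: core_def)
    ultimately show ?thesis by (simp add: algebra_simps)
  qed
  ultimately show "?r \<in> core \<Sigma> K" by (simp add: core_def)
qed

text \<open>By oddness of \<open>l\<close>, the bound by the conjugate is the same as
  \<open>K \<le> l\<close>. Positivity then follows from monotonicity of \<open>K\<close>, and
  \<open>l\<close> is 1 at the constant 1 because both bounds agree there.\<close>

lemma core_of_linear: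
  assumes alg: "algebra UNIV \<Sigma>" and K: "lower_prev \<Sigma> K"
    and add: "\<And>\<phi> \<psi>. \<phi> \<in> simple_space \<Sigma> \<Longrightarrow> \<psi> \<in> simple_space \<Sigma> \<Longrightarrow> l (\<phi> + \<psi>) = l \<phi> + l \<psi>"
    and scale: "\<And>c \<phi>. \<phi> \<in> simple_space \<Sigma> \<Longrightarrow> l (c *\<^sub>R \<phi>) = c * l \<phi>"
    and le: "\<And>\<phi>. \<phi> \<in> simple_space \<Sigma> \<Longrightarrow> l \<phi> \<le> - K (- \<phi>)"
  obtains p where "p \<in> core \<Sigma> K" "\<And>\<phi>. \<phi> \<in> simple_space \<Sigma> \<Longrightarrow> simple_integral p \<phi> = l \<phi>"
proof -
  note sub = subspace_simple_space[OF alg]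
  have ge: "K \<phi> \<le> l \<phi>" if "\<phi> \<in> simple_space \<Sigma>" for \<phi>
    using le[OF subspace_neg[OF sub that]] scale[OF that, of "- 1"] by simp
  have "0 \<le> l \<phi>" if "\<phi> \<in> simple_space \<Sigma>" "\<And>s. 0 \<le> \<phi> s" for \<phi>
    using lower_prevD(3)[OF K simple_space_const[OF alg, of 0] that] lower_prevD(4)[OF K, of 0] ge[OF that(1)]
    by simp
  moreover have "l (\<lambda>_. 1) = 1"
  proof -
    have "- (\<lambda>_. 1 :: real) = (\<lambda>_::'a. - 1)" by (simp add: fun_eq_iff)
    then show ?thesis
      using le[OF simple_space_const[OF alg, of 1]] ge[OF simple_space_const[OF alg, of 1]]
        lower_prevD(4)[OF K] by (metis minus_minus order_antisym)
  qed
  ultimately obtain p where p: "p \<in> fa_probs \<Sigma>" "\<And>\<phi>. \<phi> \<in> simple_space \<Sigma> \<Longrightarrow> simple_integral p \<phi> = l \<phi>"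
    using fa_prob_of_linear[OF alg add scale] by metis
  then have "p \<in> core \<Sigma> K" using ge by (simp add: core_def)
  then show ?thesis using that p(2) by blast
qed

lemma sublinear_conj_lower_prev:
  assumes alg: "algebra UNIV \<Sigma>" and K: "lower_prev \<Sigma> K"
  shows "sublinear_on (simple_space \<Sigma>) (\<lambda>\<phi>. - K (- \<phi>))"
  unfolding sublinear_on_def
proof (intro conjI ballI allI impI)
  note neg = subspace_neg[OF subspace_simple_space[OF alg]]
  fix \<phi> \<psi> and c :: real assume \<phi>: "\<phi> \<in> simple_space \<Sigma>"
  show "- K (- (c *\<^sub>R \<phi>)) = c * - K (- \<phi>)" if "c > 0"
    using lower_prevD(2)[OF K neg[OF \<phi>] that] by simp
  assume \<psi>: "\<psi> \<in> simple_space \<Sigma>"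
  have "- (\<phi> + \<psi>) = - \<phi> + - \<psi>" by simp
  then show "- K (- (\<phi> + \<psi>)) \<le> - K (- \<phi>) + - K (- \<psi>)"
    using lower_prevD(1)[OF K neg[OF \<phi>] neg[OF \<psi>]] by (simp only:)
qed

text \<open>On the ray of \<open>- \<phi>\<close> the conjugate \<open>q\<close> is already linear,
  so a linear functional below \<open>q\<close> can be made to touch it there. Since
  \<open>q (- \<phi>) = - K \<phi>\<close>, touching means that the functional takes the value
  \<open>K \<phi>\<close> at \<open>\<phi>\<close>.\<close>

lemma core_attains:
  assumes alg: "algebra UNIV \<Sigma>" and K: "lower_prev \<Sigma> K" and \<phi>: "\<phi> \<in> simple_space \<Sigma>"
  obtains p where "p \<in> core \<Sigma> K" "simple_integral p \<phi> = K \<phi>"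
proof -
  note sub = subspace_simple_space[OF alg]
  define q where "q \<psi> = - K (- \<psi>)" for \<psi>
  have q: "sublinear_on (simple_space \<Sigma>) q"
    unfolding q_def by (rule sublinear_conj_lower_prev[OF alg K])
  define R where "R = {t *\<^sub>R (- \<phi>) | t. t \<ge> 0}"
  have m\<phi>: "- \<phi> \<in> simple_space \<Sigma>" by (rule subspace_neg[OF sub \<phi>])
  have R: "R \<subseteq> simple_space \<Sigma>" using subspace_scale[OF sub m\<phi>] by (auto simp only: R_def)
  have q0: "q 0 = 0" by (rule sublinear_on_zero[OF q sub])
  have scale: "q (t *\<^sub>R \<psi>) = t * q \<psi>" if "t \<ge> 0" "\<psi> \<in> simple_space \<Sigma>" for t \<psi>
    using q that q0 unfolding sublinear_on_def by (cases "t = 0") auto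
  obtain l where l: "\<And>x y. x \<in> simple_space \<Sigma> \<Longrightarrow> y \<in> simple_space \<Sigma> \<Longrightarrow> l (x + y) = l x + l y"
    "\<And>c x. x \<in> simple_space \<Sigma> \<Longrightarrow> l (c *\<^sub>R x) = c * l x" "\<And>x. x \<in> simple_space \<Sigma> \<Longrightarrow> l x \<le> q x"
    "\<And>x. x \<in> R \<Longrightarrow> q x \<le> l x"
  proof (rule hahn_banach_sandwich[OF q sub R, of q])
    show "0 \<in> R" unfolding R_def by (rule CollectI, rule exI[of _ 0]) simp
    fix x assume x: "x \<in> R"
    then obtain s where s: "x = s *\<^sub>R (- \<phi>)" "s \<ge> 0" unfolding R_def by blast
    show "c *\<^sub>R x \<in> R" if "c > 0" for c
      unfolding R_def s(1) scaleR_scaleR using s(2) that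
      by (intro CollectI exI[of _ "c * s"] conjI refl) simp
    show "q (c *\<^sub>R x) = c * q x" if "c > 0" for c
      using scale that R x by auto
    fix y assume y: "y \<in> R"
    then obtain t where t: "y = t *\<^sub>R (- \<phi>)" "t \<ge> 0" unfolding R_def by blast
    have xy: "x + y = (s + t) *\<^sub>R (- \<phi>)" unfolding s(1) t(1) by (rule scaleR_left_distrib[symmetric])
    then show "x + y \<in> R" unfolding R_def using s(2) t(2) by (intro CollectI exI[of _ "s + t"]) simp
    have "q (x + y) = (s + t) * q (- \<phi>)" unfolding xy using s t by (intro scale m\<phi>) simp
    then show "q x + q y \<le> q (x + y)"
      unfolding s(1) t(1) scale[OF s(2) m\<phi>] scale[OF t(2) m\<phi>] by (simp add: distrib_right)
  qed (use q0 in auto)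
  obtain p where p: "p \<in> core \<Sigma> K" "\<And>\<psi>. \<psi> \<in> simple_space \<Sigma> \<Longrightarrow> simple_integral p \<psi> = l \<psi>"
    using core_of_linear[OF alg K l(1,2)] l(3) unfolding q_def by metis
  have "- \<phi> \<in> R" unfolding R_def by (rule CollectI, rule exI[of _ 1]) simp
  then have "q (- \<phi>) \<le> l (- \<phi>)" by (rule l(4))
  then have "l \<phi> \<le> K \<phi>" using l(2)[OF \<phi>, of "- 1"] by (simp add: q_def)
  moreover have "K \<phi> \<le> l \<phi>" using p \<phi> by (auto simp: core_def)
  ultimately show ?thesis using that p \<phi> by simp
qed

lemma INF_core:
  assumes alg: "algebra UNIV \<Sigma>" and K: "lower_prev \<Sigma> K" and \<phi>: "\<phi> \<in> simple_space \<Sigma>"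
  shows "(INF p\<in>core \<Sigma> K. simple_integral p \<phi>) = K \<phi>"
proof -
  obtain p where p: "p \<in> core \<Sigma> K" "simple_integral p \<phi> = K \<phi>"
    using core_attains[OF assms] .
  have "(INF p\<in>core \<Sigma> K. simple_integral p \<phi>) \<le> simple_integral p \<phi>"
    using p \<phi> by (intro cINF_lower bdd_belowI2[of _ "K \<phi>"]) (auto simp: core_def)
  moreover have "K \<phi> \<le> (INF p\<in>core \<Sigma> K. simple_integral p \<phi>)"
    using p \<phi> by (intro cINF_greatest) (auto simp: core_def)
  ultimately show ?thesis using p by simp
qed

text \<open>A linear functional squeezed between \<open>K\<close> and the conjugate of
  \<open>M\<close> is a common element: its upper bound puts it into the core of \<open>M\<close>,
  its lower bound into that of \<open>K\<close>.\<close>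

lemma cores_intersect:
  assumes alg: "algebra UNIV \<Sigma>" and K: "lower_prev \<Sigma> K" and M: "lower_prev \<Sigma> M"
    and le: "\<And>\<phi>. \<phi> \<in> simple_space \<Sigma> \<Longrightarrow> K \<phi> \<le> - M (- \<phi>)"
  shows "core \<Sigma> K \<inter> core \<Sigma> M \<noteq> {}"
proof -
  note sub = subspace_simple_space[OF alg]
  obtain l where l: "\<And>x y. x \<in> simple_space \<Sigma> \<Longrightarrow> y \<in> simple_space \<Sigma> \<Longrightarrow> l (x + y) = l x + l y"
    "\<And>c x. x \<in> simple_space \<Sigma> \<Longrightarrow> l (c *\<^sub>R x) = c * l x"
    "\<And>x. x \<in> simple_space \<Sigma> \<Longrightarrow> l x \<le> - M (- x)" "\<And>x. x \<in> simple_space \<Sigma> \<Longrightarrow> K x \<le> l x"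
  proof (rule hahn_banach_sandwich[OF sublinear_conj_lower_prev[OF alg M] sub subset_refl, of K])
    show "0 \<in> simple_space \<Sigma>" by (rule subspace_0[OF sub])
    show "K 0 = 0" by (rule lower_prev_zero[OF K])
    fix x assume x: "x \<in> simple_space \<Sigma>"
    show "K x \<le> - M (- x)" by (rule le[OF x])
    show "c *\<^sub>R x \<in> simple_space \<Sigma>" for c by (rule subspace_scale[OF sub x])
    show "K (c *\<^sub>R x) = c * K x" if "c > 0" for c by (rule lower_prevD(2)[OF K x that])
    fix y assume y: "y \<in> simple_space \<Sigma>"
    show "x + y \<in> simple_space \<Sigma>" by (rule subspace_add[OF sub x y])
    show "K x + K y \<le> K (x + y)" by (rule lower_prevD(1)[OF K x y])
  qed auto
  obtain p where p: "p \<in> core \<Sigma> M" "\<And>\<psi>. \<psi> \<in> simple_space \<Sigma> \<Longrightarrow> simple_integral p \<psi> = l \<psi>"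
    using core_of_linear[OF alg M l(1,2,3)] by metis
  then have "p \<in> core \<Sigma> K" using l(4) by (simp add: core_def)
  then show ?thesis using p by blast
qed

section \<open>Lower envelopes of sets of probabilities\<close>

lemma bdd_below_simple_integral:
  assumes alg: "algebra UNIV \<Sigma>" and C: "C \<subseteq> fa_probs \<Sigma>" and \<phi>: "\<phi> \<in> simple_space \<Sigma>"
  shows "bdd_below ((\<lambda>p. simple_integral p \<phi>) ` C)"
proof -
  obtain B where B: "\<And>s. \<bar>\<phi> s\<bar> < B"
    using finmeas_bounded \<phi> unfolding mem_simple_space by metis
  have "- B \<le> \<phi> s" for s using B[of s] by linarith
  then have "- B \<le> simple_integral p \<phi>" if "p \<in> C" for p
    using simple_integral_mono[OF alg, of p "\<lambda>_. - B" \<phi>] simple_integral_const[of p \<Sigma> "- B"]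
      finmeas_const[OF alg, of "- B"] \<phi> subsetD[OF C that] by (simp add: mem_simple_space)
  then show ?thesis by (rule bdd_belowI2)
qed

text \<open>Lets necessity and uniqueness be argued for functionals alone: any representing pair of
  sets is first replaced by its lower envelopes.\<close>

lemma lower_prev_INF:
  assumes alg: "algebra UNIV \<Sigma>" and C: "C \<subseteq> fa_probs \<Sigma>" "C \<noteq> {}"
  shows "lower_prev \<Sigma> (\<lambda>\<phi>. INF p\<in>C. simple_integral p \<phi>)"
proof -
  note bdd = bdd_below_simple_integral[OF alg C(1)]
  have low: "(INF p\<in>C. simple_integral p \<phi>) \<le> simple_integral p \<phi>"
    if "\<phi> \<in> simple_space \<Sigma>" "p \<in> C" for \<phi> p
    using bdd[OF that(1)] that(2) by (rule cINF_lower)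
  have le: "c * (INF p\<in>C. simple_integral p \<phi>) \<le> (INF p\<in>C. simple_integral p (c *\<^sub>R \<phi>))"
    if "\<phi> \<in> simple_space \<Sigma>" "c > 0" for \<phi> c
  proof (rule cINF_greatest[OF C(2)])
    fix p assume p: "p \<in> C"
    then have "simple_integral p (c *\<^sub>R \<phi>) = c * simple_integral p \<phi>"
      using C that simple_integral_cmult[OF alg] by (auto simp: mem_simple_space)
    then show "c * (INF p\<in>C. simple_integral p \<phi>) \<le> simple_integral p (c *\<^sub>R \<phi>)"
      using low[OF that(1) p] that(2) by simp
  qed
  show ?thesis
    unfolding lower_prev_def
  proof (intro conjI ballI allI impI)
    fix \<phi> assume \<phi>: "\<phi> \<in> simple_space \<Sigma>"
    show "(INF p\<in>C. simple_integral p (c *\<^sub>R \<phi>)) = c * (INF p\<in>C. simple_integral p \<phi>)" if "c > 0" for c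
    proof (rule antisym)
      have "inverse c * (INF p\<in>C. simple_integral p (c *\<^sub>R \<phi>)) \<le> (INF p\<in>C. simple_integral p (inverse c *\<^sub>R c *\<^sub>R \<phi>))"
        using that \<phi> subspace_scale[OF subspace_simple_space[OF alg]] by (intro le) auto
      then show "(INF p\<in>C. simple_integral p (c *\<^sub>R \<phi>)) \<le> c * (INF p\<in>C. simple_integral p \<phi>)"
        using that by (simp add: field_simps)
    qed (rule le[OF \<phi> that])
    fix \<psi> assume \<psi>: "\<psi> \<in> simple_space \<Sigma>"
    show "(INF p\<in>C. simple_integral p \<phi>) + (INF p\<in>C. simple_integral p \<psi>) \<le> (INF p\<in>C. simple_integral p (\<phi> + \<psi>))"
    proof (rule cINF_greatest[OF C(2)])
      fix p assume p: "p \<in> C"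
      then have "simple_integral p (\<phi> + \<psi>) = simple_integral p \<phi> + simple_integral p \<psi>"
        using C \<phi> \<psi> simple_integral_add[OF alg] by (auto simp: mem_simple_space)
      then show "(INF p\<in>C. simple_integral p \<phi>) + (INF p\<in>C. simple_integral p \<psi>) \<le> simple_integral p (\<phi> + \<psi>)"
        using low[OF \<phi> p] low[OF \<psi> p] by simp
    qed
    show "(INF p\<in>C. simple_integral p \<phi>) \<le> (INF p\<in>C. simple_integral p \<psi>)" if "\<forall>s. \<phi> s \<le> \<psi> s"
    proof (rule cINF_mono[OF C(2) bdd[OF \<phi>]])
      fix p assume "p \<in> C"
      then show "\<exists>q\<in>C. simple_integral q \<phi> \<le> simple_integral p \<psi>"
        using C \<phi> \<psi> simple_integral_mono[OF alg, of p \<phi> \<psi>] that by (auto simp: mem_simple_space)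
    qed
  next
    fix c
    have "(INF p\<in>C. simple_integral p (\<lambda>_. c)) = (INF p\<in>C. c)"
      using C simple_integral_const by (intro INF_cong) auto
    then show "(INF p\<in>C. simple_integral p (\<lambda>_. c)) = c" using C(2) by simp
  qed
qed

text \<open>Support functions determine compact convex sets: a point of \<open>C'\<close> outside
  \<open>C\<close> would be separated by a simple function whose infimum over \<open>C'\<close>
  falls below that over \<open>C\<close>.\<close>

lemma subset_of_INF_le:
  assumes alg: "algebra UNIV \<Sigma>" and C: "C \<subseteq> fa_probs \<Sigma>" "compact C" "convex_probs C" "C \<noteq> {}"
    and C': "C' \<subseteq> fa_probs \<Sigma>"
    and le: "\<And>\<phi>. \<phi> \<in> simple_space \<Sigma> \<Longrightarrow> (INF p\<in>C. simple_integral p \<phi>) \<le> (INF p\<in>C'. simple_integral p \<phi>)"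
  shows "C' \<subseteq> C"
proof
  fix q assume q: "q \<in> C'"
  show "q \<in> C"
  proof (rule ccontr)
    assume "q \<notin> C"
    then obtain \<phi> m where \<phi>: "\<phi> \<in> simple_space \<Sigma>" "simple_integral q \<phi> < m"
      "\<And>p. p \<in> C \<Longrightarrow> m \<le> simple_integral p \<phi>"
      using separating_simple_fn[OF alg C, of q] C' q by blast
    have "m \<le> (INF p\<in>C. simple_integral p \<phi>)" using C(4) \<phi>(3) by (rule cINF_greatest)
    also have "\<dots> \<le> (INF p\<in>C'. simple_integral p \<phi>)" by (rule le[OF \<phi>(1)])
    also have "\<dots> \<le> simple_integral q \<phi>"
      using bdd_below_simple_integral[OF alg C' \<phi>(1)] q by (rule cINF_lower)
    finally show False using \<phi>(2) by simp
  qed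
qed

section \<open>Utility on outcomes\<close>

text \<open>The key to the next theorem is that \<open>x \<succ> y\<close> depends only on the direction of \<open>x - y\<close>,
  so that the relation is given by a cone \<open>G\<close> of differences; any two differences can be placed
  consecutively, as \<open>c (x - y)\<close> and \<open>c (y - z)\<close>.\<close>

theorem mixture_utility:
  fixes X :: "'x::real_vector set" and gt :: "'x \<Rightarrow> 'x \<Rightarrow> bool"
  assumes X: "convex X" and ab: "a \<in> X" "b \<in> X" "gt a b"
    and asym: "\<And>x y. x \<in> X \<Longrightarrow> y \<in> X \<Longrightarrow> gt x y \<Longrightarrow> \<not> gt y x"
    and negtrans: "\<And>x y z. x \<in> X \<Longrightarrow> y \<in> X \<Longrightarrow> z \<in> X \<Longrightarrow> \<not> gt x y \<Longrightarrow> \<not> gt y z \<Longrightarrow> \<not> gt x z"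
    and indep: "\<And>x y z t. x \<in> X \<Longrightarrow> y \<in> X \<Longrightarrow> z \<in> X \<Longrightarrow> 0 < t \<Longrightarrow> t < 1 \<Longrightarrow>
      gt x y \<longleftrightarrow> gt (t *\<^sub>R x + (1 - t) *\<^sub>R z) (t *\<^sub>R y + (1 - t) *\<^sub>R z)"
    and cont: "\<And>x y z. x \<in> X \<Longrightarrow> y \<in> X \<Longrightarrow> z \<in> X \<Longrightarrow> gt x y \<Longrightarrow>
      \<exists>t>0. t \<le> 1 \<and> gt x ((1 - t) *\<^sub>R y + t *\<^sub>R z)"
  obtains u where "affine_on X u" "\<And>x y. x \<in> X \<Longrightarrow> y \<in> X \<Longrightarrow> gt x y \<longleftrightarrow> u x > u y"
proof -
  have mixX: "t *\<^sub>R x + (1 - t) *\<^sub>R y \<in> X" if "x \<in> X" "y \<in> X" "0 \<le> t" "t \<le> 1" for x y t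
    using convexD[OF X that(1,2), of t "1 - t"] that by simp
  have trans: "gt x z" if "x \<in> X" "y \<in> X" "z \<in> X" "gt x y" "gt y z" for x y z
    using that asym negtrans by meson
  have irrefl: "\<not> gt x x" if "x \<in> X" for x using asym that by blast

  \<comment> \<open>Mixing the first pair equally with \<open>y'\<close> and the second with
    \<open>y\<close> yields the same pair, because \<open>x + y' = x' + y\<close>.\<close>
  have diff1: "gt x y \<longleftrightarrow> gt x' y'" if m: "x \<in> X" "y \<in> X" "x' \<in> X" "y' \<in> X" and eq: "x - y = x' - y'" for x y x' y'
  proof -
    have "x + y' = x' + y" using eq by (simp add: algebra_simps)
    then have "(1/2) *\<^sub>R x + (1 - 1/2) *\<^sub>R y' = (1/2) *\<^sub>R x' + (1 - 1/2) *\<^sub>R y"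
      by (simp add: scaleR_right_distrib[symmetric])
    then show ?thesis
      using indep[OF m(1,2,4), of "1/2"] indep[OF m(3,4,2), of "1/2"] by (simp add: add.commute)
  qed
  \<comment> \<open>Mixing with \<open>y'\<close> itself leaves \<open>y'\<close> in place and
    shrinks the difference by the factor \<open>c\<close>.\<close>
  have diff2: "gt x y \<longleftrightarrow> gt x' y'"
    if m: "x \<in> X" "y \<in> X" "x' \<in> X" "y' \<in> X" and eq: "x - y = c *\<^sub>R (x' - y')" and c: "0 < c" "c < 1" for x y x' y' c
  proof -
    have "gt x' y' \<longleftrightarrow> gt (c *\<^sub>R x' + (1 - c) *\<^sub>R y') (c *\<^sub>R y' + (1 - c) *\<^sub>R y')"
      using indep[OF m(3,4,4) c] .
    moreover have "c *\<^sub>R y' + (1 - c) *\<^sub>R y' = y'" by (simp add: scaleR_left_distrib[symmetric])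
    moreover have "x - y = c *\<^sub>R x' + (1 - c) *\<^sub>R y' - y'" using eq by (simp add: algebra_simps)
    ultimately show ?thesis using diff1[OF m(1,2) mixX[OF m(3,4)] m(4)] c by simp
  qed
  have diff: "gt x y \<longleftrightarrow> gt x' y'"
    if m: "x \<in> X" "y \<in> X" "x' \<in> X" "y' \<in> X" and eq: "c *\<^sub>R (x - y) = c' *\<^sub>R (x' - y')" and c: "0 < c" "0 < c'" for x y x' y' c c'
  proof (cases c c' rule: linorder_cases)
    case less
    have "inverse c' *\<^sub>R c *\<^sub>R (x - y) = inverse c' *\<^sub>R c' *\<^sub>R (x' - y')" using eq by simp
    then have "x' - y' = (c / c') *\<^sub>R (x - y)" using c by (simp add: field_simps)
    then show ?thesis using diff2[OF m(3,4,1,2), of "c / c'"] less c by simp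
  next
    case equal
    then have "x - y = x' - y'" using eq c by simp
    then show ?thesis using diff1[OF m] by simp
  next
    case greater
    have "inverse c *\<^sub>R c *\<^sub>R (x - y) = inverse c *\<^sub>R c' *\<^sub>R (x' - y')" using eq by simp
    then have "x - y = (c' / c) *\<^sub>R (x' - y')" using c by (simp add: field_simps)
    then show ?thesis using diff2[OF m, of "c' / c"] greater c by simp
  qed

  define W where "W = {c *\<^sub>R (x - y) | c x y. c > 0 \<and> x \<in> X \<and> y \<in> X}"
  define G where "G = {c *\<^sub>R (x - y) | c x y. c > 0 \<and> x \<in> X \<and> y \<in> X \<and> gt x y}"
  have WI: "c *\<^sub>R (x - y) \<in> W" if "c > 0" "x \<in> X" "y \<in> X" for c x y
    using that unfolding W_def by blast
  have G_iff: "c *\<^sub>R (x - y) \<in> G \<longleftrightarrow> gt x y" if "c > 0" "x \<in> X" "y \<in> X" for c x y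
  proof
    assume "c *\<^sub>R (x - y) \<in> G"
    then obtain c' x' y' where "c *\<^sub>R (x - y) = c' *\<^sub>R (x' - y')" "c' > 0" "x' \<in> X" "y' \<in> X" "gt x' y'"
      unfolding G_def by blast
    then show "gt x y" using diff that by blast
  qed (use that in \<open>unfold G_def, blast\<close>)
  have chain: "\<exists>c x y z. c > 0 \<and> x \<in> X \<and> y \<in> X \<and> z \<in> X \<and> v = c *\<^sub>R (x - y) \<and> w = c *\<^sub>R (y - z)"
    if vw: "v \<in> W" "w \<in> W" for v w
  proof -
    obtain c1 x1 y1 where 1: "v = c1 *\<^sub>R (x1 - y1)" "c1 > 0" "x1 \<in> X" "y1 \<in> X"
      using vw(1) unfolding W_def by blast
    obtain c2 x2 y2 where 2: "w = c2 *\<^sub>R (x2 - y2)" "c2 > 0" "x2 \<in> X" "y2 \<in> X"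
      using vw(2) unfolding W_def by blast
    \<comment> \<open>With this weight the three points
      \<open>t *\<^sub>R x1 + (1 - t) *\<^sub>R x2\<close>,
      \<open>t *\<^sub>R y1 + (1 - t) *\<^sub>R x2\<close> and
      \<open>t *\<^sub>R y1 + (1 - t) *\<^sub>R y2\<close> have consecutive differences
      \<open>v\<close> and \<open>w\<close>, up to the common factor \<open>c1 + c2\<close>.\<close>
    define t where "t = c1 / (c1 + c2)"
    have t: "0 \<le> t" "t \<le> 1" "(c1 + c2) * t = c1" "(c1 + c2) * (1 - t) = c2"
      using 1 2 by (auto simp: t_def field_simps)
    have "v = (c1 + c2) *\<^sub>R ((t *\<^sub>R x1 + (1 - t) *\<^sub>R x2) - (t *\<^sub>R y1 + (1 - t) *\<^sub>R x2))"
    proof -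
      have "v = ((c1 + c2) * t) *\<^sub>R (x1 - y1)" using 1 t by simp
      then show ?thesis by (simp add: scaleR_diff_right[symmetric] del: scaleR_diff_right)
    qed
    moreover have "w = (c1 + c2) *\<^sub>R ((t *\<^sub>R y1 + (1 - t) *\<^sub>R x2) - (t *\<^sub>R y1 + (1 - t) *\<^sub>R y2))"
    proof -
      have "w = ((c1 + c2) * (1 - t)) *\<^sub>R (x2 - y2)" using 2 t by simp
      then show ?thesis by (simp add: scaleR_diff_right[symmetric] del: scaleR_diff_right)
    qed
    moreover have "c1 + c2 > 0" using 1 2 by simp
    ultimately show ?thesis using mixX[OF _ _ t(1,2)] 1 2 by blast
  qed
  have W_scale_pos: "c *\<^sub>R v \<in> W" if c: "c > 0" and v: "v \<in> W" for c v
  proof -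
    obtain k x y where "v = k *\<^sub>R (x - y)" "k > 0" "x \<in> X" "y \<in> X" using v unfolding W_def by blast
    then show ?thesis using WI[of "c * k" x y] c by simp
  qed
  have W_neg: "- v \<in> W" if v: "v \<in> W" for v
  proof -
    obtain k x y where "v = k *\<^sub>R (x - y)" "k > 0" "x \<in> X" "y \<in> X" using v unfolding W_def by blast
    then show ?thesis using WI[of k y x] by (simp add: scaleR_diff_right)
  qed
  have W: "subspace W"
  proof (rule subspaceI)
    show W0: "0 \<in> W" using WI[of 1 a a] ab by simp
    show "v + w \<in> W" if vw: "v \<in> W" "w \<in> W" for v w
    proof -
      obtain c x y z where "c > 0" "x \<in> X" "y \<in> X" "z \<in> X" "v = c *\<^sub>R (x - y)" "w = c *\<^sub>R (y - z)"
        using chain[OF vw] by blast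
      then show ?thesis using WI[of c x z] by (simp add: scaleR_right_distrib[symmetric])
    qed
    show "c *\<^sub>R v \<in> W" if "v \<in> W" for c v
    proof (cases c "0::real" rule: linorder_cases)
      case less
      then show ?thesis using W_scale_pos[of "- c" "- v"] W_neg[OF that] by simp
    qed (use W_scale_pos[of c v] that W0 in auto)
  qed
  \<comment> \<open>Along a chain \<open>x, y, z\<close>, transitivity makes \<open>G\<close> closed
    under addition, negative transitivity does the same for its complement, and continuity makes
    \<open>G\<close> open along lines.\<close>
  have sum: "(v \<in> G \<longrightarrow> w \<in> G \<longrightarrow> v + w \<in> G) \<and> (v \<notin> G \<longrightarrow> w \<notin> G \<longrightarrow> v + w \<notin> G) \<and>
      (v \<in> G \<longrightarrow> (\<exists>t>0. v + t *\<^sub>R w \<in> G))" if vw: "v \<in> W" "w \<in> W" for v w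
  proof -
    obtain c x y z where c: "c > 0" "x \<in> X" "y \<in> X" "z \<in> X" and eq: "v = c *\<^sub>R (x - y)" "w = c *\<^sub>R (y - z)"
      using chain[OF vw] by blast
    have "v + w = c *\<^sub>R (x - z)" unfolding eq by (simp add: algebra_simps)
    moreover have "\<exists>t>0. v + t *\<^sub>R w \<in> G" if xy: "gt x y"
    proof -
      obtain t where t: "t > 0" "t \<le> 1" "gt x ((1 - t) *\<^sub>R y + t *\<^sub>R z)" using cont[OF c(2,3,4) xy] by blast
      have "(1 - t) *\<^sub>R y + t *\<^sub>R z \<in> X" using mixX[of z y t] c t by (simp add: add.commute)
      moreover have "v + t *\<^sub>R w = c *\<^sub>R (x - ((1 - t) *\<^sub>R y + t *\<^sub>R z))"
        unfolding eq by (simp add: algebra_simps)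
      ultimately show ?thesis using t c G_iff by (metis (no_types, lifting))
    qed
    ultimately show ?thesis using G_iff c eq trans negtrans by (metis (no_types, lifting))
  qed
  have GW: "v \<in> W" if "v \<in> G" for v using that unfolding G_def W_def by blast
  have zero: "0 \<notin> G" using G_iff[of 1 a a] ab irrefl by simp
  have G_scale: "c *\<^sub>R v \<in> G \<longleftrightarrow> v \<in> G" if c: "c > 0" and v: "v \<in> W" for c v
  proof -
    obtain k x y where "v = k *\<^sub>R (x - y)" "k > 0" "x \<in> X" "y \<in> X" using v unfolding W_def by blast
    then show ?thesis using G_iff[of "c * k" x y] G_iff[of k x y] c by simp
  qed

  define d where "d = a - b"
  have dG: "d \<in> G" using G_iff[of 1 a b] ab by (simp add: d_def)
  note dW = GW[OF dG]
  have td: "t *\<^sub>R d \<in> G" if "t > 0" for t using G_scale dG dW that by blast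
  have vtd: "v - t *\<^sub>R d \<in> W" if "v \<in> W" for v t using W that dW by (simp add: subspace_diff subspace_scale)
  \<comment> \<open>The value of \<open>v\<close> measured in units of the fixed positive difference
    \<open>d\<close>: the threshold up to which \<open>v\<close> still exceeds
    \<open>t *\<^sub>R d\<close>.\<close>
  define L where "L v = Sup {t. v - t *\<^sub>R d \<in> G}" for v
  \<comment> \<open>Archimedean property: openness at \<open>d\<close> in the direction
    \<open>v\<close>, divided by the step size.\<close>
  have low: "\<exists>t. v - t *\<^sub>R d \<in> G" if v: "v \<in> W" for v
  proof -
    obtain t where t: "t > 0" "d + t *\<^sub>R v \<in> G" using sum[OF dW v] dG by blast
    then have "inverse t *\<^sub>R (d + t *\<^sub>R v) \<in> G" using G_scale[of "inverse t"] GW by simp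
    moreover have "inverse t *\<^sub>R (d + t *\<^sub>R v) = v - (- inverse t) *\<^sub>R d"
      using t by (simp add: scaleR_right_distrib add.commute)
    ultimately show ?thesis by metis
  qed
  have L: "v - t *\<^sub>R d \<in> G \<longleftrightarrow> t < L v" if v: "v \<in> W" for v t
  proof -
    let ?S = "{t. v - t *\<^sub>R d \<in> G}"
    obtain s where s: "- v - s *\<^sub>R d \<in> G" using low[OF W_neg[OF v]] by blast
    have down: "t' \<in> ?S" if "t \<in> ?S" "t' < t" for t t'
    proof -
      have "(v - t *\<^sub>R d) + (t - t') *\<^sub>R d \<in> G"
        using sum[of "v - t *\<^sub>R d" "(t - t') *\<^sub>R d"] td[of "t - t'"] that vtd[OF v] GW by auto
      then show ?thesis by (simp add: algebra_simps)
    qed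
    \<comment> \<open>A larger threshold would put both \<open>v + s *\<^sub>R d\<close> and its
      negative into \<open>G\<close>, and hence 0.\<close>
    have bd: "t \<le> - s" if "t \<in> ?S" for t
    proof (rule ccontr)
      assume "\<not> t \<le> - s"
      then have "- s \<in> ?S" by (intro down[OF that]) simp
      then have "(v - (- s) *\<^sub>R d) + (- v - s *\<^sub>R d) \<in> G"
        using sum[OF GW GW] s by blast
      then show False using zero by simp
    qed
    have bdd: "bdd_above ?S" using bd by (rule bdd_aboveI)
    have ne: "?S \<noteq> {}" using low[OF v] by blast
    show ?thesis
    proof
      assume t: "v - t *\<^sub>R d \<in> G"
      then obtain e where "e > 0" "(v - t *\<^sub>R d) + e *\<^sub>R (- d) \<in> G"
        using sum[OF vtd[OF v] W_neg[OF dW]] by blast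
      then have "t + e \<in> ?S" by (simp add: algebra_simps)
      then have "t + e \<le> L v" unfolding L_def using bdd by (rule cSup_upper)
      then show "t < L v" using \<open>e > 0\<close> by simp
    next
      assume "t < L v"
      then obtain t' where "t' \<in> ?S" "t < t'" unfolding L_def using less_cSup_iff[OF ne bdd] by blast
      then show "v - t *\<^sub>R d \<in> G" using down by blast
    qed
  qed
  \<comment> \<open>Closure of \<open>G\<close> under addition gives superadditivity, closure of its
    complement subadditivity. Half of a supposed deficit, \<open>h\<close>, is taken from each
    summand to stay strictly below both thresholds.\<close>
  have L_add: "L (v + w) = L v + L w" if v: "v \<in> W" and w: "w \<in> W" for v w
  proof -
    have vw: "v + w \<in> W" using W v w by (rule subspace_add)
    have split: "(v - t *\<^sub>R d) + (w - s *\<^sub>R d) = (v + w) - (t + s) *\<^sub>R d" for t s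
      by (simp add: algebra_simps)
    have le: "t + s < L (v + w)" if "t < L v" "s < L w" for t s
      using sum[OF vtd[OF v] vtd[OF w], of t s] that L[OF v] L[OF w] L[OF vw] unfolding split by blast
    have ge: "L (v + w) \<le> t + s" if "L v \<le> t" "L w \<le> s" for t s
      using sum[OF vtd[OF v] vtd[OF w], of t s] that L[OF v] L[OF w] L[OF vw] unfolding split
      by (meson not_less)
    have "\<not> L (v + w) < L v + L w"
    proof
      assume less: "L (v + w) < L v + L w"
      define h where "h = (L v + L w - L (v + w)) / 2"
      have "(L v - h) + (L w - h) < L (v + w)" using less by (intro le) (auto simp: h_def)
      then show False by (simp add: h_def field_simps)
    qed
    then show ?thesis using ge[of "L v" "L w"] by simp
  qed
  have L_scale: "L (c *\<^sub>R v) = c * L v" if c: "c > 0" and v: "v \<in> W" for c v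
  proof -
    have "t < L (c *\<^sub>R v) \<longleftrightarrow> t < c * L v" for t
    proof -
      have "c *\<^sub>R v - t *\<^sub>R d = c *\<^sub>R (v - (t / c) *\<^sub>R d)" using c by (simp add: scaleR_diff_right)
      then have "t < L (c *\<^sub>R v) \<longleftrightarrow> t / c < L v"
        using L[OF W_scale_pos[OF c v]] G_scale[OF c vtd[OF v]] L[OF v] by metis
      then show ?thesis using c by (simp add: field_simps)
    qed
    then show ?thesis by (meson less_irrefl not_less_iff_gr_or_eq)
  qed
  have XW: "x - y \<in> W" if "x \<in> X" "y \<in> X" for x y using WI[of 1 x y] that by simp
  show ?thesis
  proof (rule that[of "\<lambda>x. L (x - b)"])
    show "affine_on X (\<lambda>x. L (x - b))"
      unfolding affine_on_def
    proof (intro ballI)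
      fix x y and t :: real assume x: "x \<in> X" and y: "y \<in> X" and t: "t \<in> {0..1}"
      show "L (t *\<^sub>R x + (1 - t) *\<^sub>R y - b) = t * L (x - b) + (1 - t) * L (y - b)"
      proof (cases "t = 0 \<or> t = 1")
        case False
        have "t *\<^sub>R x + (1 - t) *\<^sub>R y - b = t *\<^sub>R (x - b) + (1 - t) *\<^sub>R (y - b)"
          by (simp add: algebra_simps)
        then show ?thesis
          using L_add L_scale W_scale_pos XW[OF x ab(2)] XW[OF y ab(2)] t False by simp
      qed auto
    qed
    fix x y assume x: "x \<in> X" and y: "y \<in> X"
    have "L (x - b) = L (x - y) + L (y - b)"
      using L_add[OF XW[OF x y] XW[OF y ab(2)]] by simp
    then show "gt x y \<longleftrightarrow> L (y - b) < L (x - b)"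
      using G_iff[of 1 x y] L[OF XW[OF x y], of 0] x y by simp
  qed
qed

section \<open>Intermediate values and uniqueness of affine utilities\<close>

lemma affine_onD:
  "affine_on X u \<Longrightarrow> x \<in> X \<Longrightarrow> y \<in> X \<Longrightarrow> 0 \<le> t \<Longrightarrow> t \<le> 1 \<Longrightarrow>
    u (t *\<^sub>R x + (1 - t) *\<^sub>R y) = t * u x + (1 - t) * u y"
  by (simp add: affine_on_def)

lemma affine_on_ivt:
  assumes "affine_on X u" "convex X" "x \<in> X" "y \<in> X" "u x \<le> r" "r \<le> u y"
  obtains z where "z \<in> X" "u z = r"
proof (cases "u x = u y")
  case False
  define t where "t = (r - u x) / (u y - u x)"
  have t: "0 \<le> t" "t \<le> 1" "t * (u y - u x) = r - u x" using assms(5,6) False by (auto simp: t_def field_simps)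
  have "u (t *\<^sub>R y + (1 - t) *\<^sub>R x) = r"
    unfolding affine_onD[OF assms(1,4,3) t(1,2)] using t(3) by (simp add: algebra_simps)
  moreover have "t *\<^sub>R y + (1 - t) *\<^sub>R x \<in> X"
    using convexD[OF assms(2,4,3), of t "1 - t"] t by simp
  ultimately show ?thesis using that by blast
qed (use that assms in force)

text \<open>Ratios of utility differences are ordinal: a point between two others has the same
  utility as a mixture of them, and by \<open>eq\<close> the same weight must serve
  \<open>u'\<close>.\<close>

lemma affine_on_ordinally_unique:
  assumes u: "affine_on X u" and u': "affine_on X u'" and X: "convex X"
    and ne: "x0 \<in> X" "y0 \<in> X" "u x0 \<noteq> u y0"
    and ord: "\<And>x y. x \<in> X \<Longrightarrow> y \<in> X \<Longrightarrow> u x > u y \<longleftrightarrow> u' x > u' y"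
  obtains a b where "a > 0" "\<And>x. x \<in> X \<Longrightarrow> u' x = a * u x + b"
proof -
  have eq: "u' x = u' y" if "x \<in> X" "y \<in> X" "u x = u y" for x y
    using ord[of x y] ord[of y x] that by simp
  \<comment> \<open>Cross-multiplied, so that the degenerate case \<open>u x = u z\<close> is
    included.\<close>
  have lin: "(u z - u x) * u' y = (u z - u y) * u' x + (u y - u x) * u' z"
    if m: "x \<in> X" "y \<in> X" "z \<in> X" and le: "u x \<le> u y" "u y \<le> u z" for x y z
  proof (cases "u x = u z")
    case False
    define t where "t = (u y - u x) / (u z - u x)"
    have t: "0 \<le> t" "t \<le> 1" "t * (u z - u x) = u y - u x" using le False by (auto simp: t_def field_simps)
    have w: "t *\<^sub>R z + (1 - t) *\<^sub>R x \<in> X" using convexD[OF X m(3,1), of t "1 - t"] t by simp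
    have "u (t *\<^sub>R z + (1 - t) *\<^sub>R x) = u y"
      unfolding affine_onD[OF u m(3,1) t(1,2)] using t(3) by (simp add: algebra_simps)
    then have "u' y = u' (t *\<^sub>R z + (1 - t) *\<^sub>R x)" using eq[OF w m(2)] by simp
    also have "\<dots> = t * u' z + (1 - t) * u' x" by (rule affine_onD[OF u' m(3,1) t(1,2)])
    finally have u'y: "u' y = t * u' z + (1 - t) * u' x" .
    have "(u z - u x) * u' y = (t * (u z - u x)) * u' z + ((u z - u x) - t * (u z - u x)) * u' x"
      unfolding u'y by (simp add: algebra_simps)
    then show ?thesis unfolding t(3) by (simp add: algebra_simps)
  qed (use le in simp)
  obtain p q where pq: "p \<in> X" "q \<in> X" "u q < u p" using ne by (metis linorder_neqE)
  define a where "a = (u' p - u' q) / (u p - u q)"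
  have "a > 0" using ord[OF pq(1,2)] pq(3) by (simp add: a_def)
  moreover have "u' x = a * u x + (u' q - a * u q)" if x: "x \<in> X" for x
  proof -
    have "(u p - u q) * u' x = (u p - u x) * u' q + (u x - u q) * u' p"
    proof -
      \<comment> \<open>Whichever of the three points lies in the middle, \<open>lin\<close>
        rearranges to the same identity.\<close>
      consider "u x \<le> u q" | "u q \<le> u x" "u x \<le> u p" | "u p \<le> u x" by linarith
      then show ?thesis
      proof cases
        case 1
        then show ?thesis using lin[OF x pq(2,1)] pq(3) by (simp add: algebra_simps)
      next
        case 2
        then show ?thesis using lin[OF pq(2) x pq(1)] by (simp add: algebra_simps)
      next
        case 3
        then show ?thesis using lin[OF pq(2,1) x] pq(3) by (simp add: algebra_simps)
      qed
    qed
    also have "\<dots> = (u' p - u' q) * (u x - u q) + (u p - u q) * u' q" by (simp add: algebra_simps)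
    also have "u' p - u' q = a * (u p - u q)" using pq(3) by (simp add: a_def)
    also have "a * (u p - u q) * (u x - u q) + (u p - u q) * u' q
        = (u p - u q) * (a * u x + (u' q - a * u q))" by (simp add: algebra_simps)
    finally show ?thesis using pq(3) by simp
  qed
  ultimately show ?thesis by (rule that)
qed

section \<open>Necessity of the axioms\<close>

lemma axioms_A1_A7D:
  assumes "axioms_A1_A7 \<Sigma> X P"
  shows "f \<in> acts \<Sigma> X \<Longrightarrow> g \<in> acts \<Sigma> X \<Longrightarrow> P f g \<Longrightarrow> \<not> P g f"
    "f \<in> acts \<Sigma> X \<Longrightarrow> g \<in> acts \<Sigma> X \<Longrightarrow> h \<in> acts \<Sigma> X \<Longrightarrow> P f g \<Longrightarrow> P g h \<Longrightarrow> P f h"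
    "\<exists>x\<in>X. \<exists>y\<in>X. P (cact x) (cact y)"
    "x \<in> X \<Longrightarrow> y \<in> X \<Longrightarrow> z \<in> X \<Longrightarrow> \<not> P (cact x) (cact y) \<Longrightarrow> \<not> P (cact y) (cact z) \<Longrightarrow>
      \<not> P (cact x) (cact z)"
    "f \<in> acts \<Sigma> X \<Longrightarrow> g \<in> acts \<Sigma> X \<Longrightarrow> h \<in> acts \<Sigma> X \<Longrightarrow>
      openin (top_of_set {0..1}) {a\<in>{0..1::real}. P (mix a f g) h}"
    "f \<in> acts \<Sigma> X \<Longrightarrow> g \<in> acts \<Sigma> X \<Longrightarrow> h \<in> acts \<Sigma> X \<Longrightarrow>
      openin (top_of_set {0..1}) {a\<in>{0..1::real}. P h (mix a f g)}"
    "f \<in> acts \<Sigma> X \<Longrightarrow> g \<in> acts \<Sigma> X \<Longrightarrow> x \<in> X \<Longrightarrow> 0 < a \<Longrightarrow> a < 1 \<Longrightarrow>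
      P f g \<longleftrightarrow> P (mix a f (cact x)) (mix a g (cact x))"
    "x \<in> X \<Longrightarrow> f \<in> acts \<Sigma> X \<Longrightarrow> g \<in> acts \<Sigma> X \<Longrightarrow> 0 \<le> a \<Longrightarrow> a \<le> 1 \<Longrightarrow>
      P f (cact x) \<Longrightarrow> P g (cact x) \<Longrightarrow> P (mix a f g) (cact x)"
    "x \<in> X \<Longrightarrow> f \<in> acts \<Sigma> X \<Longrightarrow> g \<in> acts \<Sigma> X \<Longrightarrow> 0 \<le> a \<Longrightarrow> a \<le> 1 \<Longrightarrow>
      P (cact x) f \<Longrightarrow> P (cact x) g \<Longrightarrow> P (cact x) (mix a f g)"
    "f \<in> acts \<Sigma> X \<Longrightarrow> g \<in> acts \<Sigma> X \<Longrightarrow> (\<And>s. P (cact (f s)) (cact (g s))) \<Longrightarrow> P f g"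
    "f \<in> acts \<Sigma> X \<Longrightarrow> g \<in> acts \<Sigma> X \<Longrightarrow> (\<And>x. x \<in> X \<Longrightarrow> incomp P f (cact x) \<Longrightarrow> incomp P g (cact x)) \<Longrightarrow>
      incomp P f g"
    "f \<in> acts \<Sigma> X \<Longrightarrow> g \<in> acts \<Sigma> X \<Longrightarrow> x \<in> X \<Longrightarrow> y \<in> X \<Longrightarrow>
      incomp P f (cact x) \<Longrightarrow> P (cact x) g \<Longrightarrow> incomp P g (cact y) \<Longrightarrow> P f (cact y) \<Longrightarrow> P f g"
proof -
  note ax = assms[unfolded axioms_A1_A7_def]
  show "f \<in> acts \<Sigma> X \<Longrightarrow> g \<in> acts \<Sigma> X \<Longrightarrow> P f g \<Longrightarrow> \<not> P g f"
    using conjunct1[OF ax] by blast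
  note ax = conjunct2[OF ax]
  show "f \<in> acts \<Sigma> X \<Longrightarrow> g \<in> acts \<Sigma> X \<Longrightarrow> h \<in> acts \<Sigma> X \<Longrightarrow> P f g \<Longrightarrow> P g h \<Longrightarrow> P f h"
    using conjunct1[OF ax] by blast
  note ax = conjunct2[OF ax]
  show "\<exists>x\<in>X. \<exists>y\<in>X. P (cact x) (cact y)"
    by (rule conjunct1[OF ax])
  note ax = conjunct2[OF ax]
  show "x \<in> X \<Longrightarrow> y \<in> X \<Longrightarrow> z \<in> X \<Longrightarrow> \<not> P (cact x) (cact y) \<Longrightarrow> \<not> P (cact y) (cact z) \<Longrightarrow>
      \<not> P (cact x) (cact z)"
    using conjunct1[OF ax] by blast
  note ax = conjunct2[OF ax]
  show "f \<in> acts \<Sigma> X \<Longrightarrow> g \<in> acts \<Sigma> X \<Longrightarrow> h \<in> acts \<Sigma> X \<Longrightarrow>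
      openin (top_of_set {0..1}) {a\<in>{0..1::real}. P (mix a f g) h}"
    "f \<in> acts \<Sigma> X \<Longrightarrow> g \<in> acts \<Sigma> X \<Longrightarrow> h \<in> acts \<Sigma> X \<Longrightarrow>
      openin (top_of_set {0..1}) {a\<in>{0..1::real}. P h (mix a f g)}"
    using conjunct1[OF ax] by blast+
  note ax = conjunct2[OF ax]
  show "f \<in> acts \<Sigma> X \<Longrightarrow> g \<in> acts \<Sigma> X \<Longrightarrow> x \<in> X \<Longrightarrow> 0 < a \<Longrightarrow> a < 1 \<Longrightarrow>
      P f g \<longleftrightarrow> P (mix a f (cact x)) (mix a g (cact x))"
    using conjunct1[OF ax] greaterThanLessThan_iff by blast
  note ax = conjunct2[OF ax]
  show "x \<in> X \<Longrightarrow> f \<in> acts \<Sigma> X \<Longrightarrow> g \<in> acts \<Sigma> X \<Longrightarrow> 0 \<le> a \<Longrightarrow> a \<le> 1 \<Longrightarrow>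
      P f (cact x) \<Longrightarrow> P g (cact x) \<Longrightarrow> P (mix a f g) (cact x)"
    "x \<in> X \<Longrightarrow> f \<in> acts \<Sigma> X \<Longrightarrow> g \<in> acts \<Sigma> X \<Longrightarrow> 0 \<le> a \<Longrightarrow> a \<le> 1 \<Longrightarrow>
      P (cact x) f \<Longrightarrow> P (cact x) g \<Longrightarrow> P (cact x) (mix a f g)"
    using conjunct1[OF ax] atLeastAtMost_iff by blast+
  note ax = conjunct2[OF ax]
  show "f \<in> acts \<Sigma> X \<Longrightarrow> g \<in> acts \<Sigma> X \<Longrightarrow> (\<And>s. P (cact (f s)) (cact (g s))) \<Longrightarrow> P f g"
    using conjunct1[OF ax] by blast
  note ax = conjunct2[OF ax]
  show "f \<in> acts \<Sigma> X \<Longrightarrow> g \<in> acts \<Sigma> X \<Longrightarrow> (\<And>x. x \<in> X \<Longrightarrow> incomp P f (cact x) \<Longrightarrow> incomp P g (cact x)) \<Longrightarrow>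
      incomp P f g"
    using conjunct1[OF ax] by blast
  note ax = conjunct2[OF ax]
  show "f \<in> acts \<Sigma> X \<Longrightarrow> g \<in> acts \<Sigma> X \<Longrightarrow> x \<in> X \<Longrightarrow> y \<in> X \<Longrightarrow>
      incomp P f (cact x) \<Longrightarrow> P (cact x) g \<Longrightarrow> incomp P g (cact y) \<Longrightarrow> P f (cact y) \<Longrightarrow> P f g"
    using ax by blast
qed

text \<open>A2 and A4 contain both directions of the preference, and A7 is carried to itself by
  exchanging \<open>f\<close> with \<open>g\<close> and \<open>x\<close> with \<open>y\<close>.
  Results on the lower functional thereby also cover the upper one.\<close>

lemma axioms_A1_A7_dual:
  assumes "axioms_A1_A7 \<Sigma> X P"
  shows "axioms_A1_A7 \<Sigma> X (\<lambda>f g. P g f)"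
proof -
  note ax = axioms_A1_A7D[OF assms]
  have incomp_eq: "incomp (\<lambda>f g. P g f) = incomp P"
    by (auto simp: incomp_def fun_eq_iff)
  show ?thesis
    unfolding axioms_A1_A7_def incomp_eq
  proof (intro conjI)
    show "\<exists>x\<in>X. \<exists>y\<in>X. P (cact y) (cact x)" using ax(3) by blast
    show "\<forall>f\<in>acts \<Sigma> X. \<forall>g\<in>acts \<Sigma> X. P g f \<longrightarrow> \<not> P f g" using ax(1) by blast
    show "\<forall>f\<in>acts \<Sigma> X. \<forall>g\<in>acts \<Sigma> X. \<forall>h\<in>acts \<Sigma> X. P g f \<and> P h g \<longrightarrow> P h f" using ax(2) by blast
    show "\<forall>x\<in>X. \<forall>y\<in>X. \<forall>z\<in>X. \<not> P (cact y) (cact x) \<and> \<not> P (cact z) (cact y) \<longrightarrow> \<not> P (cact z) (cact x)"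
      using ax(4) by blast
    show "\<forall>f\<in>acts \<Sigma> X. \<forall>g\<in>acts \<Sigma> X. \<forall>h\<in>acts \<Sigma> X.
       openin (top_of_set {0..1}) {a\<in>{0..1::real}. P h (mix a f g)} \<and>
       openin (top_of_set {0..1}) {a\<in>{0..1::real}. P (mix a f g) h}" using ax(5,6) by blast
    show "\<forall>f\<in>acts \<Sigma> X. \<forall>g\<in>acts \<Sigma> X. \<forall>x\<in>X. \<forall>a\<in>{0<..<1}.
       P g f \<longleftrightarrow> P (mix a g (cact x)) (mix a f (cact x))" using ax(7) by auto
    show "\<forall>x\<in>X. \<forall>f\<in>acts \<Sigma> X. \<forall>g\<in>acts \<Sigma> X. \<forall>a\<in>{0..1}.
       (P (cact x) f \<and> P (cact x) g \<longrightarrow> P (cact x) (mix a f g)) \<and>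
       (P f (cact x) \<and> P g (cact x) \<longrightarrow> P (mix a f g) (cact x))" using ax(8,9) by auto
    show "\<forall>f\<in>acts \<Sigma> X. \<forall>g\<in>acts \<Sigma> X. (\<forall>s. P (cact (g s)) (cact (f s))) \<longrightarrow> P g f" using ax(10) by blast
    show "\<forall>f\<in>acts \<Sigma> X. \<forall>g\<in>acts \<Sigma> X.
       (\<forall>x\<in>X. incomp P f (cact x) \<longrightarrow> incomp P g (cact x)) \<longrightarrow> incomp P f g" using ax(11) by blast
    show "\<forall>f\<in>acts \<Sigma> X. \<forall>g\<in>acts \<Sigma> X. \<forall>x\<in>X. \<forall>y\<in>X.
       incomp P f (cact x) \<and> P g (cact x) \<and> incomp P g (cact y) \<and> P (cact y) f \<longrightarrow> P g f"
      using ax(12) by blast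
  qed
qed

lemma cact_in_acts: "algebra UNIV \<Sigma> \<Longrightarrow> x \<in> X \<Longrightarrow> cact x \<in> acts \<Sigma> X"
  by (simp add: acts_iff_finmeas cact_def finmeas_const)

lemma mix_in_acts:
  assumes "algebra UNIV \<Sigma>" "convex X" "f \<in> acts \<Sigma> X" "g \<in> acts \<Sigma> X" "0 \<le> a" "a \<le> 1"
  shows "mix a f g \<in> acts \<Sigma> X"
  unfolding acts_iff_finmeas mix_def
  using assms(3-) convexD[OF assms(2), of _ _ a "1 - a"]
    finmeas_comp2[OF assms(1), of f g "\<lambda>x y. a *\<^sub>R x + (1 - a) *\<^sub>R y"]
  by (simp add: acts_iff_finmeas)

lemma comp_in_simple_space:
  "algebra UNIV \<Sigma> \<Longrightarrow> f \<in> acts \<Sigma> X \<Longrightarrow> u \<circ> f \<in> simple_space \<Sigma>"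
  by (simp add: acts_iff_finmeas mem_simple_space comp_def finmeas_comp)

lemma affine_comp_mix:
  assumes "affine_on X u" "f \<in> acts \<Sigma> X" "g \<in> acts \<Sigma> X" "0 \<le> a" "a \<le> 1"
  shows "u \<circ> mix a f g = a *\<^sub>R (u \<circ> f) + (1 - a) *\<^sub>R (u \<circ> g)"
  using assms by (auto simp: fun_eq_iff mix_def acts_def affine_on_def)

lemma comp_cact: "u \<circ> cact x = (\<lambda>_. u x)"
  by (simp add: fun_eq_iff cact_def)

text \<open>Monotonicity after translation, that is, nonexpansiveness in the supremum norm; it
  underlies strict monotonicity and continuity in mixture weights.\<close>

lemma lower_prev_le_add:
  assumes alg: "algebra UNIV \<Sigma>" and K: "lower_prev \<Sigma> K" and \<phi>: "\<phi> \<in> simple_space \<Sigma>"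
    and \<psi>: "\<psi> \<in> simple_space \<Sigma>" and le: "\<And>s. \<phi> s \<le> \<psi> s + c"
  shows "K \<phi> \<le> K \<psi> + c"
proof -
  have "\<psi> + (\<lambda>_. c) \<in> simple_space \<Sigma>"
    using subspace_add[OF subspace_simple_space[OF alg] \<psi> simple_space_const[OF alg]] .
  then have "K \<phi> \<le> K (\<psi> + (\<lambda>_. c))" using le by (intro lower_prevD(3)[OF K \<phi>]) auto
  then show ?thesis using lower_prev_add_const[OF alg K \<psi>] by simp
qed

text \<open>Finitely many values turn pointwise strictness into a uniform gap \<open>e\<close>, and
  translation carries the gap over to \<open>K\<close>.\<close>

lemma lower_prev_strict_mono:
  assumes alg: "algebra UNIV \<Sigma>" and K: "lower_prev \<Sigma> K" and \<phi>: "\<phi> \<in> simple_space \<Sigma>"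
    and \<psi>: "\<psi> \<in> simple_space \<Sigma>" and less: "\<And>s. \<phi> s < \<psi> s"
  shows "K \<phi> < K \<psi>"
proof -
  have fin: "finite (range (\<lambda>s. \<psi> s - \<phi> s))"
    using finmeas_comp2[OF alg, of \<psi> \<phi> "(-)"] \<phi> \<psi> by (simp add: mem_simple_space finmeas_def)
  define e where "e = Min (range (\<lambda>s. \<psi> s - \<phi> s))"
  have "e > 0" using fin less by (simp add: e_def)
  have "e \<le> \<psi> s - \<phi> s" for s using fin by (simp add: e_def)
  then have "\<phi> s \<le> \<psi> s + (- e)" for s by (simp add: algebra_simps)
  then have "K \<phi> \<le> K \<psi> + (- e)" by (rule lower_prev_le_add[OF alg K \<phi> \<psi>])
  then show ?thesis using \<open>e > 0\<close> by simp
qed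

lemma lower_prev_mix_cact:
  assumes alg: "algebra UNIV \<Sigma>" and K: "lower_prev \<Sigma> K" and u: "affine_on X u"
    and f: "f \<in> acts \<Sigma> X" and x: "x \<in> X" and a: "0 < a" "a \<le> 1"
  shows "K (u \<circ> mix a f (cact x)) = a * K (u \<circ> f) + (1 - a) * u x"
proof -
  note uf = comp_in_simple_space[OF alg f, of u]
  have "u \<circ> mix a f (cact x) = a *\<^sub>R (u \<circ> f) + (\<lambda>_. (1 - a) * u x)"
    using affine_comp_mix[OF u f cact_in_acts[OF alg x]] a by (auto simp: cact_def fun_eq_iff)
  then show ?thesis
    using lower_prev_add_const[OF alg K subspace_scale[OF subspace_simple_space[OF alg] uf]]
      lower_prevD(2)[OF K uf a(1)] by metis
qed

lemma lower_prev_mix: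
  assumes alg: "algebra UNIV \<Sigma>" and K: "lower_prev \<Sigma> K" and u: "affine_on X u"
    and f: "f \<in> acts \<Sigma> X" and g: "g \<in> acts \<Sigma> X" and a: "0 \<le> a" "a \<le> 1"
  shows "a * K (u \<circ> f) + (1 - a) * K (u \<circ> g) \<le> K (u \<circ> mix a f g)"
proof -
  note uf = comp_in_simple_space[OF alg f, of u] and ug = comp_in_simple_space[OF alg g, of u]
  note sc = subspace_scale[OF subspace_simple_space[OF alg]]
  have hom: "K (c *\<^sub>R \<phi>) = c * K \<phi>" if "c \<ge> 0" "\<phi> \<in> simple_space \<Sigma>" for c \<phi>
  proof (cases "c = 0")
    case True
    then show ?thesis by (simp add: lower_prev_zero[OF K])
  qed (use that lower_prevD(2)[OF K] in simp)
  show ?thesis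
    using lower_prevD(1)[OF K sc[OF uf, of a] sc[OF ug, of "1 - a"]] hom[OF a(1) uf] hom[OF _ ug, of "1 - a"] a
    unfolding affine_comp_mix[OF u f g a] by simp
qed

lemma continuous_on_lower_prev_mix:
  assumes alg: "algebra UNIV \<Sigma>" and X: "convex X" and K: "lower_prev \<Sigma> K" and u: "affine_on X u"
    and f: "f \<in> acts \<Sigma> X" and g: "g \<in> acts \<Sigma> X"
  shows "continuous_on {0..1} (\<lambda>a. K (u \<circ> mix a f g))"
proof -
  obtain B where B: "B > 0" "\<And>s. \<bar>u (f s) - u (g s)\<bar> < B"
    using finmeas_bounded[OF finmeas_comp2[OF alg, of f g "\<lambda>x y. u x - u y"]] f g
    by (auto simp: acts_iff_finmeas)
  have le: "K (u \<circ> mix a f g) \<le> K (u \<circ> mix b f g) + B * \<bar>a - b\<bar>" if "a \<in> {0..1}" "b \<in> {0..1}" for a b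
  proof (rule lower_prev_le_add[OF alg K])
    fix s
    have "(u \<circ> mix a f g) s = (u \<circ> mix b f g) s + (a - b) * (u (f s) - u (g s))"
      using that affine_comp_mix[OF u f g, of a] affine_comp_mix[OF u f g, of b]
      by (simp add: fun_eq_iff algebra_simps)
    also have "(a - b) * (u (f s) - u (g s)) \<le> \<bar>a - b\<bar> * \<bar>u (f s) - u (g s)\<bar>"
      by (metis abs_ge_self abs_mult)
    also have "\<dots> \<le> \<bar>a - b\<bar> * B" using B(2)[of s] by (intro mult_left_mono) auto
    finally show "(u \<circ> mix a f g) s \<le> (u \<circ> mix b f g) s + B * \<bar>a - b\<bar>" by (simp add: mult.commute)
  qed (use comp_in_simple_space[OF alg mix_in_acts[OF alg X f g]] that in auto)
  have "B-lipschitz_on {0..1} (\<lambda>a. K (u \<circ> mix a f g))"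
  proof (rule lipschitz_onI)
    fix a b :: real assume "a \<in> {0..1}" "b \<in> {0..1}"
    then show "dist (K (u \<circ> mix a f g)) (K (u \<circ> mix b f g)) \<le> B * dist a b"
      using le[of a b] le[of b a] by (simp add: dist_real_def abs_minus_commute)
  qed (use B in simp)
  then show ?thesis by (rule lipschitz_on_continuous_on)
qed

text \<open>The value lies between the least and the greatest utility attained by \<open>f\<close>,
  and an affine function on a convex set attains everything in between.\<close>

lemma lower_prev_certainty_equivalent:
  assumes alg: "algebra UNIV \<Sigma>" and X: "convex X" and K: "lower_prev \<Sigma> K" and u: "affine_on X u"
    and f: "f \<in> acts \<Sigma> X"
  obtains x where "x \<in> X" "u x = K (u \<circ> f)"
proof -
  have fin: "finite (range (u \<circ> f))"
    using finite_imageI[of "range f" u] f by (simp add: acts_def image_image comp_def)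
  then have "Min (range (u \<circ> f)) \<in> range (u \<circ> f)" "Max (range (u \<circ> f)) \<in> range (u \<circ> f)"
    by (auto intro!: Min_in Max_in simp del: o_apply)
  then obtain s t where s: "(u \<circ> f) s = Min (range (u \<circ> f))" and t: "(u \<circ> f) t = Max (range (u \<circ> f))"
    by (metis imageE)
  have bd: "u (f s) \<le> (u \<circ> f) r" "(u \<circ> f) r \<le> u (f t)" for r
    using Min_le[OF fin, of "(u \<circ> f) r"] Max_ge[OF fin, of "(u \<circ> f) r"] s t by auto
  note uf = comp_in_simple_space[OF alg f, of u] and c = simple_space_const[OF alg]
  have "K (\<lambda>_. u (f s)) \<le> K (u \<circ> f)" by (rule lower_prevD(3)[OF K c uf bd(1)])
  moreover have "K (u \<circ> f) \<le> K (\<lambda>_. u (f t))" by (rule lower_prevD(3)[OF K uf c bd(2)])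
  ultimately show ?thesis
    using affine_on_ivt[OF u X, of "f s" "f t" "K (u \<circ> f)"] f that
    unfolding lower_prevD(4)[OF K] by (auto simp: acts_def)
qed

text \<open>The maxmax functional is encoded by the conjugate lower prevision \<open>M\<close>: the maximum of the
  integral of \<open>\<phi>\<close> over \<open>D\<close> is \<open>- M (- \<phi>)\<close>. Reversing the preference then just exchanges \<open>K\<close> and \<open>M\<close>
  and negates \<open>u\<close>.\<close>

definition prev_rep :: "'s set set \<Rightarrow> 'x::real_vector set \<Rightarrow> (('s \<Rightarrow> 'x) \<Rightarrow> ('s \<Rightarrow> 'x) \<Rightarrow> bool) \<Rightarrow>
    ('x \<Rightarrow> real) \<Rightarrow> (('s \<Rightarrow> real) \<Rightarrow> real) \<Rightarrow> (('s \<Rightarrow> real) \<Rightarrow> real) \<Rightarrow> bool" where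
  "prev_rep \<Sigma> X P u K M \<longleftrightarrow>
     affine_on X u \<and> (\<exists>x\<in>X. \<exists>y\<in>X. u x \<noteq> u y) \<and> lower_prev \<Sigma> K \<and> lower_prev \<Sigma> M \<and>
     (\<forall>\<phi>\<in>simple_space \<Sigma>. K \<phi> \<le> - M (- \<phi>)) \<and>
     (\<forall>f\<in>acts \<Sigma> X. \<forall>g\<in>acts \<Sigma> X. P f g \<longleftrightarrow> K (u \<circ> f) > K (u \<circ> g) \<and> M (- (u \<circ> f)) < M (- (u \<circ> g)))"

text \<open>Against a constant the two conditions are nested, because \<open>K\<close> is at most
  the conjugate of \<open>M\<close> and both reproduce constants. The more demanding one decides,
  which separates \<open>K\<close> from \<open>M\<close>.\<close>

lemma prev_rep_const:
  fixes \<Sigma> :: "'s set set"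
  assumes "algebra UNIV \<Sigma>" "prev_rep \<Sigma> X P u K M" "f \<in> acts \<Sigma> X" "x \<in> X"
  shows "P f (cact x) \<longleftrightarrow> K (u \<circ> f) > u x" "P (cact x) f \<longleftrightarrow> u x > - M (- (u \<circ> f))"
proof -
  have K: "lower_prev \<Sigma> K" and M: "lower_prev \<Sigma> M" and le: "K (u \<circ> f) \<le> - M (- (u \<circ> f))"
    and P: "P f (cact x) \<longleftrightarrow> K (u \<circ> f) > K (u \<circ> cact x) \<and> M (- (u \<circ> f)) < M (- (u \<circ> cact x))"
      "P (cact x) f \<longleftrightarrow> K (u \<circ> cact x) > K (u \<circ> f) \<and> M (- (u \<circ> cact x)) < M (- (u \<circ> f))"
    using assms(2) comp_in_simple_space[OF assms(1,3), of u] cact_in_acts[OF assms(1,4)] assms(3)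
    unfolding prev_rep_def by blast+
  have "- (u \<circ> cact x) = (\<lambda>_::'s. - u x)" by (simp add: cact_def fun_eq_iff)
  then have "M (- (u \<circ> cact x)) = - u x" by (simp only: lower_prevD(4)[OF M])
  moreover have "K (u \<circ> cact x) = u x" using lower_prevD(4)[OF K] by (simp add: comp_cact)
  ultimately show "P f (cact x) \<longleftrightarrow> K (u \<circ> f) > u x" "P (cact x) f \<longleftrightarrow> u x > - M (- (u \<circ> f))"
    using P le by auto
qed

lemma prev_rep_imp_axioms:
  assumes alg: "algebra UNIV \<Sigma>" and X: "convex X" and rep: "prev_rep \<Sigma> X P u K M"
  shows "axioms_A1_A7 \<Sigma> X P"
proof -
  \<comment> \<open>With \<open>v\<close> the upper functional \<open>J\<close> is a negated lower
    prevision of an affine profile, so every lemma about \<open>K\<close> and \<open>u\<close> also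
    applies to \<open>M\<close> and \<open>v\<close>.\<close>
  define v where "v x = - u x" for x
  define I where "I f = K (u \<circ> f)" for f
  define J where "J f = - M (v \<circ> f)" for f
  have vneg: "- (u \<circ> f) = v \<circ> f" for f by (simp add: fun_eq_iff v_def)
  have u: "affine_on X u" and K: "lower_prev \<Sigma> K" and M: "lower_prev \<Sigma> M"
    using rep by (auto simp: prev_rep_def)
  have v: "affine_on X v" using u by (simp add: affine_on_def v_def)
  have P: "P f g \<longleftrightarrow> I f > I g \<and> J f > J g" if "f \<in> acts \<Sigma> X" "g \<in> acts \<Sigma> X" for f g
    using rep that by (simp add: prev_rep_def I_def J_def vneg)
  have IJ: "I f \<le> J f" if "f \<in> acts \<Sigma> X" for f
    using rep comp_in_simple_space[OF alg that, of u] by (simp add: prev_rep_def I_def J_def vneg[symmetric])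
  have Pc: "P f (cact x) \<longleftrightarrow> I f > u x" "P (cact x) f \<longleftrightarrow> u x > J f" if "f \<in> acts \<Sigma> X" "x \<in> X" for f x
    using prev_rep_const[OF alg rep that] by (simp_all add: I_def J_def vneg)
  have inc: "incomp P f (cact x) \<longleftrightarrow> I f \<le> u x \<and> u x \<le> J f" if "f \<in> acts \<Sigma> X" "x \<in> X" for f x
    using Pc[OF that] by (auto simp: incomp_def)
  have Pxy: "P (cact x) (cact y) \<longleftrightarrow> u x > u y" if "x \<in> X" "y \<in> X" for x y
    using Pc(1)[OF cact_in_acts[OF alg that(1)] that(2)] lower_prevD(4)[OF K] by (simp add: I_def comp_cact)
  have contI: "continuous_on {0..1} (\<lambda>a. I (mix a f g))"
    and contJ: "continuous_on {0..1} (\<lambda>a. J (mix a f g))" if "f \<in> acts \<Sigma> X" "g \<in> acts \<Sigma> X" for f g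
    using continuous_on_lower_prev_mix[OF alg X K u that] continuous_on_lower_prev_mix[OF alg X M v that]
    unfolding I_def J_def by (auto intro: continuous_on_minus)
  note mixA = mix_in_acts[OF alg X]
  show ?thesis
    unfolding axioms_A1_A7_def
  proof (intro conjI ballI allI impI)
    obtain x y where "x \<in> X" "y \<in> X" "u x \<noteq> u y" using rep unfolding prev_rep_def by blast
    then show "\<exists>x\<in>X. \<exists>y\<in>X. P (cact x) (cact y)" using Pxy by (metis linorder_neqE)
    show "\<not> P (cact x) (cact z)"
      if "x \<in> X" "y \<in> X" "z \<in> X" "\<not> P (cact x) (cact y) \<and> \<not> P (cact y) (cact z)" for x y z
      using that Pxy by simp
    fix f g assume f: "f \<in> acts \<Sigma> X" and g: "g \<in> acts \<Sigma> X"
    show "\<not> P g f" if "P f g" using that P f g by simp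
    show "P f h" if "h \<in> acts \<Sigma> X" "P f g \<and> P g h" for h using that P f g by auto
    show "P f g" if "\<forall>s. P (cact (f s)) (cact (g s))"
    proof -
      have less: "u (g s) < u (f s)" for s using that Pxy f g by (simp add: acts_def)
      have "I g < I f"
        unfolding I_def using less comp_in_simple_space[OF alg] f g by (intro lower_prev_strict_mono[OF alg K]) auto
      moreover have "J g < J f"
        unfolding J_def neg_less_iff_less using less comp_in_simple_space[OF alg] f g
        by (intro lower_prev_strict_mono[OF alg M]) (auto simp: v_def)
      ultimately show ?thesis using P f g by simp
    qed
    show "incomp P f g" if "\<forall>x\<in>X. incomp P f (cact x) \<longrightarrow> incomp P g (cact x)"
    proof -
      \<comment> \<open>A6: outcomes at both ends of the interval from \<open>I f\<close> to
        \<open>J f\<close> show that it is contained in that of \<open>g\<close>; nested intervals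
        cannot be ranked strictly at both ends.\<close>
      obtain x where x: "x \<in> X" "u x = I f"
        using lower_prev_certainty_equivalent[OF alg X K u f] unfolding I_def by blast
      obtain y where y: "y \<in> X" "u y = J f"
        using lower_prev_certainty_equivalent[OF alg X M v f] unfolding J_def v_def by (metis minus_minus)
      have "I g \<le> I f" "J f \<le> J g" using that x y inc f g IJ[OF f] by auto
      then show ?thesis using P f g by (auto simp: incomp_def)
    qed
    \<comment> \<open>A7: the outcomes act as separators, \<open>J f \<ge> u x > J g\<close> and
      \<open>I f > u y \<ge> I g\<close>.\<close>
    show "P f g" if "x \<in> X" "y \<in> X"
      "incomp P f (cact x) \<and> P (cact x) g \<and> incomp P g (cact y) \<and> P f (cact y)" for x y
      using that inc Pc P f g by fastforce
    show "P f g \<longleftrightarrow> P (mix a f (cact x)) (mix a g (cact x))" if "x \<in> X" "a \<in> {0<..<1}" for x a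
    proof -
      have "I (mix a h (cact x)) = a * I h + (1 - a) * u x \<and> J (mix a h (cact x)) = a * J h + (1 - a) * u x"
        if h: "h \<in> acts \<Sigma> X" for h
        using lower_prev_mix_cact[OF alg K u h \<open>x \<in> X\<close>, of a] lower_prev_mix_cact[OF alg M v h \<open>x \<in> X\<close>, of a]
          \<open>a \<in> {0<..<1}\<close> by (simp add: I_def J_def v_def)
      then show ?thesis
        using that f g P mixA[OF _ cact_in_acts[OF alg]] by simp
    qed
    have conv: "a * I f + (1 - a) * I g \<le> I (mix a f g)" "J (mix a f g) \<le> a * J f + (1 - a) * J g"
      if "a \<in> {0..1}" for a
      using lower_prev_mix[OF alg K u f g, of a] lower_prev_mix[OF alg M v f g, of a] that
      by (simp_all add: I_def J_def)
    show "P (mix a f g) (cact x)" if x: "x \<in> X" and a: "a \<in> {0..1}" and "P f (cact x) \<and> P g (cact x)" for x a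
    proof -
      have "a * - I f + (1 - a) * - I g < - u x"
        using that Pc f g by (intro convex_bound_lt) auto
      then show ?thesis using conv[OF a] Pc(1)[OF mixA[OF f g] x] a by simp
    qed
    show "P (cact x) (mix a f g)" if x: "x \<in> X" and a: "a \<in> {0..1}" and "P (cact x) f \<and> P (cact x) g" for x a
    proof -
      have "a * J f + (1 - a) * J g < u x"
        using that Pc f g by (intro convex_bound_lt) auto
      then show ?thesis using conv[OF a] Pc(2)[OF mixA[OF f g] x] a by simp
    qed
    fix h assume h: "h \<in> acts \<Sigma> X"
    have "{a\<in>{0..1}. P (mix a f g) h} = ({0..1} \<inter> (\<lambda>a. I (mix a f g)) -` {I h<..}) \<inter> ({0..1} \<inter> (\<lambda>a. J (mix a f g)) -` {J h<..})"
      using P[OF mixA[OF f g] h] by auto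
    then show "openin (top_of_set {0..1}) {a\<in>{0..1::real}. P (mix a f g) h}"
      using contI[OF f g] contJ[OF f g]
      by (simp only:) (intro openin_Int continuous_openin_preimage_gen; simp)
    have "{a\<in>{0..1}. P h (mix a f g)} = ({0..1} \<inter> (\<lambda>a. I (mix a f g)) -` {..<I h}) \<inter> ({0..1} \<inter> (\<lambda>a. J (mix a f g)) -` {..<J h})"
      using P[OF h mixA[OF f g]] by auto
    then show "openin (top_of_set {0..1}) {a\<in>{0..1::real}. P h (mix a f g)}"
      using contI[OF f g] contJ[OF f g]
      by (simp only:) (intro openin_Int continuous_openin_preimage_gen; simp)
  qed
qed

section \<open>Sufficiency of the axioms\<close>

text \<open>\<open>Q \<phi> r\<close> is a Dedekind cut for \<open>r < K \<phi>\<close>, and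
  openness excludes the supremum itself from it. Additivity is assumed only at threshold 0;
  translation moves other thresholds there and back.\<close>

lemma lower_prev_of_cut:
  assumes alg: "algebra UNIV \<Sigma>"
    and mono: "\<And>\<phi> \<psi> r. \<phi> \<in> simple_space \<Sigma> \<Longrightarrow> \<psi> \<in> simple_space \<Sigma> \<Longrightarrow> (\<And>s. \<phi> s \<le> \<psi> s) \<Longrightarrow> Q \<phi> r \<Longrightarrow> Q \<psi> r"
    and const: "\<And>a r. Q (\<lambda>_. a) r \<longleftrightarrow> r < a"
    and scale: "\<And>\<phi> r c. \<phi> \<in> simple_space \<Sigma> \<Longrightarrow> c > 0 \<Longrightarrow> Q \<phi> r \<Longrightarrow> Q (c *\<^sub>R \<phi>) (c * r)"
    and shift: "\<And>\<phi> r a. \<phi> \<in> simple_space \<Sigma> \<Longrightarrow> Q \<phi> r \<Longrightarrow> Q (\<phi> + (\<lambda>_. a)) (r + a)"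
    and add: "\<And>\<phi> \<psi>. \<phi> \<in> simple_space \<Sigma> \<Longrightarrow> \<psi> \<in> simple_space \<Sigma> \<Longrightarrow> Q \<phi> 0 \<Longrightarrow> Q \<psi> 0 \<Longrightarrow> Q (\<phi> + \<psi>) 0"
    and opn: "\<And>\<phi> r. \<phi> \<in> simple_space \<Sigma> \<Longrightarrow> Q \<phi> r \<Longrightarrow> \<exists>e>0. Q \<phi> (r + e)"
  obtains K where "lower_prev \<Sigma> K" "\<And>\<phi> r. \<phi> \<in> simple_space \<Sigma> \<Longrightarrow> Q \<phi> r \<longleftrightarrow> r < K \<phi>"
proof -
  note sub = subspace_simple_space[OF alg] and c = simple_space_const[OF alg]
  define K where "K \<phi> = Sup {r. Q \<phi> r}" for \<phi>
  have Q: "Q \<phi> r \<longleftrightarrow> r < K \<phi>" if \<phi>: "\<phi> \<in> simple_space \<Sigma>" for \<phi> r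
  proof -
    obtain B where B: "\<And>s. \<bar>\<phi> s\<bar> < B"
      using finmeas_bounded \<phi> unfolding mem_simple_space by metis
    have bd: "- B \<le> \<phi> s" "\<phi> s \<le> B" for s using B[of s] by linarith+
    have "Q (\<lambda>_. - B) (- B - 1)" using const by simp
    then have "Q \<phi> (- B - 1)"
      by (rule mono[OF c \<phi>, rotated]) (rule bd)
    then have ne: "{r. Q \<phi> r} \<noteq> {}" by blast
    have "r \<le> B" if r: "Q \<phi> r" for r
    proof -
      have "Q (\<lambda>_. B) r"
        using r by (rule mono[OF \<phi> c, rotated]) (rule bd)
      then show ?thesis using const by simp
    qed
    then have bdd: "bdd_above {r. Q \<phi> r}" by (intro bdd_aboveI[of _ B]) simp
    show ?thesis
    proof
      assume "Q \<phi> r"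
      then obtain e where "e > 0" "Q \<phi> (r + e)" using opn[OF \<phi>] by blast
      then have "r + e \<le> K \<phi>" unfolding K_def using bdd by (intro cSup_upper) auto
      then show "r < K \<phi>" using \<open>e > 0\<close> by simp
    next
      assume "r < K \<phi>"
      then obtain r' where r': "Q \<phi> r'" "r < r'" unfolding K_def using less_cSup_iff[OF ne bdd] by blast
      \<comment> \<open>Downward closure of the cut: lower the function along with the threshold,
        then raise the function back by monotonicity.\<close>
      have "Q (\<phi> + (\<lambda>_. r - r')) r" using shift[OF \<phi> r'(1), of "r - r'"] by simp
      then show "Q \<phi> r"
        by (rule mono[OF subspace_add[OF sub \<phi> c] \<phi>, rotated]) (use r' in simp)
    qed
  qed
  have eqI: "x = y" if "\<And>r::real. r < x \<longleftrightarrow> r < y" for x y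
    using that[of x] that[of y] by auto
  have "lower_prev \<Sigma> K"
    unfolding lower_prev_def
  proof (intro conjI ballI allI impI)
    fix a show "K (\<lambda>_. a) = a" using Q[OF c] const by (intro eqI) simp
  next
    fix \<phi> assume \<phi>: "\<phi> \<in> simple_space \<Sigma>"
    show "K (k *\<^sub>R \<phi>) = k * K \<phi>" if k: "k > 0" for k
    proof (rule eqI)
      fix r
      have k\<phi>: "k *\<^sub>R \<phi> \<in> simple_space \<Sigma>" by (rule subspace_scale[OF sub \<phi>])
      have "Q (k *\<^sub>R \<phi>) r \<longleftrightarrow> Q \<phi> (r / k)"
        using scale[OF \<phi> k, of "r / k"] scale[OF k\<phi>, of "inverse k" r] k by (auto simp: field_simps)
      then show "r < K (k *\<^sub>R \<phi>) \<longleftrightarrow> r < k * K \<phi>"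
        using Q[OF \<phi>] Q[OF k\<phi>] k by (simp add: field_simps)
    qed
    fix \<psi> assume \<psi>: "\<psi> \<in> simple_space \<Sigma>"
    show "K \<phi> \<le> K \<psi>" if "\<forall>s. \<phi> s \<le> \<psi> s"
    proof (rule dense_le)
      fix r assume "r < K \<phi>"
      then have "Q \<phi> r" using Q[OF \<phi>] by simp
      then have "Q \<psi> r" by (rule mono[OF \<phi> \<psi>, rotated]) (use that in simp)
      then show "r \<le> K \<psi>" using Q[OF \<psi>] by simp
    qed
    show "K \<phi> + K \<psi> \<le> K (\<phi> + \<psi>)"
    proof -
      have "r + t < K (\<phi> + \<psi>)" if r: "r < K \<phi>" and t: "t < K \<psi>" for r t
      proof -
        have "Q (\<phi> + (\<lambda>_. - r)) 0" "Q (\<psi> + (\<lambda>_. - t)) 0"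
          using shift[OF \<phi>, of r "- r"] shift[OF \<psi>, of t "- t"] r t Q[OF \<phi>] Q[OF \<psi>] by simp_all
        then have "Q ((\<phi> + (\<lambda>_. - r)) + (\<psi> + (\<lambda>_. - t))) 0"
          by (rule add[OF subspace_add[OF sub \<phi> c] subspace_add[OF sub \<psi> c]])
        then have "Q ((\<phi> + (\<lambda>_. - r)) + (\<psi> + (\<lambda>_. - t)) + (\<lambda>_. r + t)) (0 + (r + t))"
          using sub c \<phi> \<psi> by (intro shift subspace_add) 
        moreover have "(\<phi> + (\<lambda>_. - r)) + (\<psi> + (\<lambda>_. - t)) + (\<lambda>_. r + t) = \<phi> + \<psi>"
          by (simp add: fun_eq_iff)
        ultimately show ?thesis using Q[OF subspace_add[OF sub \<phi> \<psi>]] by simp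
      qed
      then have "K \<phi> + t \<le> K (\<phi> + \<psi>)" if "t < K \<psi>" for t
        using that dense_le[of "K \<phi>" "K (\<phi> + \<psi>) - t"] by (force simp: le_diff_eq)
      then show ?thesis
        using dense_le[of "K \<psi>" "K (\<phi> + \<psi>) - K \<phi>"] by (force simp: algebra_simps)
    qed
  qed
  then show ?thesis using that Q by blast
qed

text \<open>The working form of A2: a strict preference at weight 0 survives a small positive
  admixture of another act.\<close>

lemma openin_unit_interval_near_0:
  assumes "openin (top_of_set {0..1::real}) S" "0 \<in> S"
  obtains t where "0 < t" "t < 1" "t \<in> S"
proof -
  obtain T where T: "open T" "S = {0..1} \<inter> T" using assms(1) by (auto simp: openin_open)
  then obtain e where e: "e > 0" "\<And>t. dist t 0 < e \<Longrightarrow> t \<in> T" using assms(2) by (metis IntD2 open_dist)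
  have "min (1/2) (e/2) \<in> S" using e T by (auto simp: dist_real_def)
  then show ?thesis using that[of "min (1/2) (e/2)"] e(1) by auto
qed

lemma mix_0: "mix 0 f g = g"
  by (simp add: mix_def)

text \<open>Shrinks profiles into a range available from outcomes; \<open>k < 1\<close> makes the
  shrinking an instance of mixing under A3.\<close>

lemma admissible_scale:
  assumes "\<phi> \<in> simple_space \<Sigma>" "\<psi> \<in> simple_space \<Sigma>" "B > (0::real)"
  obtains k where "0 < k" "k < 1" "\<And>s. \<bar>k * \<phi> s\<bar> \<le> B" "\<And>s. \<bar>k * \<psi> s\<bar> \<le> B"
proof -
  obtain B1 where B1: "B1 > 0" "\<And>s. \<bar>\<phi> s\<bar> < B1"
    using finmeas_bounded assms(1) unfolding mem_simple_space by metis
  obtain B2 where B2: "B2 > 0" "\<And>s. \<bar>\<psi> s\<bar> < B2"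
    using finmeas_bounded assms(2) unfolding mem_simple_space by metis
  define k where "k = B / (B + B1 + B2)"
  have k: "0 < k" "k < 1" "k * (B1 + B2) \<le> B"
    using B1 B2 assms(3) by (auto simp: k_def field_simps)
  have "\<bar>k * y\<bar> \<le> B" if "\<bar>y\<bar> \<le> B1 + B2" for y
  proof -
    have "\<bar>k * y\<bar> \<le> k * (B1 + B2)" using k that by (simp add: abs_mult)
    then show ?thesis using k by simp
  qed
  then show ?thesis using that[of k] k B1(2) B2(2) B1(1) B2(1)
    by (smt (verit))
qed

lemma admissible_scale_finite:
  assumes "finite F" "F \<subseteq> simple_space \<Sigma>" "B > (0::real)"
  obtains k where "0 < k" "k < 1" "\<And>\<phi> s. \<phi> \<in> F \<Longrightarrow> \<bar>k * \<phi> s\<bar> \<le> B"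
proof -
  have "\<exists>k. 0 < k \<and> k < 1 \<and> (\<forall>\<phi>\<in>F. \<forall>s. \<bar>k * \<phi> s\<bar> \<le> B)"
    using assms(1,2)
  proof induction
    case empty
    show ?case by (rule exI[of _ "1/2"]) simp
  next
    case (insert \<phi> F)
    then obtain k where k: "0 < k" "k < 1" "\<forall>\<phi>\<in>F. \<forall>s. \<bar>k * \<phi> s\<bar> \<le> B" by auto
    obtain l where l: "0 < l" "l < 1" "\<And>s. \<bar>l * \<phi> s\<bar> \<le> B"
      using admissible_scale[of \<phi> \<Sigma> \<phi> B] insert.prems assms(3) by auto
    have red: "\<bar>c * (d * y)\<bar> \<le> B" if "0 < c" "c < 1" "\<bar>d * y\<bar> \<le> B" for c d y
    proof -
      have "\<bar>c * (d * y)\<bar> \<le> \<bar>d * y\<bar>" using that by (simp add: abs_mult mult_left_le_one_le)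
      then show ?thesis using that by simp
    qed
    \<comment> \<open>The product works for all functions because each factor is below 1 and so
      preserves the bound secured by the other.\<close>
    have "\<forall>\<psi>\<in>insert \<phi> F. \<forall>s. \<bar>k * l * \<psi> s\<bar> \<le> B"
    proof (intro ballI allI)
      fix \<psi> s assume "\<psi> \<in> insert \<phi> F"
      then show "\<bar>k * l * \<psi> s\<bar> \<le> B"
        using red[OF k(1,2) l(3)[of s]] red[OF l(1,2), of k "\<psi> s"] k(3) by (auto simp: mult_ac)
    qed
    moreover have "k * l < 1" using k l mult_strict_mono[of k 1 l 1] by simp
    ultimately show ?case using k l by (intro exI[of _ "k * l"]) simp
  qed
  then show ?thesis using that by blast
qed

lemma abs_mean_le_1: "\<bar>x\<bar> \<le> 1 \<Longrightarrow> \<bar>y\<bar> \<le> 1 \<Longrightarrow> \<bar>(x + y) / 2\<bar> \<le> (1::real)"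
  by (simp add: abs_le_iff)

text \<open>Fixing utilities 1 and -1 makes the range of \<open>u\<close> a neighbourhood of 0
  containing all values of functions bounded by 1. The two reference outcomes are parameters because
  reversing the preference exchanges them.\<close>

locale normalized_pref =
  fixes \<Sigma> :: "'s set set" and X :: "'x::real_vector set"
    and P :: "('s \<Rightarrow> 'x) \<Rightarrow> ('s \<Rightarrow> 'x) \<Rightarrow> bool" and u :: "'x \<Rightarrow> real" and x1 x0 :: 'x
  assumes alg: "algebra UNIV \<Sigma>" and X: "convex X" and axioms: "axioms_A1_A7 \<Sigma> X P"
    and u: "affine_on X u"
    and ord: "\<And>x y. x \<in> X \<Longrightarrow> y \<in> X \<Longrightarrow> P (cact x) (cact y) \<longleftrightarrow> u x > u y"
    and x1: "x1 \<in> X" "u x1 = 1" and x0: "x0 \<in> X" "u x0 = - 1"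
begin

lemmas ax = axioms_A1_A7D[OF axioms]
lemmas sub = subspace_simple_space[OF alg]
lemmas cA = cact_in_acts[OF alg]
lemmas mixA = mix_in_acts[OF alg X]
lemmas cV = simple_space_const[OF alg]

lemma dual: "normalized_pref \<Sigma> X (\<lambda>f g. P g f) (\<lambda>x. - u x) x0 x1"
  by (rule normalized_pref.intro)
    (use alg X axioms_A1_A7_dual[OF axioms] u ord x1 x0 in \<open>auto simp: affine_on_def\<close>)

text \<open>A5 demands strict dominance in every state. Weak dominance is reduced to it by lowering
  \<open>g\<close> slightly towards \<open>x0\<close>, which A2 permits without losing the
  preference over \<open>h\<close>; strictness requires that \<open>g\<close> stay above
  \<open>x0\<close> in utility, hence the prior mixture with \<open>x1\<close>.\<close>

lemma pref_mono:
  assumes f: "f \<in> acts \<Sigma> X" and g: "g \<in> acts \<Sigma> X" and h: "h \<in> acts \<Sigma> X"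
    and le: "\<And>s. u (g s) \<le> u (f s)" and gh: "P g h"
  shows "P f h"
proof -
  obtain B where B: "B > 0" "\<And>s. \<bar>u (g s)\<bar> < B"
    using finmeas_bounded[OF finmeas_comp[OF alg, of g u]] g by (auto simp: acts_iff_finmeas)
  \<comment> \<open>Mixing with \<open>x1\<close> lifts all utilities strictly above \<open>u x0\<close>.\<close>
  define k where "k = 1 / (2 + B)"
  have k: "0 < k" "k < 1" "k * B < 1" using B by (auto simp: k_def field_simps)
  let ?F = "mix k f (cact x1)" and ?G = "mix k g (cact x1)" and ?H = "mix k h (cact x1)"
  have A: "?F \<in> acts \<Sigma> X" "?G \<in> acts \<Sigma> X" "?H \<in> acts \<Sigma> X"
    using mixA[OF _ cA[OF x1(1)]] f g h k by auto
  have "P ?G ?H" using ax(7)[OF g h x1(1) k(1,2)] gh by simp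
  then obtain t where t: "0 < t" "t < 1" "P (mix t (cact x0) ?G) ?H"
    using openin_unit_interval_near_0[OF ax(5)[OF cA[OF x0(1)] A(2,3)]] by (auto simp: mix_0)
  have tA: "mix t (cact x0) ?G \<in> acts \<Sigma> X" using mixA[OF cA[OF x0(1)] A(2)] t by simp
  have "P ?F (mix t (cact x0) ?G)"
  proof (rule ax(10)[OF A(1) tA])
    fix s
    have uF: "u (?F s) = k * u (f s) + (1 - k)" and uG: "u (?G s) = k * u (g s) + (1 - k)"
      using affine_comp_mix[OF u f cA[OF x1(1)], of k] affine_comp_mix[OF u g cA[OF x1(1)], of k] k x1
      by (simp_all add: fun_eq_iff cact_def)
    have "k * - u (g s) \<le> k * B" using B(2)[of s] k by (intro mult_left_mono) auto
    then have G: "- 1 < u (?G s)" using k uG by simp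
    have GF: "u (?G s) \<le> u (?F s)" using le[of s] k uF uG by simp
    have "u (mix t (cact x0) ?G s) = t * (- 1) + (1 - t) * u (?G s)"
      using affine_comp_mix[OF u cA[OF x0(1)] A(2), of t] t x0 by (simp add: fun_eq_iff cact_def)
    also have "\<dots> = u (?G s) - t * (u (?G s) + 1)" by (simp add: algebra_simps)
    also have "\<dots> < u (?G s)" using t G by simp
    finally have "u (mix t (cact x0) ?G s) < u (?F s)" using GF by simp
    then show "P (cact (?F s)) (cact (mix t (cact x0) ?G s))"
      using ord A(1) tA by (simp add: acts_def)
  qed
  then have "P ?F ?H" using ax(2)[OF A(1) tA A(3)] t(3) by simp
  then show ?thesis using ax(7)[OF f h x1(1) k(1,2)] by simp
qed

lemma pref_mono_right:
  assumes "f \<in> acts \<Sigma> X" "g \<in> acts \<Sigma> X" "h \<in> acts \<Sigma> X" "\<And>s. u (f s) \<le> u (g s)" "P h g"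
  shows "P h f"
  using normalized_pref.pref_mono[OF dual assms(1,2,3)] assms(4,5) by simp

text \<open>Realises a profile bounded by 1 on the segment from \<open>x0\<close> to
  \<open>x1\<close>: a right inverse of composition with \<open>u\<close> that commutes with
  mixtures.\<close>

definition em :: "('s \<Rightarrow> real) \<Rightarrow> 's \<Rightarrow> 'x" where
  "em \<phi> s = ((1 + \<phi> s) / 2) *\<^sub>R x1 + ((1 - \<phi> s) / 2) *\<^sub>R x0"

lemma em_in_acts:
  assumes "\<phi> \<in> simple_space \<Sigma>" "\<And>s. \<bar>\<phi> s\<bar> \<le> 1"
  shows "em \<phi> \<in> acts \<Sigma> X"
  unfolding acts_iff_finmeas
proof (intro conjI allI)
  have "em \<phi> = (\<lambda>s. ((1 + \<phi> s) / 2) *\<^sub>R x1 + ((1 - \<phi> s) / 2) *\<^sub>R x0)"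
    by (rule ext) (rule em_def)
  then show "finmeas \<Sigma> (em \<phi>)"
    using finmeas_comp[OF alg, of \<phi> "\<lambda>y. ((1 + y) / 2) *\<^sub>R x1 + ((1 - y) / 2) *\<^sub>R x0"] assms(1)
    by (simp only: mem_simple_space)
  fix s show "em \<phi> s \<in> X"
    unfolding em_def using assms(2)[of s] x1 x0 by (intro convexD[OF X]) (auto simp: field_simps)
qed

lemma u_em:
  assumes "\<And>s. \<bar>\<phi> s\<bar> \<le> 1"
  shows "u (em \<phi> s) = \<phi> s"
proof -
  have "(1 - \<phi> s) / 2 = 1 - (1 + \<phi> s) / 2" by (simp add: field_simps)
  then have "u (em \<phi> s) = (1 + \<phi> s) / 2 * u x1 + (1 - (1 + \<phi> s) / 2) * u x0"
    unfolding em_def using assms[of s] by (simp only:) (intro affine_onD[OF u x1(1) x0(1)]; simp)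
  then show ?thesis using x1 x0 by (simp add: field_simps)
qed

lemma mix_em: "mix a (em \<phi>) (em \<psi>) = em (\<lambda>s. a * \<phi> s + (1 - a) * \<psi> s)"
proof
  fix s
  have 1: "(1 + (a * \<phi> s + (1 - a) * \<psi> s)) / 2 = a * ((1 + \<phi> s) / 2) + (1 - a) * ((1 + \<psi> s) / 2)"
    and 2: "(1 - (a * \<phi> s + (1 - a) * \<psi> s)) / 2 = a * ((1 - \<phi> s) / 2) + (1 - a) * ((1 - \<psi> s) / 2)"
    by (simp_all add: field_simps)
  show "mix a (em \<phi>) (em \<psi>) s = em (\<lambda>s. a * \<phi> s + (1 - a) * \<psi> s) s"
    unfolding mix_def em_def 1 2 by (simp add: scaleR_left_distrib scaleR_right_distrib)
qed

definition pt :: "real \<Rightarrow> 'x" where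
  "pt r = ((1 + r) / 2) *\<^sub>R x1 + ((1 - r) / 2) *\<^sub>R x0"

lemma em_const: "em (\<lambda>_. r) = cact (pt r)"
  by (simp add: fun_eq_iff em_def cact_def pt_def)

lemma pt_in_X: "\<bar>r\<bar> \<le> 1 \<Longrightarrow> pt r \<in> X"
  unfolding pt_def using x1 x0 by (intro convexD[OF X]) (auto simp: field_simps)

text \<open>The preference transported to utility profiles and extended to all simple functions by
  homogeneity.\<close>

definition R :: "('s \<Rightarrow> real) \<Rightarrow> ('s \<Rightarrow> real) \<Rightarrow> bool" where
  "R \<phi> \<psi> \<longleftrightarrow> (\<exists>k>0. (\<forall>s. \<bar>k * \<phi> s\<bar> \<le> 1) \<and> (\<forall>s. \<bar>k * \<psi> s\<bar> \<le> 1) \<and> P (em (k *\<^sub>R \<phi>)) (em (k *\<^sub>R \<psi>)))"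

text \<open>Shrinking a profile amounts to mixing its act with the outcome of utility 0, so this is
  A3.\<close>

lemma em_scale_less:
  assumes V: "\<phi> \<in> simple_space \<Sigma>" "\<psi> \<in> simple_space \<Sigma>" and k: "0 < k" "k < l"
    and l: "\<And>s. \<bar>l * \<phi> s\<bar> \<le> 1" "\<And>s. \<bar>l * \<psi> s\<bar> \<le> 1"
  shows "P (em (k *\<^sub>R \<phi>)) (em (k *\<^sub>R \<psi>)) \<longleftrightarrow> P (em (l *\<^sub>R \<phi>)) (em (l *\<^sub>R \<psi>))"
proof -
  have "em (k *\<^sub>R \<eta>) = mix (k / l) (em (l *\<^sub>R \<eta>)) (cact (pt 0))" for \<eta>
    unfolding em_const[symmetric] mix_em using k by (simp add: scaleR_fun_def)
  moreover have "em (l *\<^sub>R \<phi>) \<in> acts \<Sigma> X" "em (l *\<^sub>R \<psi>) \<in> acts \<Sigma> X"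
    using l subspace_scale[OF sub] V by (auto intro!: em_in_acts)
  ultimately show ?thesis
    using ax(7)[of "em (l *\<^sub>R \<phi>)" "em (l *\<^sub>R \<psi>)" "pt 0" "k / l"] k pt_in_X[of 0] by simp
qed

lemma R_iff:
  assumes V: "\<phi> \<in> simple_space \<Sigma>" "\<psi> \<in> simple_space \<Sigma>" and k: "0 < k"
    and kb: "\<And>s. \<bar>k * \<phi> s\<bar> \<le> 1" "\<And>s. \<bar>k * \<psi> s\<bar> \<le> 1"
  shows "R \<phi> \<psi> \<longleftrightarrow> P (em (k *\<^sub>R \<phi>)) (em (k *\<^sub>R \<psi>))"
proof
  assume "R \<phi> \<psi>"
  then obtain l where l: "l > 0" "\<And>s. \<bar>l * \<phi> s\<bar> \<le> 1" "\<And>s. \<bar>l * \<psi> s\<bar> \<le> 1" "P (em (l *\<^sub>R \<phi>)) (em (l *\<^sub>R \<psi>))"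
    unfolding R_def by blast
  show "P (em (k *\<^sub>R \<phi>)) (em (k *\<^sub>R \<psi>))"
    using em_scale_less[OF V k _ l(2,3)] em_scale_less[OF V l(1) _ kb] l(4)
    by (cases k l rule: linorder_cases) auto
qed (use k kb in \<open>auto simp: R_def\<close>)

text \<open>A general act need not take values on the segment. After shrinking, the act and its
  realisation by \<open>em\<close> have equal utilities in every state, and monotonicity in both
  directions makes them interchangeable.\<close>

lemma pref_iff_R:
  assumes f: "f \<in> acts \<Sigma> X" and g: "g \<in> acts \<Sigma> X"
  shows "P f g \<longleftrightarrow> R (u \<circ> f) (u \<circ> g)"
proof -
  note V = comp_in_simple_space[OF alg f, of u] comp_in_simple_space[OF alg g, of u]
  obtain k where k: "0 < k" "k < 1" "\<And>s. \<bar>k * (u \<circ> f) s\<bar> \<le> 1" "\<And>s. \<bar>k * (u \<circ> g) s\<bar> \<le> 1"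
    using admissible_scale[OF V, of 1] by auto
  let ?c = "cact (pt 0)"
  have pt0: "pt 0 \<in> X" by (rule pt_in_X) simp
  have upt0: "u (pt 0) = 0" using u_em[of "\<lambda>_. 0"] by (simp add: em_const cact_def)
  have A: "mix k f ?c \<in> acts \<Sigma> X" "mix k g ?c \<in> acts \<Sigma> X"
    using mixA[OF _ cA[OF pt0]] f g k by auto
  have E: "em (k *\<^sub>R (u \<circ> f)) \<in> acts \<Sigma> X" "em (k *\<^sub>R (u \<circ> g)) \<in> acts \<Sigma> X"
    using k subspace_scale[OF sub] V by (auto intro!: em_in_acts)
  have eq: "u (mix k h ?c s) = k * u (h s)" if "h \<in> acts \<Sigma> X" for h s
    using affine_comp_mix[OF u that cA[OF pt0], of k] k upt0 by (simp add: fun_eq_iff cact_def)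
  have ee: "u (em (k *\<^sub>R (u \<circ> f)) s) = k * u (f s)" "u (em (k *\<^sub>R (u \<circ> g)) s) = k * u (g s)" for s
    using u_em[of "k *\<^sub>R (u \<circ> f)"] u_em[of "k *\<^sub>R (u \<circ> g)"] k by simp_all
  have "P f g \<longleftrightarrow> P (mix k f ?c) (mix k g ?c)" using ax(7)[OF f g pt0 k(1,2)] .
  also have "\<dots> \<longleftrightarrow> P (em (k *\<^sub>R (u \<circ> f))) (mix k g ?c)"
    using pref_mono[OF A(1) E(1) A(2)] pref_mono[OF E(1) A(1) A(2)] eq[OF f] ee(1) by auto
  also have "\<dots> \<longleftrightarrow> P (em (k *\<^sub>R (u \<circ> f))) (em (k *\<^sub>R (u \<circ> g)))"
    using pref_mono_right[OF A(2) E(2) E(1)] pref_mono_right[OF E(2) A(2) E(1)] eq[OF g] ee(2) by auto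
  finally show ?thesis unfolding R_iff[OF V k(1,3,4)] .
qed

section \<open>The axioms for the relation on simple functions\<close>

lemma scaled_em_in_acts:
  assumes "\<phi> \<in> simple_space \<Sigma>" "\<And>s. \<bar>k * \<phi> s\<bar> \<le> 1"
  shows "em (k *\<^sub>R \<phi>) \<in> acts \<Sigma> X"
  using assms subspace_scale[OF sub] by (intro em_in_acts) auto

lemma em_scale_const: "em (k *\<^sub>R (\<lambda>_. r)) = cact (pt (k * r))"
  by (simp add: em_const[symmetric] scaleR_fun_def)

lemma R_asym:
  assumes V: "\<phi> \<in> simple_space \<Sigma>" "\<psi> \<in> simple_space \<Sigma>" and R: "R \<phi> \<psi>"
  shows "\<not> R \<psi> \<phi>"
proof -
  obtain k where k: "0 < k" "k < 1" "\<And>\<eta> s. \<eta> \<in> {\<phi>, \<psi>} \<Longrightarrow> \<bar>k * \<eta> s\<bar> \<le> 1"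
    by (rule admissible_scale_finite[of "{\<phi>, \<psi>}" \<Sigma> 1]) (use V in auto)
  have kb: "\<And>s. \<bar>k * \<phi> s\<bar> \<le> 1" "\<And>s. \<bar>k * \<psi> s\<bar> \<le> 1" using k(3) by auto
  show ?thesis
    using R ax(1)[OF scaled_em_in_acts[OF V(1) kb(1)] scaled_em_in_acts[OF V(2) kb(2)]]
    unfolding R_iff[OF V k(1) kb] R_iff[OF V(2,1) k(1) kb(2,1)] by blast
qed

lemma R_trans:
  assumes V: "\<phi> \<in> simple_space \<Sigma>" "\<psi> \<in> simple_space \<Sigma>" "\<theta> \<in> simple_space \<Sigma>"
    and R: "R \<phi> \<psi>" "R \<psi> \<theta>"
  shows "R \<phi> \<theta>"
proof -
  obtain k where k: "0 < k" "k < 1" "\<And>\<eta> s. \<eta> \<in> {\<phi>, \<psi>, \<theta>} \<Longrightarrow> \<bar>k * \<eta> s\<bar> \<le> 1"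
    by (rule admissible_scale_finite[of "{\<phi>, \<psi>, \<theta>}" \<Sigma> 1]) (use V in auto)
  have kb: "\<And>s. \<bar>k * \<phi> s\<bar> \<le> 1" "\<And>s. \<bar>k * \<psi> s\<bar> \<le> 1" "\<And>s. \<bar>k * \<theta> s\<bar> \<le> 1" using k(3) by auto
  show ?thesis
    using R ax(2)[OF scaled_em_in_acts[OF V(1) kb(1)] scaled_em_in_acts[OF V(2) kb(2)] scaled_em_in_acts[OF V(3) kb(3)]]
    unfolding R_iff[OF V(1,2) k(1) kb(1,2)] R_iff[OF V(2,3) k(1) kb(2,3)] R_iff[OF V(1,3) k(1) kb(1,3)] by blast
qed

lemma R_mono:
  assumes V: "\<phi> \<in> simple_space \<Sigma>" "\<psi> \<in> simple_space \<Sigma>" "\<theta> \<in> simple_space \<Sigma>"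
    and le: "\<And>s. \<psi> s \<le> \<phi> s" and R: "R \<psi> \<theta>"
  shows "R \<phi> \<theta>"
proof -
  obtain k where k: "0 < k" "k < 1" "\<And>\<eta> s. \<eta> \<in> {\<phi>, \<psi>, \<theta>} \<Longrightarrow> \<bar>k * \<eta> s\<bar> \<le> 1"
    by (rule admissible_scale_finite[of "{\<phi>, \<psi>, \<theta>}" \<Sigma> 1]) (use V in auto)
  have kb: "\<And>s. \<bar>k * \<phi> s\<bar> \<le> 1" "\<And>s. \<bar>k * \<psi> s\<bar> \<le> 1" "\<And>s. \<bar>k * \<theta> s\<bar> \<le> 1" using k(3) by auto
  have "u (em (k *\<^sub>R \<psi>) s) \<le> u (em (k *\<^sub>R \<phi>) s)" for s
    using u_em[of "k *\<^sub>R \<psi>" s] u_em[of "k *\<^sub>R \<phi>" s] kb le[of s] k by simp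
  then show ?thesis
    using R pref_mono[OF scaled_em_in_acts[OF V(1) kb(1)] scaled_em_in_acts[OF V(2) kb(2)] scaled_em_in_acts[OF V(3) kb(3)]]
    unfolding R_iff[OF V(2,3) k(1) kb(2,3)] R_iff[OF V(1,3) k(1) kb(1,3)] by blast
qed

lemma R_const: "R (\<lambda>_. a) (\<lambda>_. r) \<longleftrightarrow> r < a"
proof -
  obtain k where k: "0 < k" "k < 1" "\<And>\<eta> s. \<eta> \<in> {\<lambda>_::'s. a, \<lambda>_. r} \<Longrightarrow> \<bar>k * \<eta> s\<bar> \<le> 1"
    by (rule admissible_scale_finite[of "{\<lambda>_. a, \<lambda>_. r}" \<Sigma> 1]) (use cV in auto)
  have kb: "\<bar>k * a\<bar> \<le> 1" "\<bar>k * r\<bar> \<le> 1" using k(3) by auto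
  have upt: "u (pt r) = r" if "\<bar>r\<bar> \<le> 1" for r
    using u_em[of "\<lambda>_. r"] that by (simp add: em_const cact_def)
  have "R (\<lambda>_. a) (\<lambda>_. r) \<longleftrightarrow> P (cact (pt (k * a))) (cact (pt (k * r)))"
    using R_iff[OF cV cV k(1), of a r] kb by (simp add: em_scale_const)
  also have "\<dots> \<longleftrightarrow> k * r < k * a"
    using ord[OF pt_in_X[OF kb(1)] pt_in_X[OF kb(2)]] upt kb by simp
  finally show ?thesis using k by simp
qed

lemma R_scale:
  assumes V: "\<phi> \<in> simple_space \<Sigma>" "\<psi> \<in> simple_space \<Sigma>" and c: "c > 0" and R: "R \<phi> \<psi>"
  shows "R (c *\<^sub>R \<phi>) (c *\<^sub>R \<psi>)"
proof -
  obtain k where k: "k > 0" "\<And>s. \<bar>k * \<phi> s\<bar> \<le> 1" "\<And>s. \<bar>k * \<psi> s\<bar> \<le> 1" "P (em (k *\<^sub>R \<phi>)) (em (k *\<^sub>R \<psi>))"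
    using R unfolding R_def by blast
  show ?thesis
    unfolding R_def
  proof (intro exI[of _ "k / c"] conjI allI)
    show "P (em ((k / c) *\<^sub>R c *\<^sub>R \<phi>)) (em ((k / c) *\<^sub>R c *\<^sub>R \<psi>))"
      unfolding scaleR_scaleR using c k(4) by simp
  qed (use k c in auto)
qed

text \<open>An equal mixture with the outcome of utility \<open>k * a\<close> realises the translate
  at factor \<open>k / 2\<close>, so translation invariance is again A3.\<close>

lemma R_shift:
  assumes V: "\<phi> \<in> simple_space \<Sigma>" "\<psi> \<in> simple_space \<Sigma>" and R: "R \<phi> \<psi>"
  shows "R (\<phi> + (\<lambda>_. a)) (\<psi> + (\<lambda>_. a))"
proof -
  obtain k where k: "0 < k" "k < 1" "\<And>\<eta> s. \<eta> \<in> {\<phi>, \<psi>, \<lambda>_. a} \<Longrightarrow> \<bar>k * \<eta> s\<bar> \<le> 1"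
    by (rule admissible_scale_finite[of "{\<phi>, \<psi>, \<lambda>_. a}" \<Sigma> 1]) (use V cV in auto)
  have kb: "\<And>s. \<bar>k * \<phi> s\<bar> \<le> 1" "\<And>s. \<bar>k * \<psi> s\<bar> \<le> 1" "\<bar>k * a\<bar> \<le> 1" using k(3) by auto
  have eq: "mix (1/2) (em (k *\<^sub>R \<theta>)) (cact (pt (k * a))) = em ((k / 2) *\<^sub>R (\<theta> + (\<lambda>_. a)))" for \<theta>
    unfolding em_const[symmetric] mix_em by (rule arg_cong[where f = em]) (simp add: fun_eq_iff algebra_simps)
  have "P (em (k *\<^sub>R \<phi>)) (em (k *\<^sub>R \<psi>))" using R unfolding R_iff[OF V k(1) kb(1,2)] .
  then have "P (em ((k / 2) *\<^sub>R (\<phi> + (\<lambda>_. a)))) (em ((k / 2) *\<^sub>R (\<psi> + (\<lambda>_. a))))"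
    using ax(7)[OF scaled_em_in_acts[OF V(1) kb(1)] scaled_em_in_acts[OF V(2) kb(2)] pt_in_X[OF kb(3)], of "1/2"]
    unfolding eq by simp
  moreover have "\<bar>k / 2 * (\<theta> + (\<lambda>_. a)) s\<bar> \<le> 1" if "\<And>s. \<bar>k * \<theta> s\<bar> \<le> 1" for \<theta> :: "'s \<Rightarrow> real" and s
  proof -
    have "k / 2 * (\<theta> + (\<lambda>_. a)) s = (k * \<theta> s + k * a) / 2" by (simp add: algebra_simps)
    then show ?thesis using abs_mean_le_1[OF that[of s] kb(3)] by (simp only:)
  qed
  ultimately show ?thesis
    unfolding R_def using k(1) kb by (intro exI[of _ "k / 2"]) auto
qed

text \<open>A4 at the midpoint, the factor 1/2 being absorbed into the scale.\<close>

lemma R_add: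
  assumes V: "\<phi> \<in> simple_space \<Sigma>" "\<psi> \<in> simple_space \<Sigma>" and R: "R \<phi> (\<lambda>_. 0)" "R \<psi> (\<lambda>_. 0)"
  shows "R (\<phi> + \<psi>) (\<lambda>_. 0)"
proof -
  obtain k where k: "0 < k" "k < 1" "\<And>\<eta> s. \<eta> \<in> {\<phi>, \<psi>} \<Longrightarrow> \<bar>k * \<eta> s\<bar> \<le> 1"
    by (rule admissible_scale_finite[of "{\<phi>, \<psi>}" \<Sigma> 1]) (use V in auto)
  have kb: "\<And>s. \<bar>k * \<phi> s\<bar> \<le> 1" "\<And>s. \<bar>k * \<psi> s\<bar> \<le> 1" using k(3) by auto
  have eq: "mix (1/2) (em (k *\<^sub>R \<phi>)) (em (k *\<^sub>R \<psi>)) = em ((k / 2) *\<^sub>R (\<phi> + \<psi>))"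
    unfolding mix_em by (rule arg_cong[where f = em]) (simp add: fun_eq_iff algebra_simps)
  have "P (em (k *\<^sub>R \<phi>)) (cact (pt 0))" "P (em (k *\<^sub>R \<psi>)) (cact (pt 0))"
    using R R_iff[OF V(1) cV k(1) kb(1), of 0] R_iff[OF V(2) cV k(1) kb(2), of 0] by (simp_all add: em_scale_const)
  then have "P (em ((k / 2) *\<^sub>R (\<phi> + \<psi>))) (em ((k / 2) *\<^sub>R (\<lambda>_. 0)))"
    using ax(8)[OF pt_in_X scaled_em_in_acts[OF V(1) kb(1)] scaled_em_in_acts[OF V(2) kb(2)], of 0 "1/2"]
    unfolding eq em_scale_const by simp
  moreover have "\<bar>k / 2 * (\<phi> + \<psi>) s\<bar> \<le> 1" for s
  proof -
    have "k / 2 * (\<phi> + \<psi>) s = (k * \<phi> s + k * \<psi> s) / 2" by (simp add: algebra_simps)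
    then show ?thesis using abs_mean_le_1[OF kb(1,2)] by (simp only:)
  qed
  ultimately show ?thesis
    unfolding R_def using k(1) by (intro exI[of _ "k / 2"]) auto
qed

text \<open>A2 allows a small admixture of the outcome of utility -1, giving the profile
  \<open>\<theta>\<close>. Monotonicity then replaces \<open>\<theta>\<close> by a translate of
  \<open>\<phi>\<close> by a constant.\<close>

lemma R_open:
  assumes V: "\<phi> \<in> simple_space \<Sigma>" "\<psi> \<in> simple_space \<Sigma>" and R: "R \<phi> \<psi>"
  obtains e where "e > 0" "R (\<phi> + (\<lambda>_. - e)) \<psi>"
proof -
  \<comment> \<open>The bound 1/2 in place of 1 keeps \<open>\<phi>\<close> away from the admixed
    value: the mixture loses at least \<open>t / 2\<close> in every state after scaling, whence
    \<open>e = t / (2 * k)\<close>.\<close>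
  obtain k where k: "0 < k" "k < 1" "\<And>\<eta> s. \<eta> \<in> {\<phi>, \<psi>} \<Longrightarrow> \<bar>k * \<eta> s\<bar> \<le> 1/2"
    by (rule admissible_scale_finite[of "{\<phi>, \<psi>}" \<Sigma> "1/2"]) (use V in auto)
  have kb: "\<bar>k * \<phi> s\<bar> \<le> 1/2" "\<bar>k * \<psi> s\<bar> \<le> 1/2" for s using k(3) by auto
  have kb1: "\<bar>k * \<phi> s\<bar> \<le> 1" "\<bar>k * \<psi> s\<bar> \<le> 1" for s using kb[of s] by auto
  have A: "em (k *\<^sub>R \<phi>) \<in> acts \<Sigma> X" "em (k *\<^sub>R \<psi>) \<in> acts \<Sigma> X"
    using scaled_em_in_acts[OF V(1) kb1(1)] scaled_em_in_acts[OF V(2) kb1(2)] by auto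
  have "P (em (k *\<^sub>R \<phi>)) (em (k *\<^sub>R \<psi>))" using R unfolding R_iff[OF V k(1) kb1] .
  then obtain t where t: "0 < t" "t < 1" "P (mix t (cact (pt (- 1))) (em (k *\<^sub>R \<phi>))) (em (k *\<^sub>R \<psi>))"
    using openin_unit_interval_near_0[OF ax(5)[OF cA[OF pt_in_X[of "- 1"]] A]] by (auto simp: mix_0)
  define \<theta> where "\<theta> = (1 - t) *\<^sub>R \<phi> + (\<lambda>_. - (t / k))"
  have \<theta>: "\<theta> \<in> simple_space \<Sigma>"
    unfolding \<theta>_def using subspace_add[OF sub subspace_scale[OF sub V(1)] cV] .
  have k\<theta>: "k * \<theta> s = (1 - t) * (k * \<phi> s) - t" for s
    using k by (simp add: \<theta>_def algebra_simps)
  have "mix t (cact (pt (- 1))) (em (k *\<^sub>R \<phi>)) = em (k *\<^sub>R \<theta>)"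
    unfolding em_const[symmetric] mix_em using k\<theta> by (intro arg_cong[where f = em]) (simp add: fun_eq_iff)
  moreover have "\<bar>k * \<theta> s\<bar> \<le> 1" for s
  proof -
    have "\<bar>(1 - t) * (k * \<phi> s)\<bar> \<le> (1 - t) * 1"
      using t kb1(1)[of s] unfolding abs_mult by (intro mult_mono) auto
    moreover have "\<bar>y - t\<bar> \<le> 1" if "\<bar>y\<bar> \<le> (1 - t) * 1" for y
      using that t by (simp add: abs_le_iff)
    ultimately show ?thesis unfolding k\<theta> by blast
  qed
  ultimately have R\<theta>: "R \<theta> \<psi>" unfolding R_def using t k kb1 by (intro exI[of _ k]) auto
  define e where "e = t / (2 * k)"
  have "e > 0" using t k by (simp add: e_def)
  have "\<theta> s \<le> (\<phi> + (\<lambda>_. - e)) s" for s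
  proof -
    have "t * - (k * \<phi> s) \<le> t * (1/2)" using t kb(1)[of s] by (intro mult_left_mono) auto
    then have "k * \<theta> s \<le> k * \<phi> s - t / 2" unfolding k\<theta> by (simp add: algebra_simps)
    also have "\<dots> = k * (\<phi> + (\<lambda>_. - e)) s" using k by (simp add: e_def algebra_simps)
    finally show ?thesis using k by simp
  qed
  then have "R (\<phi> + (\<lambda>_. - e)) \<psi>"
    using R_mono[OF subspace_add[OF sub V(1) cV] \<theta> V(2) _ R\<theta>] by simp
  then show ?thesis using that \<open>e > 0\<close> by blast
qed

lemma R_of_A7:
  assumes V: "\<phi> \<in> simple_space \<Sigma>" "\<psi> \<in> simple_space \<Sigma>"
    and "\<not> R \<phi> (\<lambda>_. r)" "\<not> R (\<lambda>_. r) \<phi>" "R (\<lambda>_. r) \<psi>" "\<not> R \<psi> (\<lambda>_. t)" "\<not> R (\<lambda>_. t) \<psi>" "R \<phi> (\<lambda>_. t)"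
  shows "R \<phi> \<psi>"
proof -
  obtain k where k: "0 < k" "k < 1" "\<And>\<eta> s. \<eta> \<in> {\<phi>, \<psi>, \<lambda>_. r, \<lambda>_. t} \<Longrightarrow> \<bar>k * \<eta> s\<bar> \<le> 1"
    by (rule admissible_scale_finite[of "{\<phi>, \<psi>, \<lambda>_. r, \<lambda>_. t}" \<Sigma> 1]) (use V cV in auto)
  have kb: "\<And>s. \<bar>k * \<phi> s\<bar> \<le> 1" "\<And>s. \<bar>k * \<psi> s\<bar> \<le> 1" "\<bar>k * r\<bar> \<le> 1" "\<bar>k * t\<bar> \<le> 1" using k(3) by auto
  show ?thesis
    using assms(3-)
      ax(12)[OF scaled_em_in_acts[OF V(1) kb(1)] scaled_em_in_acts[OF V(2) kb(2)] pt_in_X[OF kb(3)] pt_in_X[OF kb(4)]]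
    unfolding R_iff[OF V k(1) kb(1,2)] R_iff[OF V(1) cV k(1) kb(1,3)] R_iff[OF cV V(1) k(1) kb(3,1)]
      R_iff[OF cV V(2) k(1) kb(3,2)] R_iff[OF V(2) cV k(1) kb(2,4)] R_iff[OF cV V(2) k(1) kb(4,2)]
      R_iff[OF V(1) cV k(1) kb(1,4)] em_scale_const incomp_def by blast
qed

lemma lower_prev_of_R:
  obtains K where "lower_prev \<Sigma> K" "\<And>\<phi> r. \<phi> \<in> simple_space \<Sigma> \<Longrightarrow> R \<phi> (\<lambda>_. r) \<longleftrightarrow> r < K \<phi>"
    "\<And>\<phi> \<psi>. \<phi> \<in> simple_space \<Sigma> \<Longrightarrow> \<psi> \<in> simple_space \<Sigma> \<Longrightarrow> R \<phi> \<psi> \<Longrightarrow> K \<psi> < K \<phi>"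
proof -
  have shift: "R (\<phi> + (\<lambda>_. a)) (\<lambda>_. r + a)" if "\<phi> \<in> simple_space \<Sigma>" "R \<phi> (\<lambda>_. r)" for \<phi> r a
    using R_shift[OF that(1) cV that(2), of a] by (simp add: plus_fun_def)
  obtain K where K: "lower_prev \<Sigma> K" "\<And>\<phi> r. \<phi> \<in> simple_space \<Sigma> \<Longrightarrow> R \<phi> (\<lambda>_. r) \<longleftrightarrow> r < K \<phi>"
  proof (rule lower_prev_of_cut[OF alg, of "\<lambda>\<phi> r. R \<phi> (\<lambda>_. r)"])
    show "R \<psi> (\<lambda>_. r)" if "\<phi> \<in> simple_space \<Sigma>" "\<psi> \<in> simple_space \<Sigma>" "\<And>s. \<phi> s \<le> \<psi> s" "R \<phi> (\<lambda>_. r)" for \<phi> \<psi> r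
      using R_mono[OF that(2,1) cV that(3,4)] .
    show "R (\<lambda>_. a) (\<lambda>_. r) \<longleftrightarrow> r < a" for a r by (rule R_const)
    show "R (c *\<^sub>R \<phi>) (\<lambda>_. c * r)" if "\<phi> \<in> simple_space \<Sigma>" "c > 0" "R \<phi> (\<lambda>_. r)" for \<phi> r c
      using R_scale[OF that(1) cV that(2,3)] by (simp add: scaleR_fun_def)
    show "R (\<phi> + (\<lambda>_. a)) (\<lambda>_. r + a)" if "\<phi> \<in> simple_space \<Sigma>" "R \<phi> (\<lambda>_. r)" for \<phi> r a
      using shift[OF that] .
    show "R (\<phi> + \<psi>) (\<lambda>_. 0)" if "\<phi> \<in> simple_space \<Sigma>" "\<psi> \<in> simple_space \<Sigma>" "R \<phi> (\<lambda>_. 0)" "R \<psi> (\<lambda>_. 0)" for \<phi> \<psi>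
      using R_add[OF that] .
    show "\<exists>e>0. R \<phi> (\<lambda>_. r + e)" if \<phi>: "\<phi> \<in> simple_space \<Sigma>" and R\<phi>: "R \<phi> (\<lambda>_. r)" for \<phi> r
    proof -
      obtain e where e: "e > 0" "R (\<phi> + (\<lambda>_. - e)) (\<lambda>_. r)" using R_open[OF \<phi> cV R\<phi>] .
      have "\<phi> + (\<lambda>_. - e) + (\<lambda>_. e) = \<phi>" by (simp add: fun_eq_iff)
      then have "R \<phi> (\<lambda>_. r + e)"
        using shift[OF subspace_add[OF sub \<phi> cV] e(2), of e] by (simp only:)
      then show ?thesis using e(1) by blast
    qed
  qed blast
  have "K \<psi> < K \<phi>" if V: "\<phi> \<in> simple_space \<Sigma>" "\<psi> \<in> simple_space \<Sigma>" and R: "R \<phi> \<psi>" for \<phi> \<psi>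
  proof -
    \<comment> \<open>Comparing thresholds by transitivity only gives a weak inequality; the slack
      \<open>e\<close> makes it strict.\<close>
    obtain e where e: "e > 0" "R (\<phi> + (\<lambda>_. - e)) \<psi>" using R_open[OF V R] .
    note V' = subspace_add[OF sub V(1) cV]
    have "K \<psi> \<le> K (\<phi> + (\<lambda>_. - e))"
    proof (rule dense_le)
      fix r assume "r < K \<psi>"
      then have "R \<psi> (\<lambda>_. r)" using K(2)[OF V(2)] by simp
      then have "R (\<phi> + (\<lambda>_. - e)) (\<lambda>_. r)" by (rule R_trans[OF V' V(2) cV e(2)])
      then show "r \<le> K (\<phi> + (\<lambda>_. - e))" using K(2)[OF V'] by simp
    qed
    then show ?thesis using e(1) lower_prev_add_const[OF alg K(1) V(1), of "- e"] by simp
  qed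
  then show ?thesis using that K by blast
qed

theorem ex_prev_rep: "\<exists>K M. prev_rep \<Sigma> X P u K M"
proof -
  interpret d: normalized_pref \<Sigma> X "\<lambda>f g. P g f" "\<lambda>x. - u x" x0 x1 by (rule dual)
  \<comment> \<open>Exchanging the reference outcomes negates the realised profile, so the reversed
    relation compares negatives.\<close>
  have "d.em \<phi> = em (- \<phi>)" for \<phi>
    by (simp add: fun_eq_iff d.em_def em_def add.commute)
  then have dR: "d.R \<phi> \<psi> \<longleftrightarrow> R (- \<psi>) (- \<phi>)" for \<phi> \<psi>
    unfolding d.R_def R_def by (simp add: conj_ac)
  obtain K where K: "lower_prev \<Sigma> K" "\<And>\<phi> r. \<phi> \<in> simple_space \<Sigma> \<Longrightarrow> R \<phi> (\<lambda>_. r) \<longleftrightarrow> r < K \<phi>"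
    "\<And>\<phi> \<psi>. \<phi> \<in> simple_space \<Sigma> \<Longrightarrow> \<psi> \<in> simple_space \<Sigma> \<Longrightarrow> R \<phi> \<psi> \<Longrightarrow> K \<psi> < K \<phi>"
    using lower_prev_of_R by metis
  obtain M where M: "lower_prev \<Sigma> M" "\<And>\<phi> r. \<phi> \<in> simple_space \<Sigma> \<Longrightarrow> d.R \<phi> (\<lambda>_. r) \<longleftrightarrow> r < M \<phi>"
    "\<And>\<phi> \<psi>. \<phi> \<in> simple_space \<Sigma> \<Longrightarrow> \<psi> \<in> simple_space \<Sigma> \<Longrightarrow> d.R \<phi> \<psi> \<Longrightarrow> M \<psi> < M \<phi>"
    using d.lower_prev_of_R by metis
  note neg = subspace_neg[OF sub]
  have M2: "R (\<lambda>_. r) \<phi> \<longleftrightarrow> - M (- \<phi>) < r" if "\<phi> \<in> simple_space \<Sigma>" for \<phi> r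
  proof -
    have "- (\<lambda>_. - r) = (\<lambda>_::'s. r)" by (simp add: fun_eq_iff)
    then have "R (\<lambda>_. r) \<phi> \<longleftrightarrow> d.R (- \<phi>) (\<lambda>_. - r)" unfolding dR minus_minus by (simp only:)
    then show ?thesis using M(2)[OF neg[OF that], of "- r"] by auto
  qed
  have M3: "M (- \<phi>) < M (- \<psi>)" if "\<phi> \<in> simple_space \<Sigma>" "\<psi> \<in> simple_space \<Sigma>" "R \<phi> \<psi>" for \<phi> \<psi>
    using M(3)[OF neg[OF that(2)] neg[OF that(1)]] that(3) unfolding dR minus_minus by blast
  \<comment> \<open>A constant strictly between the two values would be both worse and better than
    \<open>\<phi>\<close>, against asymmetry.\<close>
  have KM: "K \<phi> \<le> - M (- \<phi>)" if \<phi>: "\<phi> \<in> simple_space \<Sigma>" for \<phi>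
  proof (rule ccontr)
    assume "\<not> K \<phi> \<le> - M (- \<phi>)"
    then obtain r where "- M (- \<phi>) < r" "r < K \<phi>" using dense by (metis not_le)
    then show False using R_asym[OF \<phi> cV, of r] K(2)[OF \<phi>] M2[OF \<phi>] by blast
  qed
  have R: "R \<phi> \<psi> \<longleftrightarrow> K \<phi> > K \<psi> \<and> M (- \<phi>) < M (- \<psi>)"
    if V: "\<phi> \<in> simple_space \<Sigma>" "\<psi> \<in> simple_space \<Sigma>" for \<phi> \<psi>
  proof
    assume "K \<phi> > K \<psi> \<and> M (- \<phi>) < M (- \<psi>)"
    then show "R \<phi> \<psi>"
      using KM[OF V(1)] KM[OF V(2)]
      by (intro R_of_A7[OF V, of "- M (- \<phi>)" "K \<psi>"]) (simp_all add: K(2) M2 V)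
  qed (use K(3)[OF V] M3[OF V] in blast)
  have "prev_rep \<Sigma> X P u K M"
    unfolding prev_rep_def
  proof (intro conjI ballI)
    show "\<exists>x\<in>X. \<exists>y\<in>X. u x \<noteq> u y" using x1 x0 by force
    fix f g assume "f \<in> acts \<Sigma> X" "g \<in> acts \<Sigma> X"
    then show "P f g \<longleftrightarrow> K (u \<circ> g) < K (u \<circ> f) \<and> M (- (u \<circ> f)) < M (- (u \<circ> g))"
      using pref_iff_R R comp_in_simple_space[OF alg] by metis
  qed (use u K(1) M(1) KM in auto)
  then show ?thesis by blast
qed

end



section \<open>Representation and uniqueness\<close>

lemma axioms_imp_prev_rep:
  fixes \<Sigma> :: "'s set set" and X :: "'x::real_vector set"
    and P :: "('s \<Rightarrow> 'x) \<Rightarrow> ('s \<Rightarrow> 'x) \<Rightarrow> bool"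
  assumes alg: "algebra UNIV \<Sigma>" and X: "convex X" and axioms: "axioms_A1_A7 \<Sigma> X P"
  obtains u K M where "prev_rep \<Sigma> X P u K M"
proof -
  note ax = axioms_A1_A7D[OF axioms] and cA = cact_in_acts[OF alg]
  have mix_cact: "mix t (cact x) (cact y) = (cact (t *\<^sub>R x + (1 - t) *\<^sub>R y) :: 's \<Rightarrow> 'x)" for t x y
    by (simp add: mix_def cact_def)
  obtain a b where ab: "a \<in> X" "b \<in> X" "P (cact a) (cact b)" using ax(3) by blast
  obtain v where v: "affine_on X v" "\<And>x y. x \<in> X \<Longrightarrow> y \<in> X \<Longrightarrow> P (cact x) (cact y) \<longleftrightarrow> v x > v y"
  proof (rule mixture_utility[OF X ab(1,2), of "\<lambda>x y. P (cact x) (cact y)"])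
    show "P (cact a) (cact b)" by (rule ab(3))
    show "\<not> P (cact y) (cact x)" if "x \<in> X" "y \<in> X" "P (cact x) (cact y)" for x y
      using ax(1)[OF cA cA] that by blast
    show "\<not> P (cact x) (cact z)"
      if "x \<in> X" "y \<in> X" "z \<in> X" "\<not> P (cact x) (cact y)" "\<not> P (cact y) (cact z)" for x y z
      using ax(4) that by blast
    show "P (cact x) (cact y) \<longleftrightarrow> P (cact (t *\<^sub>R x + (1 - t) *\<^sub>R z)) (cact (t *\<^sub>R y + (1 - t) *\<^sub>R z))"
      if "x \<in> X" "y \<in> X" "z \<in> X" "0 < t" "t < 1" for x y z t
      using ax(7)[OF cA cA that(3-5)] that(1,2) unfolding mix_cact by blast
    show "\<exists>t>0. t \<le> 1 \<and> P (cact x) (cact ((1 - t) *\<^sub>R y + t *\<^sub>R z))"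
      if m: "x \<in> X" "y \<in> X" "z \<in> X" and xy: "P (cact x) (cact y)" for x y z
    proof -
      have "0 \<in> {t \<in> {0..1}. P (cact x) (mix t (cact z) (cact y))}" using xy by (simp add: mix_0)
      then obtain t where "0 < t" "t < 1" "P (cact x) (mix t (cact z) (cact y))"
        using openin_unit_interval_near_0[OF ax(6)[OF cA[OF m(3)] cA[OF m(2)] cA[OF m(1)]]] by blast
      then show ?thesis
        by (intro exI[of _ t]) (simp add: mix_cact add.commute)
    qed
  qed blast
  have vab: "v b < v a" using v(2)[OF ab(1,2)] ab(3) by simp
  \<comment> \<open>The positive affine rescaling of \<open>v\<close> with value 1 at
    \<open>a\<close> and -1 at \<open>b\<close>.\<close>
  define u where "u x = (2 * v x - v a - v b) / (v a - v b)" for x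
  have "normalized_pref \<Sigma> X P u a b"
  proof (rule normalized_pref.intro)
    show "affine_on X u"
      unfolding affine_on_def
    proof (intro ballI)
      fix x y and t :: real assume "x \<in> X" "y \<in> X" "t \<in> {0..1}"
      then have "v (t *\<^sub>R x + (1 - t) *\<^sub>R y) = t * v x + (1 - t) * v y"
        using v(1) by (simp add: affine_on_def)
      then have "2 * v (t *\<^sub>R x + (1 - t) *\<^sub>R y) - v a - v b
          = t * (2 * v x - v a - v b) + (1 - t) * (2 * v y - v a - v b)"
        by (simp add: algebra_simps)
      then show "u (t *\<^sub>R x + (1 - t) *\<^sub>R y) = t * u x + (1 - t) * u y"
        unfolding u_def by (simp add: add_divide_distrib)
    qed
    show "P (cact x) (cact y) \<longleftrightarrow> u x > u y" if "x \<in> X" "y \<in> X" for x y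
      using v(2)[OF that] vab by (simp add: u_def divide_less_cancel)
    show "u a = 1" "u b = - 1" using vab by (simp_all add: u_def field_simps)
  qed (use alg X axioms ab in auto)
  then show ?thesis using normalized_pref.ex_prev_rep that by blast
qed

lemma prev_rep_dual:
  assumes alg: "algebra UNIV \<Sigma>" and rep: "prev_rep \<Sigma> X P u K M"
  shows "prev_rep \<Sigma> X (\<lambda>f g. P g f) (\<lambda>x. - u x) M K"
proof -
  have neg: "(\<lambda>x. - u x) \<circ> f = - (u \<circ> f)" for f by (simp add: fun_eq_iff)
  show ?thesis
    unfolding prev_rep_def neg minus_minus
  proof (intro conjI ballI)
    show "affine_on X (\<lambda>x. - u x)" using rep by (simp add: prev_rep_def affine_on_def)
    show "M \<phi> \<le> - K (- \<phi>)" if "\<phi> \<in> simple_space \<Sigma>" for \<phi>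
    proof -
      have "K (- \<phi>) \<le> - M (- (- \<phi>))"
        using rep subspace_neg[OF subspace_simple_space[OF alg] that] unfolding prev_rep_def by blast
      then show ?thesis unfolding minus_minus by linarith
    qed
  qed (use rep in \<open>auto simp: prev_rep_def\<close>)
qed

text \<open>Comparisons with constants fix the threshold \<open>K (u \<circ> f)\<close> for every
  act. Any simple function becomes the profile of an act after a positive affine change, under which
  lower previsions behave equivariantly.\<close>

lemma prev_rep_unique:
  fixes \<Sigma> :: "'s set set" and X :: "'x::real_vector set"
  assumes alg: "algebra UNIV \<Sigma>" and X: "convex X"
    and rep: "prev_rep \<Sigma> X P u K M" and rep': "prev_rep \<Sigma> X P u' K' M'"
  shows "\<exists>a b. a > 0 \<and> (\<forall>x\<in>X. u' x = a * u x + b)" "\<phi> \<in> simple_space \<Sigma> \<Longrightarrow> K' \<phi> = K \<phi>"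
proof -
  have u: "affine_on X u" "lower_prev \<Sigma> K" and u': "affine_on X u'" "lower_prev \<Sigma> K'"
    using rep rep' by (auto simp: prev_rep_def)
  obtain x y where xy: "x \<in> X" "y \<in> X" "u x > u y"
    using rep unfolding prev_rep_def by (metis linorder_neqE)
  have "u x > u y \<longleftrightarrow> u' x > u' y" if "x \<in> X" "y \<in> X" for x y
    using prev_rep_const(1)[OF alg rep cact_in_acts[OF alg that(1)] that(2)]
      prev_rep_const(1)[OF alg rep' cact_in_acts[OF alg that(1)] that(2)]
      lower_prevD(4)[OF u(2)] lower_prevD(4)[OF u'(2)] by (simp add: comp_cact)
  then obtain a b where ab: "a > 0" "\<And>x. x \<in> X \<Longrightarrow> u' x = a * u x + b"
    using affine_on_ordinally_unique[OF u(1) u'(1) X xy(1,2)] xy(3) by (metis less_irrefl)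
  then show "\<exists>a b. a > 0 \<and> (\<forall>x\<in>X. u' x = a * u x + b)" by blast
  note sub = subspace_simple_space[OF alg]
  have K_eq: "K' (u \<circ> f) = K (u \<circ> f)" if f: "f \<in> acts \<Sigma> X" for f
  proof -
    note uf = comp_in_simple_space[OF alg f, of u]
    have "u' \<circ> f = a *\<^sub>R (u \<circ> f) + (\<lambda>_. b)" using ab(2) f by (auto simp: fun_eq_iff acts_def)
    then have "K' (u' \<circ> f) = a * K' (u \<circ> f) + b"
      using lower_prev_add_const[OF alg u'(2) subspace_scale[OF sub uf]] lower_prevD(2)[OF u'(2) uf ab(1)] by metis
    then have iff: "K (u \<circ> f) > u z \<longleftrightarrow> K' (u \<circ> f) > u z" if "z \<in> X" for z
      using prev_rep_const(1)[OF alg rep f that] prev_rep_const(1)[OF alg rep' f that] ab that by simp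
    \<comment> \<open>Outcomes exactly at the two thresholds rule out a strict inequality in either
      direction.\<close>
    obtain z z' where "z \<in> X" "u z = K (u \<circ> f)" "z' \<in> X" "u z' = K' (u \<circ> f)"
      using lower_prev_certainty_equivalent[OF alg X u(2,1) f] lower_prev_certainty_equivalent[OF alg X u'(2) u(1) f]
      by metis
    then show ?thesis using iff[of z] iff[of z'] by simp
  qed
  assume \<phi>: "\<phi> \<in> simple_space \<Sigma>"
  then obtain k where k: "0 < k" "\<And>s. \<bar>k * \<phi> s\<bar> \<le> 1"
    using admissible_scale[OF \<phi> \<phi>, of 1] by auto
  define f where "f s = ((1 + k * \<phi> s) / 2) *\<^sub>R x + (1 - (1 + k * \<phi> s) / 2) *\<^sub>R y" for s
  have t: "0 \<le> (1 + k * \<phi> s) / 2" "(1 + k * \<phi> s) / 2 \<le> 1" for s using k(2)[of s] by (auto simp: abs_le_iff)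
  have "f \<in> acts \<Sigma> X"
    unfolding acts_iff_finmeas
  proof (intro conjI allI)
    show "f s \<in> X" for s unfolding f_def using t[of s] xy by (intro convexD[OF X]) auto
    have "f = (\<lambda>s. ((1 + k * \<phi> s) / 2) *\<^sub>R x + (1 - (1 + k * \<phi> s) / 2) *\<^sub>R y)"
      by (rule ext) (rule f_def)
    then show "finmeas \<Sigma> f"
      using finmeas_comp[OF alg, of \<phi> "\<lambda>r. ((1 + k * r) / 2) *\<^sub>R x + (1 - (1 + k * r) / 2) *\<^sub>R y"] \<phi>
      by (simp only: mem_simple_space)
  qed
  define c where "c = (u x - u y) / 2 * k"
  have c: "c > 0" using xy k by (simp add: c_def)
  have "(u \<circ> f) s = (c *\<^sub>R \<phi> + (\<lambda>_. (u x + u y) / 2)) s" for s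
  proof -
    have "u (f s) = (1 + k * \<phi> s) / 2 * u x + (1 - (1 + k * \<phi> s) / 2) * u y"
      unfolding f_def by (rule affine_onD[OF u(1) xy(1,2) t])
    also have "\<dots> = c * \<phi> s + (u x + u y) / 2" by (simp add: c_def field_simps)
    finally show ?thesis by simp
  qed
  then have uf: "u \<circ> f = c *\<^sub>R \<phi> + (\<lambda>_. (u x + u y) / 2)" by (rule ext)
  have "L (u \<circ> f) = c * L \<phi> + (u x + u y) / 2" if L: "lower_prev \<Sigma> L" for L
    unfolding uf lower_prev_add_const[OF alg L subspace_scale[OF sub \<phi>]] lower_prevD(2)[OF L \<phi> c] ..
  from this[OF u(2)] this[OF u'(2)] K_eq[OF \<open>f \<in> acts \<Sigma> X\<close>] show "K' \<phi> = K \<phi>" using c by simp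
qed

text \<open>The supremum over \<open>D\<close> is the conjugate of the infimum over
  \<open>D\<close>. The integral against a common element of \<open>C\<close> and \<open>D\<close>
  lies between the lower and the upper functional, which is the inequality required by
  \<open>prev_rep\<close>.\<close>

lemma represents_iff_prev_rep:
  assumes alg: "algebra UNIV \<Sigma>"
  shows "represents \<Sigma> X P u C D \<longleftrightarrow>
    C \<subseteq> fa_probs \<Sigma> \<and> D \<subseteq> fa_probs \<Sigma> \<and> C \<inter> D \<noteq> {} \<and> convex_probs C \<and> convex_probs D \<and>
    compact C \<and> compact D \<and>
    prev_rep \<Sigma> X P u (\<lambda>\<phi>. INF p\<in>C. simple_integral p \<phi>) (\<lambda>\<phi>. INF p\<in>D. simple_integral p \<phi>)"
proof (cases "C \<subseteq> fa_probs \<Sigma> \<and> D \<subseteq> fa_probs \<Sigma> \<and> C \<inter> D \<noteq> {}")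
  case True
  then have C: "C \<subseteq> fa_probs \<Sigma>" and D: "D \<subseteq> fa_probs \<Sigma>" and CD: "C \<inter> D \<noteq> {}" by auto
  note sub = subspace_simple_space[OF alg]
  have neg: "simple_integral p (- \<phi>) = - simple_integral p \<phi>" if "p \<in> fa_probs \<Sigma>" "\<phi> \<in> simple_space \<Sigma>" for p \<phi>
    using simple_integral_cmult[OF alg that(1), of \<phi> "- 1"] that(2) by (simp add: mem_simple_space)
  have INF: "(INF p\<in>C. fa_integral \<Sigma> p (u \<circ> f)) = (INF p\<in>C. simple_integral p (u \<circ> f))" if "f \<in> acts \<Sigma> X" for f
    using comp_in_simple_space[OF alg that, of u] C fa_integral_simple[OF alg]
    by (intro INF_cong refl) (auto simp: mem_simple_space)
  have SUP: "(SUP p\<in>D. fa_integral \<Sigma> p (u \<circ> f)) = - (INF p\<in>D. simple_integral p (- (u \<circ> f)))"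
    if f: "f \<in> acts \<Sigma> X" for f
  proof -
    note uf = comp_in_simple_space[OF alg f, of u]
    have "(SUP p\<in>D. fa_integral \<Sigma> p (u \<circ> f)) = (SUP p\<in>D. - simple_integral p (- (u \<circ> f)))"
      using uf D fa_integral_simple[OF alg] neg[OF _ uf]
      by (intro SUP_cong refl) (auto simp: mem_simple_space)
    also have "\<dots> = - (INF p\<in>D. simple_integral p (- (u \<circ> f)))"
      by (simp add: Inf_real_def image_image)
    finally show ?thesis .
  qed
  have lp: "lower_prev \<Sigma> (\<lambda>\<phi>. INF p\<in>C. simple_integral p \<phi>)" "lower_prev \<Sigma> (\<lambda>\<phi>. INF p\<in>D. simple_integral p \<phi>)"
    using lower_prev_INF[OF alg C] lower_prev_INF[OF alg D] CD by auto
  obtain p where p: "p \<in> C" "p \<in> D" using CD by blast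
  have le: "(INF p\<in>C. simple_integral p \<phi>) \<le> - (INF p\<in>D. simple_integral p (- \<phi>))" if \<phi>: "\<phi> \<in> simple_space \<Sigma>" for \<phi>
  proof -
    have "(INF p\<in>C. simple_integral p \<phi>) \<le> simple_integral p \<phi>"
      by (rule cINF_lower[OF bdd_below_simple_integral[OF alg C \<phi>] p(1)])
    moreover have "(INF p\<in>D. simple_integral p (- \<phi>)) \<le> simple_integral p (- \<phi>)"
      by (rule cINF_lower[OF bdd_below_simple_integral[OF alg D subspace_neg[OF sub \<phi>]] p(2)])
    ultimately show ?thesis using neg[OF _ \<phi>, of p] p C by auto
  qed
  show ?thesis
    unfolding represents_def prev_rep_def compactin_weak_star[OF alg C] compactin_weak_star[OF alg D]
    using C D CD lp le by (auto simp: INF SUP)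
next
  case False
  then show ?thesis by (auto simp: represents_def)
qed

lemma represents_core:
  assumes alg: "algebra UNIV \<Sigma>" and rep: "prev_rep \<Sigma> X P u K M"
  shows "represents \<Sigma> X P u (core \<Sigma> K) (core \<Sigma> M)"
proof -
  have K: "lower_prev \<Sigma> K" and M: "lower_prev \<Sigma> M" and le: "\<And>\<phi>. \<phi> \<in> simple_space \<Sigma> \<Longrightarrow> K \<phi> \<le> - M (- \<phi>)"
    using rep by (auto simp: prev_rep_def)
  note INF = INF_core[OF alg K] INF_core[OF alg M]
  have sub: "core \<Sigma> K \<subseteq> fa_probs \<Sigma>" "core \<Sigma> M \<subseteq> fa_probs \<Sigma>" by (auto simp: core_def)
  have ne: "core \<Sigma> K \<inter> core \<Sigma> M \<noteq> {}" by (rule cores_intersect[OF alg K M le])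
  have lp: "lower_prev \<Sigma> (\<lambda>\<phi>. INF p\<in>core \<Sigma> K. simple_integral p \<phi>)"
    "lower_prev \<Sigma> (\<lambda>\<phi>. INF p\<in>core \<Sigma> M. simple_integral p \<phi>)"
    using lower_prev_INF[OF alg sub(1)] lower_prev_INF[OF alg sub(2)] ne by auto
  note V = comp_in_simple_space[OF alg] and neg = subspace_neg[OF subspace_simple_space[OF alg]]
  have "prev_rep \<Sigma> X P u (\<lambda>\<phi>. INF p\<in>core \<Sigma> K. simple_integral p \<phi>) (\<lambda>\<phi>. INF p\<in>core \<Sigma> M. simple_integral p \<phi>)"
    unfolding prev_rep_def
  proof (intro conjI ballI)
    show "(INF p\<in>core \<Sigma> K. simple_integral p \<phi>) \<le> - (INF p\<in>core \<Sigma> M. simple_integral p (- \<phi>))"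
      if "\<phi> \<in> simple_space \<Sigma>" for \<phi>
      using le[OF that] unfolding INF(1)[OF that] INF(2)[OF neg[OF that]] .
    fix f g assume f: "f \<in> acts \<Sigma> X" and g: "g \<in> acts \<Sigma> X"
    show "P f g \<longleftrightarrow> (INF p\<in>core \<Sigma> K. simple_integral p (u \<circ> g)) < (INF p\<in>core \<Sigma> K. simple_integral p (u \<circ> f)) \<and>
      (INF p\<in>core \<Sigma> M. simple_integral p (- (u \<circ> f))) < (INF p\<in>core \<Sigma> M. simple_integral p (- (u \<circ> g)))"
      unfolding INF(1)[OF V[OF f]] INF(1)[OF V[OF g]] INF(2)[OF neg[OF V[OF f]]] INF(2)[OF neg[OF V[OF g]]]
      using rep f g by (simp add: prev_rep_def)
  qed (use rep lp in \<open>auto simp: prev_rep_def\<close>)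
  then show ?thesis
    unfolding represents_iff_prev_rep[OF alg]
    using sub ne convex_core compact_core[OF alg] by blast
qed

lemma represents_unique:
  assumes alg: "algebra UNIV \<Sigma>" and X: "convex X"
    and rep: "represents \<Sigma> X P u C D" and rep': "represents \<Sigma> X P u' C' D'"
  shows "\<exists>a b. a > 0 \<and> (\<forall>x\<in>X. u' x = a * u x + b)" "C' = C" "D' = D"
proof -
  note r = rep[unfolded represents_iff_prev_rep[OF alg]] and r' = rep'[unfolded represents_iff_prev_rep[OF alg]]
  have p: "prev_rep \<Sigma> X P u (\<lambda>\<phi>. INF p\<in>C. simple_integral p \<phi>) (\<lambda>\<phi>. INF p\<in>D. simple_integral p \<phi>)"
    and p': "prev_rep \<Sigma> X P u' (\<lambda>\<phi>. INF p\<in>C'. simple_integral p \<phi>) (\<lambda>\<phi>. INF p\<in>D'. simple_integral p \<phi>)"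
    using r r' by blast+
  note uniq = prev_rep_unique[OF alg X p p']
    and uniq_dual = prev_rep_unique[OF alg X prev_rep_dual[OF alg p] prev_rep_dual[OF alg p']]
  show "\<exists>a b. a > 0 \<and> (\<forall>x\<in>X. u' x = a * u x + b)" by (rule uniq(1))
  have eq: "A' = A"
    if "A \<subseteq> fa_probs \<Sigma>" "compact A" "convex_probs A" "A \<noteq> {}" "A' \<subseteq> fa_probs \<Sigma>" "compact A'" "convex_probs A'" "A' \<noteq> {}"
      "\<And>\<phi>. \<phi> \<in> simple_space \<Sigma> \<Longrightarrow> (INF p\<in>A'. simple_integral p \<phi>) = (INF p\<in>A. simple_integral p \<phi>)" for A A'
    using subset_of_INF_le[OF alg that(1-4) that(5)] subset_of_INF_le[OF alg that(5-8) that(1)] that(9)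
    by (intro antisym) auto
  show "C' = C" by (rule eq) (use r r' uniq(2) in auto)
  \<comment> \<open>In the reversed preference the infimum over \<open>D\<close> plays the part of
    \<open>K\<close>.\<close>
  show "D' = D" by (rule eq) (use r r' uniq_dual(2) in auto)
qed

theorem theorem1:
  fixes \<Sigma> :: "'s set set" and X :: "'x::real_vector set"
    and P :: "('s \<Rightarrow> 'x) \<Rightarrow> ('s \<Rightarrow> 'x) \<Rightarrow> bool"
  assumes "algebra UNIV \<Sigma>"
    and "convex X"
    and "\<exists>x\<in>X. \<exists>y\<in>X. x \<noteq> y"
  shows "axioms_A1_A7 \<Sigma> X P \<longleftrightarrow>
    (\<exists>u C D. represents \<Sigma> X P u C D \<and>
       (\<forall>u' C' D'. represents \<Sigma> X P u' C' D' \<longrightarrow>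
          (\<exists>a b. a > 0 \<and> (\<forall>x\<in>X. u' x = a * u x + b)) \<and> C' = C \<and> D' = D))"
proof
  assume "axioms_A1_A7 \<Sigma> X P"
  then obtain u K M where "prev_rep \<Sigma> X P u K M"
    using axioms_imp_prev_rep[OF assms(1,2)] by blast
  then have rep: "represents \<Sigma> X P u (core \<Sigma> K) (core \<Sigma> M)"
    by (rule represents_core[OF assms(1)])
  show "\<exists>u C D. represents \<Sigma> X P u C D \<and>
       (\<forall>u' C' D'. represents \<Sigma> X P u' C' D' \<longrightarrow>
          (\<exists>a b. a > 0 \<and> (\<forall>x\<in>X. u' x = a * u x + b)) \<and> C' = C \<and> D' = D)"
    using rep represents_unique[OF assms(1,2) rep]
    by (intro exI[of _ u] exI[of _ "core \<Sigma> K"] exI[of _ "core \<Sigma> M"]) blast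
next
  assume "\<exists>u C D. represents \<Sigma> X P u C D \<and>
       (\<forall>u' C' D'. represents \<Sigma> X P u' C' D' \<longrightarrow>
          (\<exists>a b. a > 0 \<and> (\<forall>x\<in>X. u' x = a * u x + b)) \<and> C' = C \<and> D' = D)"
  then obtain u C D where "represents \<Sigma> X P u C D" by (elim exE conjE)
  then have "prev_rep \<Sigma> X P u (\<lambda>\<phi>. INF p\<in>C. simple_integral p \<phi>) (\<lambda>\<phi>. INF p\<in>D. simple_integral p \<phi>)"
    unfolding represents_iff_prev_rep[OF assms(1)] by (elim conjE)
  then show "axioms_A1_A7 \<Sigma> X P"
    by (rule prev_rep_imp_axioms[OF assms(1,2)])
qed

end
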